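(* Consider the stochastic cash balance problem with two-sided base-stock policies described in the context, under assumptions (B1)–(B4) there. Then the policy gradient objective $l$ satisfies the PŁK condition on $\Theta$ with constant $$\mu_l=\frac{\min_{t\in[T]}\{h_t+b_t\}^3\,\mu_D^3\,\alpha^8}{16\,e\,L_D^2\big(k+|q|+\max_{t\in[T]}\{\max\{h_t,b_t\}\}\big)^2T^4},$$ that is, $l(\theta)-l(\theta^* )\le\frac1{2\mu_l}\min_{g\in N_\Theta(\theta)}\|\nabla l(\theta)+g\|_2^2$ for all $\theta\in\Theta$.
   Context: Stochastic cash balance problem: $[T]=\{1,\dots,T\}$; $s_1$ has CDF $\rho$; real-valued (possibly negative) i.i.d. demands $D_t$ have CDF $F_D$. The decision maker moves the inventory from $s_t$ to $y_t$ (up or down), pays the transaction cost $c(y,s)=k(y-s)$ if $y\ge s$ and $c(y,s)=q(s-y)$ if $y<s$, where $k$ is the unit ordering cost, and $k+q\ge0$, and the cost $L_t(y)=\mathbb E[h_t(y-D_t)^++b_t(y-D_t)^-]$ with $h_t,b_t\ge0$, $h_t+b_t>0$, $z^-=\max\{-z,0\}$; then $s_{t+1}=y_t-D_t$. Two-sided base-stock policy with $\theta_t=(\underline\theta_t,\bar\theta_t)$: $y_t=(s_t\vee\underline\theta_t)\wedge\bar\theta_t$. $\Theta_t=\{(\underline\theta_t,\bar\theta_t):\underline B\le\underline\theta_t\le\bar\theta_t\le\bar B\}$, $\Theta=\Theta_1\times\dots\times\Theta_T$. Objective $l(\theta)=\mathbb E\big[\sum_{t=1}^T\big(c((s_t\vee\underline\theta_t)\wedge\bar\theta_t,s_t)+L_t((s_t\vee\underline\theta_t)\wedge\bar\theta_t)\big)\big]$.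 All expectations are understood to be finite; gradients at boundary points of $\Theta$ are understood as one-sided (equivalently, continuous extensions from the interior). Standing assumption: the policy class with $\theta\in\Theta$ contains an optimal policy; with $V^*_{T+1}=0$, $f_t(y)=L_t(y)+\mathbb E[V^*_{t+1}(y-D_t)]$, $V_t^*(s)=\min_y\{c(y,s)+f_t(y)\}$, the optimal parameters $\theta_t^*=(\underline\theta_t^*,\bar\theta_t^* )\in\Theta_t$ are minimizers of $ky+f_t(y)$ and $-qy+f_t(y)$ respectively. Assumptions. (B1) $s_1,D_1,\dots,D_T$ are independent. (B2) $\rho$ is $L_\rho$-Lipschitz and $F_D$ is $L_D$-Lipschitz. (B3) there is $\alpha>0$ with $\rho(\underline B)\ge\alpha$, $\rho(\bar B)\le1-\alpha$, $\mathbb P(D_t\ge\bar B-\underline B)\ge\alpha$, $\mathbb P(D_t\le\underline B-\bar B)\ge\alpha$ for all $t$. (B4) the density of $D_t$ is bounded below by $\mu_D>0$ on $[\underline B,\bar B]$. $N_\Theta(\theta)=\{g:\langle g,\theta'-\theta\rangle\le0\ \forall\theta'\in\Theta\}$ is the normal cone. *)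

theory Defs
  imports "HOL-Probability.Probability"
begin

definition trans_cost :: "real \<Rightarrow> real \<Rightarrow> real \<Rightarrow> real \<Rightarrow> real" where
  "trans_cost k q y s = (if s \<le> y then k * (y - s) else q * (s - y))"

definition hold_cost :: "real \<Rightarrow> real \<Rightarrow> real \<Rightarrow> real" where
  "hold_cost h b z = h * max z 0 + b * max (- z) 0"

definition exp_hold_cost ::
  "'w measure \<Rightarrow> (nat \<Rightarrow> 'w \<Rightarrow> real) \<Rightarrow> (nat \<Rightarrow> real) \<Rightarrow> (nat \<Rightarrow> real) \<Rightarrow> nat \<Rightarrow> real \<Rightarrow> real" where
  "exp_hold_cost M D h b t y = (\<integral>\<omega>. hold_cost (h t) (b t) (y - D t \<omega>) \<partial>M)"

definition base_stock :: "real \<times> real \<Rightarrow> real \<Rightarrow> real" where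
  "base_stock p s = min (max s (fst p)) (snd p)"

text \<open>Periods are numbered from 1; the value of the inventory at index 0 is never used.\<close>

primrec inventory ::
  "('w \<Rightarrow> real) \<Rightarrow> (nat \<Rightarrow> 'w \<Rightarrow> real) \<Rightarrow> (nat \<Rightarrow> real \<times> real) \<Rightarrow> nat \<Rightarrow> 'w \<Rightarrow> real" where
  "inventory s1 D \<theta> 0 \<omega> = s1 \<omega>"
| "inventory s1 D \<theta> (Suc t) \<omega> =
     (if t = 0 then s1 \<omega> else base_stock (\<theta> t) (inventory s1 D \<theta> t \<omega>) - D t \<omega>)"

definition total_cost ::
  "'w measure \<Rightarrow> nat \<Rightarrow> ('w \<Rightarrow> real) \<Rightarrow> (nat \<Rightarrow> 'w \<Rightarrow> real) \<Rightarrow> real \<Rightarrow> real \<Rightarrow>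
   (nat \<Rightarrow> real) \<Rightarrow> (nat \<Rightarrow> real) \<Rightarrow> (nat \<Rightarrow> real \<times> real) \<Rightarrow> 'w \<Rightarrow> real" where
  "total_cost M T s1 D k q h b \<theta> \<omega> =
     (\<Sum>t = 1..T. let s = inventory s1 D \<theta> t \<omega>; y = base_stock (\<theta> t) s
                  in trans_cost k q y s + exp_hold_cost M D h b t y)"

text \<open>
  Policy parameters form the Euclidean space \<open>(real \<times> real)^'n\<close>, where the
  map \<open>e\<close> identifies the periods 1, ..., T with the coordinates.
\<close>

definition policy_objective ::
  "'w measure \<Rightarrow> nat \<Rightarrow> (nat \<Rightarrow> 'n) \<Rightarrow> ('w \<Rightarrow> real) \<Rightarrow> (nat \<Rightarrow> 'w \<Rightarrow> real) \<Rightarrow> real \<Rightarrow> real \<Rightarrow>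
   (nat \<Rightarrow> real) \<Rightarrow> (nat \<Rightarrow> real) \<Rightarrow> (real \<times> real) ^ 'n \<Rightarrow> real" where
  "policy_objective M T e s1 D k q h b \<theta> =
     (\<integral>\<omega>. total_cost M T s1 D k q h b (\<lambda>t. \<theta> $ e t) \<omega> \<partial>M)"

definition policy_params :: "real \<Rightarrow> real \<Rightarrow> ((real \<times> real) ^ 'n) set" where
  "policy_params Blo Bhi =
     {\<theta>. \<forall>i. Blo \<le> fst (\<theta> $ i) \<and> fst (\<theta> $ i) \<le> snd (\<theta> $ i) \<and> snd (\<theta> $ i) \<le> Bhi}"

text \<open>
  The infimum below is the minimum of the dynamic programming recursion. It is taken in the reals,
  so it is meaningful only where the minimized function is bounded below; this is the case as soon
  as \<open>k * y + f\<^sub>t(y)\<close> has a minimizer and \<open>k + q \<ge> 0\<close>.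
\<close>

function opt_value ::
  "'w measure \<Rightarrow> nat \<Rightarrow> (nat \<Rightarrow> 'w \<Rightarrow> real) \<Rightarrow> real \<Rightarrow> real \<Rightarrow>
   (nat \<Rightarrow> real) \<Rightarrow> (nat \<Rightarrow> real) \<Rightarrow> nat \<Rightarrow> real \<Rightarrow> real" where
  "opt_value M T D k q h b t s =
     (if T < t then 0
      else INF y. trans_cost k q y s +
        (exp_hold_cost M D h b t y + (\<integral>\<omega>. opt_value M T D k q h b (Suc t) (y - D t \<omega>) \<partial>M)))"
  by pat_completeness auto
termination
  by (relation "Wellfounded.measure (\<lambda>(M, T, D, k, q, h, b, t, s). Suc T - t)") auto

declare opt_value.simps [simp del]

definition cost_to_go ::
  "'w measure \<Rightarrow> nat \<Rightarrow> (nat \<Rightarrow> 'w \<Rightarrow> real) \<Rightarrow> real \<Rightarrow> real \<Rightarrow>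
   (nat \<Rightarrow> real) \<Rightarrow> (nat \<Rightarrow> real) \<Rightarrow> nat \<Rightarrow> real \<Rightarrow> real" where
  "cost_to_go M T D k q h b t y =
     exp_hold_cost M D h b t y + (\<integral>\<omega>. opt_value M T D k q h b (Suc t) (y - D t \<omega>) \<partial>M)"

definition normal_cone :: "'a::real_inner set \<Rightarrow> 'a \<Rightarrow> 'a set" where
  "normal_cone S x = {g. \<forall>y\<in>S. inner g (y - x) \<le> 0}"

text \<open>
  Gradients are taken relative to the feasible set, which gives the one-sided gradient at boundary
  points and the ordinary gradient at interior points.
\<close>

definition has_gradient_within :: "('a::real_inner \<Rightarrow> real) \<Rightarrow> 'a \<Rightarrow> 'a \<Rightarrow> 'a set \<Rightarrow> bool" where
  "has_gradient_within f G x S \<longleftrightarrow> (f has_derivative (\<lambda>v. inner G v)) (at x within S)"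

text \<open>
  The normal cone is closed, convex and contains 0, so in a Euclidean space the infimum is attained.
  The gradient is unique when the set is convex with nonempty interior; in general the inequality
  is required for every gradient.
\<close>

definition PLK_condition :: "('a::euclidean_space \<Rightarrow> real) \<Rightarrow> 'a set \<Rightarrow> 'a \<Rightarrow> real \<Rightarrow> bool" where
  "PLK_condition f S xopt \<mu> \<longleftrightarrow>
     (\<forall>x\<in>S. (\<exists>G. has_gradient_within f G x S) \<and>
        (\<forall>G. has_gradient_within f G x S \<longrightarrow>
           f x - f xopt \<le> 1 / (2 * \<mu>) * (INF g\<in>normal_cone S x. (norm (G + g))\<^sup>2)))"

end

theory Submission
  imports Defs
begin

text \<open>
  Write \<open>f t\<close> for the optimal cost-to-go and \<open>Q t\<close> for the cost-to-go under the policy with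
  parameters \<open>\<theta>\<close>. The function \<open>f t\<close> is convex, and strongly convex on \<open>[Blo, Bhi]\<close> with a
  modulus of at least \<open>K = m * \<mu>\<close>, where \<open>m\<close> is the minimum of \<open>h t + b t\<close>. The suboptimality gaps
  of the two thresholds in \<open>k * y + f t y\<close> and \<open>- q * y + f t y\<close> are therefore at most
  \<open>\<xi>\<^sup>2 / (2 * K)\<close>, with \<open>\<xi>\<close> the derivative of this function at the threshold, and the objective gap is
  at most the sum of all these gaps.

  The partial derivatives of the objective are those derivatives with \<open>Q t\<close> in place of \<open>f t\<close>,
  multiplied by the probability that the threshold binds, which is at least \<open>\<alpha>\<close>. The difference
  \<open>Q t - f t\<close> is the demand average of the regret of the following periods. That regret is a sum of
  monotone functions whose total variation is the sum of the later gaps, so averaging against a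
  demand with \<open>L\<close>-Lipschitz distribution function makes \<open>Q t - f t\<close> Lipschitz with constant \<open>L\<close>
  times the sum of the later gaps.

  Let \<open>r\<close> be the norm of the gradient plus a normal vector. If \<open>4 * L * T * r \<le> K * \<alpha>\<^sup>2\<close>, backward
  induction over the periods shows that this constant is at most \<open>r\<close>, so that every \<open>\<xi>\<close> is at
  most \<open>2 * r / \<alpha>\<close> in absolute value. If \<open>r\<close> is larger, the trivial bound \<open>2 * C\<close> on \<open>\<xi>\<close> suffices,
  where \<open>C = k + \<bar>q\<bar> + max (max (h t) (b t))\<close>.
\<close>

section \<open>Costs\<close>

text \<open>The objective need not be convex in the parameters, since a threshold changes the law of
  all later stocks. Convexity is therefore used only for the one-dimensional functions
  \<open>ctg t\<close>. The obstacle is that the gradient contains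
  \<open>action_value \<theta> t\<close>, whose future follows the current policy, while convexity
  belongs to \<open>ctg t\<close>, whose future is optimal. Their derivatives have to be compared,
  so closeness of the values is not enough.

  The slopes of a later regret are only of first order in its \<open>\<xi>\<close>, but its total
  variation is a gap, hence of order \<open>\<xi>\<^sup>2\<close>. Averaging against a Lipschitz
  distribution function turns total variation into a Lipschitz constant, so the error of the
  comparison is of second order as well.

  The comparison is circular: it needs the later gaps, which are bounded through the same comparison
  in later periods. For small \<open>r\<close> the accumulated error
  \<open>L * T * (4 * r\<^sup>2 / (K * \<alpha>\<^sup>2))\<close> is still at most \<open>r\<close>;
  this is the smallness condition, and it keeps the constants from compounding over the
  periods.\<close>

lemma trans_cost_eq_max:
  "0 \<le> k + q \<Longrightarrow> trans_cost k q y s = max (k * (y - s)) (q * (s - y))"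
proof (cases "s \<le> y")
  case True
  moreover assume "0 \<le> k + q"
  ultimately have "0 \<le> (k + q) * (y - s)" by simp
  then have "q * (s - y) \<le> k * (y - s)" by (simp add: algebra_simps)
  then show ?thesis using True by (simp add: trans_cost_def)
next
  case False
  moreover assume "0 \<le> k + q"
  ultimately have "(k + q) * (y - s) \<le> 0" by (simp add: mult_nonneg_nonpos)
  then have "k * (y - s) \<le> q * (s - y)" by (simp add: algebra_simps)
  then show ?thesis using False by (simp add: trans_cost_def)
qed

text \<open>Since \<open>0 \<le> k + q\<close>, the cost is a maximum of two functions that are
  linear in the pair \<open>(y, s)\<close>. Joint convexity, and not just convexity in
  \<open>y\<close>, is what makes the minimum over \<open>y\<close> convex in
  \<open>s\<close>.\<close>

lemma trans_cost_convex:
  assumes "0 \<le> k + q" "0 \<le> u" "0 \<le> v"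
  shows "trans_cost k q (u * y + v * y') (u * s + v * s')
           \<le> u * trans_cost k q y s + v * trans_cost k q y' s'"
proof -
  have "u * (k * (y - s)) + v * (k * (y' - s')) \<le> u * trans_cost k q y s + v * trans_cost k q y' s'"
    "u * (q * (s - y)) + v * (q * (s' - y')) \<le> u * trans_cost k q y s + v * trans_cost k q y' s'"
    using assms by (auto simp: trans_cost_eq_max intro!: add_mono mult_left_mono)
  moreover have "k * (u * y + v * y' - (u * s + v * s')) = u * (k * (y - s)) + v * (k * (y' - s'))"
    "q * (u * s + v * s' - (u * y + v * y')) = u * (q * (s - y)) + v * (q * (s' - y'))"
    by (simp_all add: algebra_simps)
  ultimately show ?thesis
    using assms(1) by (simp add: trans_cost_eq_max[of k q "u * y + v * y'"])
qed

lemma trans_cost_triangle: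
  assumes "0 \<le> k + q"
  shows "trans_cost k q y s' \<le> trans_cost k q y s + trans_cost k q s s'"
proof -
  have "k * (y - s') = k * (y - s) + k * (s - s')" "q * (s' - y) = q * (s - y) + q * (s' - s)"
    by (simp_all add: algebra_simps)
  then have "k * (y - s') \<le> trans_cost k q y s + trans_cost k q s s'"
    "q * (s' - y) \<le> trans_cost k q y s + trans_cost k q s s'"
    using assms by (simp_all add: trans_cost_eq_max add_mono)
  then show ?thesis
    using assms by (simp add: trans_cost_eq_max[of k q y s'])
qed

lemma trans_cost_le_dist: "\<bar>trans_cost k q y s\<bar> \<le> max \<bar>k\<bar> \<bar>q\<bar> * \<bar>y - s\<bar>"
  unfolding trans_cost_def by (auto simp: abs_mult intro!: mult_mono)

lemma trans_cost_down: "y \<le> s \<Longrightarrow> trans_cost k q y s = q * (s - y)"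
  by (cases "y = s") (simp_all add: trans_cost_def)

text \<open>The two thresholds enter separate terms. Hence the regret against another base-stock policy
  is a function of \<open>s\<close> and the lower thresholds plus a function of \<open>s\<close> and the upper thresholds. If
  \<open>f\<close> is convex and the other thresholds are optimal, both are monotone in \<open>s\<close>.\<close>

lemma base_stock_cost:
  assumes "fst p \<le> snd p"
  shows "trans_cost k q (base_stock p s) s + f (base_stock p s)
    = (k * max s (fst p) + f (max s (fst p))) + (f (min s (snd p)) - q * min s (snd p))
      + (q - k) * s - f s"
  using assms unfolding base_stock_def trans_cost_def
  by (auto simp: algebra_simps max_def min_def)

lemma base_stock_below: "fst p \<le> snd p \<Longrightarrow> s \<le> fst p \<Longrightarrow> base_stock p s = fst p"
  by (simp add: base_stock_def)

lemma base_stock_above: "fst p \<le> snd p \<Longrightarrow> snd p \<le> s \<Longrightarrow> base_stock p s = snd p"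
  by (simp add: base_stock_def)

lemma base_stock_between: "fst p \<le> s \<Longrightarrow> s \<le> snd p \<Longrightarrow> base_stock p s = s"
  by (simp add: base_stock_def)

lemma base_stock_mem:
  "fst p \<le> snd p \<Longrightarrow> base_stock p s \<in> {fst p..snd p}"
  by (auto simp: base_stock_def)

lemma base_stock_nonexpansive: "\<bar>base_stock p s - base_stock p s'\<bar> \<le> \<bar>s - s'\<bar>"
  by (auto simp: base_stock_def)

lemma base_stock_measurable [measurable]: "base_stock p \<in> borel_measurable borel"
  unfolding base_stock_def by measurable

lemma trans_cost_lipschitz:
  "\<bar>trans_cost k q y s - trans_cost k q y' s'\<bar> \<le> max \<bar>k\<bar> \<bar>q\<bar> * (\<bar>y - y'\<bar> + \<bar>s - s'\<bar>)"
proof -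
  define pos neg :: "real \<Rightarrow> real" where "pos = (\<lambda>z. max z 0)" and "neg = (\<lambda>z. max (- z) 0)"
  have c: "trans_cost k q y s = k * pos (y - s) + q * neg (y - s)" for y s
    by (auto simp: trans_cost_def pos_def neg_def)
  define m where "m = max \<bar>k\<bar> \<bar>q\<bar>"
  have "trans_cost k q y s - trans_cost k q y' s'
      = k * (pos (y - s) - pos (y' - s')) + q * (neg (y - s) - neg (y' - s'))"
    by (simp add: c algebra_simps)
  also have "\<bar>\<dots>\<bar> \<le> m * \<bar>pos (y - s) - pos (y' - s')\<bar> + m * \<bar>neg (y - s) - neg (y' - s')\<bar>"
    by (intro order_trans[OF abs_triangle_ineq] add_mono)
      (auto simp: abs_mult m_def intro!: mult_right_mono)
  also have "\<dots> = m * (\<bar>pos (y - s) - pos (y' - s')\<bar> + \<bar>neg (y - s) - neg (y' - s')\<bar>)"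
    by (simp add: algebra_simps)
  \<comment> \<open>The positive and the negative part of a number together change by exactly as
    much as the number, so no factor 2 arises.\<close>
  also have "\<dots> \<le> m * (\<bar>y - y'\<bar> + \<bar>s - s'\<bar>)"
    by (intro mult_left_mono) (auto simp: m_def pos_def neg_def max_def)
  finally show ?thesis by (simp add: m_def)
qed

text \<open>The holding cost is formally a transaction cost out of stock 0 with rates
  \<open>h\<close> and \<open>b\<close>.\<close>

lemma hold_cost_lipschitz:
  assumes "0 \<le> h" "0 \<le> b"
  shows "(max h b)-lipschitz_on UNIV (hold_cost h b)"
proof (rule lipschitz_onI)
  fix x y :: real
  have "hold_cost h b z = trans_cost h b z 0" for z
    by (auto simp: hold_cost_def trans_cost_def)
  then show "dist (hold_cost h b x) (hold_cost h b y) \<le> max h b * dist x y"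
    using trans_cost_lipschitz[of h b x 0 y 0] assms by (simp add: dist_real_def)
qed (use assms in auto)

lemma hold_cost_convex:
  assumes "0 \<le> h" "0 \<le> b"
  shows "convex_on UNIV (hold_cost h b)"
proof (rule convex_onI)
  fix t x y :: real assume "0 < t" "t < 1"
  moreover have "hold_cost h b z = trans_cost h b z 0" for z
    by (auto simp: hold_cost_def trans_cost_def)
  ultimately show "hold_cost h b ((1 - t) *\<^sub>R x + t *\<^sub>R y)
      \<le> (1 - t) * hold_cost h b x + t * hold_cost h b y"
    using trans_cost_convex[of h b "1 - t" t x y 0 0] assms by simp
qed simp

text \<open>The decision maker may first move from \<open>s'\<close> to \<open>s\<close>.\<close>

lemma INF_trans_cost_le:
  fixes f :: "real \<Rightarrow> real"
  assumes kq: "0 \<le> k + q" and bdd: "bdd_below (range (\<lambda>y. k * y + f y))"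
  shows "(INF y. trans_cost k q y s' + f y) \<le> (INF y. trans_cost k q y s + f y) + trans_cost k q s s'"
proof -
  obtain B where B: "\<And>y. B \<le> k * y + f y"
    using bdd by (auto simp: bdd_below_def)
  have lower: "B - k * s \<le> trans_cost k q y s + f y" for y s
  proof -
    have "k * (y - s) \<le> trans_cost k q y s"
      using kq by (simp add: trans_cost_eq_max)
    with B[of y] show ?thesis by (simp add: algebra_simps)
  qed
  have "(INF y. trans_cost k q y s' + f y) - trans_cost k q s s' \<le> (INF y. trans_cost k q y s + f y)"
  proof (rule cINF_greatest)
    fix y
    have "(INF y. trans_cost k q y s' + f y) \<le> trans_cost k q y s' + f y"
      by (rule cINF_lower) (use lower in \<open>auto simp: bdd_below_def\<close>)
    then show "(INF y. trans_cost k q y s' + f y) - trans_cost k q s s' \<le> trans_cost k q y s + f y"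
      using trans_cost_triangle[OF kq, of y s' s] by linarith
  qed simp
  then show ?thesis by linarith
qed

section \<open>Averaging over the demand\<close>

text \<open>Convolution with the law of the demand: the expected value of \<open>\<phi>\<close> at
  the next stock if the level after ordering is \<open>y\<close>.\<close>

definition avg :: "real measure \<Rightarrow> (real \<Rightarrow> real) \<Rightarrow> real \<Rightarrow> real" where
  "avg \<nu> \<phi> y = (\<integral>x. \<phi> (y - x) \<partial>\<nu>)"

lemma lipschitz_on_real_bound: "C-lipschitz_on UNIV f \<Longrightarrow> \<bar>f x - f y\<bar> \<le> C * \<bar>x - y\<bar>" for f :: "real \<Rightarrow> real"
  by (metis UNIV_I dist_real_def lipschitz_onD)

lemma lipschitz_on_borel_measurable:
  fixes f :: "real \<Rightarrow> real"
  shows "C-lipschitz_on UNIV f \<Longrightarrow> f \<in> borel_measurable borel"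
  by (intro borel_measurable_continuous_onI lipschitz_on_continuous_on)

lemma lipschitz_on_realI:
  fixes f :: "real \<Rightarrow> real"
  shows "0 \<le> C \<Longrightarrow> (\<And>x y. \<bar>f x - f y\<bar> \<le> C * \<bar>x - y\<bar>) \<Longrightarrow> C-lipschitz_on UNIV f"
  by (rule lipschitz_onI) (auto simp: dist_real_def)

lemma lipschitz_derivative_bound:
  fixes f :: "real \<Rightarrow> real"
  assumes "C-lipschitz_on UNIV f" and deriv: "(f has_field_derivative d) (at x)"
  shows "\<bar>d\<bar> \<le> C"
proof (rule tendsto_upperbound)
  show "((\<lambda>y. \<bar>(f y - f x) / (y - x)\<bar>) \<longlongrightarrow> \<bar>d\<bar>) (at x)"
    using deriv by (intro tendsto_rabs) (simp add: has_field_derivative_iff)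
  have "\<bar>f y - f x\<bar> \<le> C * \<bar>y - x\<bar>" for y
    using assms(1) by (rule lipschitz_on_real_bound)
  then show "\<forall>\<^sub>F y in at x. \<bar>(f y - f x) / (y - x)\<bar> \<le> C"
    by (auto simp: eventually_at_filter divide_le_eq)
qed simp

lemma lipschitz_on_add_linear:
  fixes f :: "real \<Rightarrow> real"
  assumes "C-lipschitz_on UNIV f"
  shows "(\<bar>c\<bar> + C)-lipschitz_on UNIV (\<lambda>y. c * y + f y)"
proof (rule lipschitz_on_add[OF _ assms], rule lipschitz_on_realI)
  show "\<bar>c * x - c * y\<bar> \<le> \<bar>c\<bar> * \<bar>x - y\<bar>" for x y
    by (simp add: abs_mult flip: right_diff_distrib)
qed simp

context real_distribution
begin

lemma avg_lipschitz:
  assumes lip: "C-lipschitz_on UNIV \<phi>" and int: "\<And>y. integrable M (\<lambda>x. \<phi> (y - x))"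
  shows "C-lipschitz_on UNIV (avg M \<phi>)"
proof (rule lipschitz_onI)
  fix y z :: real
  have "\<bar>avg M \<phi> y - avg M \<phi> z\<bar> = \<bar>\<integral>x. \<phi> (y - x) - \<phi> (z - x) \<partial>M\<bar>"
    unfolding avg_def using int by simp
  also have "\<dots> \<le> (\<integral>x. \<bar>\<phi> (y - x) - \<phi> (z - x)\<bar> \<partial>M)"
    by (rule integral_abs_bound)
  also have "\<dots> \<le> (\<integral>x. C * \<bar>y - z\<bar> \<partial>M)"
    using int order_trans[OF lipschitz_on_real_bound[OF lip]] by (intro integral_mono) auto
  finally show "dist (avg M \<phi> y) (avg M \<phi> z) \<le> C * dist y z"
    by (simp add: dist_real_def prob_space[simplified])
qed (rule lipschitz_on_nonneg[OF lip])

lemma avg_convex: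
  assumes conv: "convex_on UNIV \<phi>" and int: "\<And>y. integrable M (\<lambda>x. \<phi> (y - x))"
  shows "convex_on UNIV (avg M \<phi>)"
proof (rule convex_onI)
  fix t x y :: real assume t: "0 < t" "t < 1"
  have "avg M \<phi> ((1 - t) * x + t * y) \<le> (\<integral>z. (1 - t) * \<phi> (x - z) + t * \<phi> (y - z) \<partial>M)"
    unfolding avg_def
  proof (intro integral_mono)
    fix z
    have "(1 - t) * x + t * y - z = (1 - t) * (x - z) + t * (y - z)" by (simp add: algebra_simps)
    then show "\<phi> ((1 - t) * x + t * y - z) \<le> (1 - t) * \<phi> (x - z) + t * \<phi> (y - z)"
      using convex_onD[OF conv, of t "x - z" "y - z"] t by simp
  qed (use int in auto)
  also have "\<dots> = (1 - t) * avg M \<phi> x + t * avg M \<phi> y"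
    unfolding avg_def using int by simp
  finally show "avg M \<phi> ((1 - t) *\<^sub>R x + t *\<^sub>R y) \<le> (1 - t) * avg M \<phi> x + t * avg M \<phi> y"
    by simp
qed simp

text \<open>Dominated convergence: the Lipschitz constant bounds all difference quotients. A kink at
  \<open>z\<close> matters only for the demand \<open>y - z\<close>, and an atomless law gives
  countably many such demands probability 0. In this way the demand smooths the kinks that
  thresholds create.\<close>

lemma avg_has_derivative:
  assumes lip: "C-lipschitz_on UNIV \<phi>" and int: "\<And>y. integrable M (\<lambda>x. \<phi> (y - x))"
    and N: "countable N" "\<And>x. measure M {x} = 0"
    and [measurable]: "\<phi>' \<in> borel_measurable borel"
    and deriv: "\<And>z. z \<notin> N \<Longrightarrow> (\<phi> has_field_derivative \<phi>' z) (at z)"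
  shows "(avg M \<phi> has_field_derivative avg M \<phi>' y) (at y)"
proof -
  note [measurable] = lipschitz_on_borel_measurable[OF lip]
  have "(\<lambda>z. (avg M \<phi> z - avg M \<phi> y) / (z - y)) \<midarrow>y\<rightarrow> avg M \<phi>' y"
    unfolding tendsto_at_iff_sequentially
  proof (intro allI impI)
    fix X assume X: "\<forall>i. X i \<in> UNIV - {y}" and lim: "X \<longlonglongrightarrow> y"
    let ?d = "\<lambda>i x. (\<phi> (X i - x) - \<phi> (y - x)) / (X i - y)"
    have "(\<lambda>i. \<integral>x. ?d i x \<partial>M) \<longlonglongrightarrow> (\<integral>x. \<phi>' (y - x) \<partial>M)"
    proof (rule integral_dominated_convergence[where w = "\<lambda>_. C"])
      have "AE x in M. x \<notin> (\<lambda>z. y - z) ` N"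
      proof (rule AE_not_in)
        have "(\<Union>x\<in>(\<lambda>z. y - z) ` N. {x}) \<in> null_sets M"
          using N by (intro null_sets_UN') (auto simp: null_sets_def emeasure_eq_measure)
        then show "(\<lambda>z. y - z) ` N \<in> null_sets M" by simp
      qed
      then show "AE x in M. (\<lambda>i. ?d i x) \<longlonglongrightarrow> \<phi>' (y - x)"
      proof eventually_elim
        fix x assume "x \<notin> (\<lambda>z. y - z) ` N"
        then have "y - x \<notin> N" by (metis (no_types, lifting) diff_diff_eq2 add_diff_cancel_left' image_iff)
        from deriv[OF this] have "(\<lambda>w. (\<phi> w - \<phi> (y - x)) / (w - (y - x))) \<midarrow>y - x\<rightarrow> \<phi>' (y - x)"
          by (simp add: has_field_derivative_iff)
        then have "((\<lambda>w. (\<phi> w - \<phi> (y - x)) / (w - (y - x))) \<circ> (\<lambda>i. X i - x)) \<longlonglongrightarrow> \<phi>' (y - x)"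
          using X tendsto_diff[OF lim tendsto_const, of x]
          by (intro tendsto_at_iff_sequentially[THEN iffD1, rule_format]) auto
        then show "(\<lambda>i. ?d i x) \<longlonglongrightarrow> \<phi>' (y - x)"
          by (simp add: o_def)
      qed
      fix i
      show "AE x in M. norm (?d i x) \<le> C"
      proof (rule AE_I2)
        fix x
        have "\<bar>\<phi> (X i - x) - \<phi> (y - x)\<bar> \<le> C * \<bar>X i - y\<bar>"
          using lipschitz_on_real_bound[OF lip, of "X i - x" "y - x"] by simp
        then show "norm (?d i x) \<le> C"
          using X by (simp add: divide_le_eq)
      qed
    qed auto
    moreover have "(\<integral>x. ?d i x \<partial>M) = (avg M \<phi> (X i) - avg M \<phi> y) / (X i - y)" for i
    proof -
      have "(\<integral>x. \<phi> (X i - x) - \<phi> (y - x) \<partial>M) = avg M \<phi> (X i) - avg M \<phi> y"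
        unfolding avg_def using int by (intro Bochner_Integration.integral_diff)
      then show ?thesis by simp
    qed
    ultimately have "(\<lambda>i. (avg M \<phi> (X i) - avg M \<phi> y) / (X i - y)) \<longlonglongrightarrow> avg M \<phi>' y"
      unfolding avg_def[of M \<phi>'] by (simp only:)
    then show "((\<lambda>z. (avg M \<phi> z - avg M \<phi> y) / (z - y)) \<circ> X) \<longlonglongrightarrow> avg M \<phi>' y"
      by (simp add: o_def)
  qed
  then show ?thesis by (simp add: has_field_derivative_iff)
qed

lemma avg_differentiable:
  assumes lip: "C-lipschitz_on UNIV \<phi>" and int: "\<And>y. integrable M (\<lambda>x. \<phi> (y - x))"
    and N: "countable N" "\<And>x. measure M {x} = 0"
    and diff: "\<And>z. z \<notin> N \<Longrightarrow> \<phi> differentiable (at z)"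
  shows "avg M \<phi> differentiable (at y)"
proof -
  note [measurable] = lipschitz_on_borel_measurable[OF lip]
  \<comment> \<open>Taking the limit along the steps \<open>1 / (n + 1)\<close> makes the derivative
    measurable. The values of \<open>lim\<close> on \<open>N\<close> do not affect the
    integral.\<close>
  define \<phi>' where "\<phi>' z = lim (\<lambda>n. (\<phi> (z + inverse (real (Suc n))) - \<phi> z) * real (Suc n))" for z
  have [measurable]: "\<phi>' \<in> borel_measurable borel"
    unfolding \<phi>'_def by (intro borel_measurable_lim_metric) measurable
  have "(\<phi> has_field_derivative \<phi>' z) (at z)" if z: "z \<notin> N" for z
  proof -
    obtain d where d: "(\<phi> has_field_derivative d) (at z)"
      using diff[OF z] by (auto simp: real_differentiable_def)
    then have "((\<lambda>w. (\<phi> (z + w) - \<phi> z) / w) \<circ> (\<lambda>n. inverse (real (Suc n)))) \<longlonglongrightarrow> d"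
      unfolding DERIV_def tendsto_at_iff_sequentially
      using LIMSEQ_inverse_real_of_nat by auto
    then have "(\<lambda>n. (\<phi> (z + inverse (real (Suc n))) - \<phi> z) * real (Suc n)) \<longlonglongrightarrow> d"
      by (simp add: o_def field_simps)
    then show ?thesis using d by (simp add: \<phi>'_def limI)
  qed
  then have "(avg M \<phi> has_field_derivative avg M \<phi>' y) (at y)"
    by (intro avg_has_derivative[OF lip int N]) auto
  then show ?thesis
    by (auto simp: real_differentiable_def)
qed

text \<open>The set lies between its infimum and its supremum, which are at most
  \<open>\<delta>\<close> apart. Differences of \<open>cdf\<close> measure half-open intervals, so
  the infimum is split off; it carries no mass because \<open>cdf M\<close> is continuous.\<close>

lemma measure_le_cdf_lipschitz:
  assumes cdf: "L-lipschitz_on UNIV (cdf M)" and A: "A \<in> sets M" and \<delta>: "0 \<le> \<delta>"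
    and diam: "\<And>x y. x \<in> A \<Longrightarrow> y \<in> A \<Longrightarrow> y - x \<le> \<delta>"
  shows "measure M A \<le> L * \<delta>"
proof (cases "A = {}")
  case True
  then show ?thesis using lipschitz_on_nonneg[OF cdf] \<delta> by simp
next
  case False
  then obtain a where a: "a \<in> A" by blast
  have bdd: "bdd_above A" "bdd_below A"
    using diam[OF a] diam[OF _ a]
    by (force simp: algebra_simps intro!: bdd_aboveI[of _ "a + \<delta>"] bdd_belowI[of _ "a - \<delta>"])+
  have "Sup A \<le> \<delta> + Inf A"
  proof (rule cSup_least[OF False])
    fix y assume "y \<in> A"
    then have "y - \<delta> \<le> Inf A"
      using diam by (intro cInf_greatest[OF False]) (force simp: algebra_simps)
    then show "y \<le> \<delta> + Inf A" by simp
  qed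
  moreover have "A \<subseteq> {Inf A} \<union> {Inf A<..Sup A}"
    using cSup_upper[OF _ bdd(1)] cInf_lower[OF _ bdd(2)] by (auto simp: less_le)
  then have "measure M A \<le> measure M {Inf A} + measure M {Inf A<..Sup A}"
    using A by (intro order_trans[OF finite_measure_mono measure_Un_le]) auto
  moreover have "isCont (cdf M) (Inf A)"
    using lipschitz_on_continuous_on[OF cdf] by (simp add: continuous_on_eq_continuous_at)
  then have "measure M {Inf A} = 0" by (simp add: isCont_cdf)
  moreover have "measure M {Inf A<..Sup A} \<le> L * (Sup A - Inf A)"
  proof (cases "Inf A < Sup A")
    case True
    then show ?thesis
      using lipschitz_on_real_bound[OF cdf, of "Sup A" "Inf A"] by (simp add: cdf_diff_eq)
  next
    case False
    then have "Inf A = Sup A" using cInf_le_cSup[OF \<open>A \<noteq> {}\<close> bdd] by simp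
    then show ?thesis by simp
  qed
  ultimately have "measure M A \<le> L * (Sup A - Inf A)" by simp
  also have "\<dots> \<le> L * \<delta>"
    using \<open>Sup A \<le> \<delta> + Inf A\<close> lipschitz_on_nonneg[OF cdf] by (intro mult_left_mono) auto
  finally show ?thesis .
qed

text \<open>For \<open>v\<close> and \<open>w\<close> in the difference of the two superlevel sets,
  \<open>\<phi> (y - v) < r \<le> \<phi> (z - w)\<close>, and monotonicity gives
  \<open>w - v < z - y\<close>. So the difference has diameter at most \<open>z - y\<close>,
  whatever the level \<open>r\<close>.\<close>

lemma measure_superlevel_lipschitz:
  fixes \<phi> :: "real \<Rightarrow> real"
  assumes cdf: "L-lipschitz_on UNIV (cdf M)" and mono: "mono \<phi>" and "y \<le> z"
  shows "measure M {x. r \<le> \<phi> (z - x)} \<le> measure M {x. r \<le> \<phi> (y - x)} + L * (z - y)"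
    and "measure M {x. r \<le> \<phi> (y - x)} \<le> measure M {x. r \<le> \<phi> (z - x)}"
proof -
  have [measurable]: "\<phi> \<in> borel_measurable borel" using mono by (rule borel_measurable_mono)
  have [measurable]: "{x. r \<le> \<phi> (y - x)} \<in> sets M" for y
    using measurable_sets[of "\<lambda>x. \<phi> (y - x)" borel borel "{r..}"] by (simp add: vimage_def)
  have "measure M {x. r \<le> \<phi> (z - x)}
      \<le> measure M {x. r \<le> \<phi> (y - x)} + measure M ({x. r \<le> \<phi> (z - x)} - {x. r \<le> \<phi> (y - x)})"
    by (intro order_trans[OF finite_measure_mono measure_Un_le]) auto
  moreover have "measure M ({x. r \<le> \<phi> (z - x)} - {x. r \<le> \<phi> (y - x)}) \<le> L * (z - y)"
  proof (intro measure_le_cdf_lipschitz[OF cdf])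
    fix v w assume "v \<in> {x. r \<le> \<phi> (z - x)} - {x. r \<le> \<phi> (y - x)}"
      "w \<in> {x. r \<le> \<phi> (z - x)} - {x. r \<le> \<phi> (y - x)}"
    then have "\<not> \<phi> (z - w) \<le> \<phi> (y - v)" by simp
    then have "\<not> z - w \<le> y - v" using mono by (auto dest: monoD)
    then show "w - v \<le> z - y" by simp
  qed (use \<open>y \<le> z\<close> in auto)
  ultimately show "measure M {x. r \<le> \<phi> (z - x)} \<le> measure M {x. r \<le> \<phi> (y - x)} + L * (z - y)"
    by simp
  show "measure M {x. r \<le> \<phi> (y - x)} \<le> measure M {x. r \<le> \<phi> (z - x)}"
    using order_trans[OF _ monoD[OF mono]] \<open>y \<le> z\<close> by (intro finite_measure_mono) auto
qed

text \<open>Layer cake: up to \<open>c / n\<close>, a monotone function with values in \<open>[0, c]\<close> is the sum of the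
  indicator functions of \<open>n\<close> half-lines with weight \<open>c / n\<close>, and the average of the indicator
  function of a half-line is a translate of the distribution function.\<close>

lemma avg_mono_lipschitz:
  assumes mono: "mono \<phi>" and range: "\<And>x. 0 \<le> \<phi> x \<and> \<phi> x \<le> c"
    and cdf: "L-lipschitz_on UNIV (cdf M)"
  shows "(L * c)-lipschitz_on UNIV (avg M \<phi>)"
proof -
  have [measurable]: "\<phi> \<in> borel_measurable borel" using mono by (rule borel_measurable_mono)
  have int: "integrable M (\<lambda>x. \<phi> (y - x))" for y
    using range by (intro integrable_const_bound[where B = c]) auto
  have L: "0 \<le> L" using cdf by (rule lipschitz_on_nonneg)
  have c: "0 \<le> c" using range[of 0] by linarith
  have main: "\<bar>avg M \<phi> z - avg M \<phi> y\<bar> \<le> L * c * (z - y)" if yz: "y \<le> z" for y z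
  \<comment> \<open>The levels below are spaced by \<open>c / n\<close>, and counting them divides
    by \<open>c\<close>.\<close>
  proof (cases "c = 0")
    case True
    then have "\<phi> = (\<lambda>_. 0)" using range by (auto intro!: ext antisym)
    then show ?thesis using True by (simp add: avg_def)
  next
    case False
    then have c_pos: "0 < c" using c by simp
    have approx: "\<bar>avg M \<phi> z - avg M \<phi> y\<bar> \<le> L * c * (z - y) + c * inverse (real (Suc m))" for m
    proof -
      define n where "n = Suc m"
      then have n_pos: "0 < real n" by simp
      \<comment> \<open>\<open>S y x\<close> collects the levels reached by
        \<open>\<phi> (y - x)\<close>; its cardinality is the floor of
        \<open>n * \<phi> (y - x) / c\<close>.\<close>
      define S where "S y x = {i \<in> {1..n}. real i * c / n \<le> \<phi> (y - x)}" for y x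
      have S: "real (card (S y x)) \<le> n * \<phi> (y - x) / c" "n * \<phi> (y - x) / c < real (card (S y x)) + 1" for y x
      proof -
        define r where "r = n * \<phi> (y - x) / c"
        have "0 \<le> r" "r \<le> n"
          using range[of "y - x"] c_pos by (simp_all add: r_def divide_le_eq mult_left_mono)
        then have fl: "0 \<le> \<lfloor>r\<rfloor>" "nat \<lfloor>r\<rfloor> \<le> n"
          using floor_mono[of r n] by auto
        have "real i * c / n \<le> \<phi> (y - x) \<longleftrightarrow> i \<le> nat \<lfloor>r\<rfloor>" for i
        proof -
          have "real i * c / n \<le> \<phi> (y - x) \<longleftrightarrow> real i \<le> r"
            using c_pos by (simp add: n_def r_def field_simps)
          also have "\<dots> \<longleftrightarrow> int i \<le> \<lfloor>r\<rfloor>" by (simp add: le_floor_iff)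
          also have "\<dots> \<longleftrightarrow> i \<le> nat \<lfloor>r\<rfloor>" using fl(1) by linarith
          finally show ?thesis .
        qed
        then have "S y x = {i \<in> {1..n}. i \<le> nat \<lfloor>r\<rfloor>}" by (simp only: S_def)
        also have "\<dots> = {1..nat \<lfloor>r\<rfloor>}" using fl(2) by (auto simp del: nat_le_iff)
        finally have "real (card (S y x)) = of_int \<lfloor>r\<rfloor>" using fl(1) by simp
        then show "real (card (S y x)) \<le> n * \<phi> (y - x) / c" "n * \<phi> (y - x) / c < real (card (S y x)) + 1"
          by (simp_all flip: r_def)
      qed
      define G where "G i y = measure M {x. real i * c / n \<le> \<phi> (y - x)}" for i y
      have [measurable]: "{x. real i * c / n \<le> \<phi> (y - x)} \<in> sets M" for i y
        using measurable_sets[of "\<lambda>x. \<phi> (y - x)" borel borel "{real i * c / n..}"] by (simp add: vimage_def)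
      have ind: "real (card (S y x)) = (\<Sum>i=1..n. indicator {x. real i * c / n \<le> \<phi> (y - x)} x)" for x y
        by (simp add: S_def indicator_def sum.If_cases Int_def)
      have G: "(\<integral>x. real (card (S y x)) \<partial>M) = (\<Sum>i=1..n. G i y)" for y
      proof -
        have "(\<integral>x. real (card (S y x)) \<partial>M)
            = (\<Sum>i=1..n. \<integral>x. indicator {x. real i * c / n \<le> \<phi> (y - x)} x \<partial>M)"
          unfolding ind
          by (intro Bochner_Integration.integral_sum integrable_real_indicator) (auto simp: emeasure_eq_measure)
        then show ?thesis by (simp add: G_def)
      qed
      have "card (S y x) \<le> n" for y x
      proof -
        have "S y x \<subseteq> {1..n}" unfolding S_def by blast
        from card_mono[OF _ this] show ?thesis by simp
      qed
      moreover have "(\<lambda>x. real (card (S y x))) \<in> borel_measurable M" for y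
        unfolding ind by measurable
      ultimately have int_S: "integrable M (\<lambda>x. real (card (S y x)))" for y
        by (intro integrable_const_bound[where B = n]) auto
      have avg: "avg M \<phi> y - c / n * (\<Sum>i=1..n. G i y) \<in> {0..c / n}" for y
      proof -
        have "0 \<le> \<phi> (y - x) - c / n * real (card (S y x))" "\<phi> (y - x) - c / n * real (card (S y x)) \<le> c / n" for x
        proof -
          have "c * card (S y x) \<le> n * \<phi> (y - x)" "n * \<phi> (y - x) - c * card (S y x) \<le> c"
            using c_pos n_pos S(1)[of y x] less_imp_le[OF S(2)[of y x]] by (simp_all add: field_simps)
          moreover have "\<phi> (y - x) - c / n * card (S y x) = (n * \<phi> (y - x) - c * card (S y x)) / n"
            using n_pos by (simp add: field_simps)
          ultimately show "0 \<le> \<phi> (y - x) - c / n * real (card (S y x))" "\<phi> (y - x) - c / n * real (card (S y x)) \<le> c / n"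
            using n_pos by (simp_all add: divide_right_mono)
        qed
        moreover have "(\<integral>x. \<phi> (y - x) - c / n * real (card (S y x)) \<partial>M) = avg M \<phi> y - c / n * (\<Sum>i=1..n. G i y)"
          using int int_S by (simp add: G avg_def)
        moreover have "integrable M (\<lambda>x. \<phi> (y - x) - c / n * real (card (S y x)))"
          using int int_S by simp
        ultimately show ?thesis
          using Bochner_Integration.integral_nonneg[of M "\<lambda>x. \<phi> (y - x) - c / n * real (card (S y x))"]
            integral_le_const[of "\<lambda>x. \<phi> (y - x) - c / n * real (card (S y x))" "c / n"] by auto
      qed
      \<comment> \<open>Each of the \<open>n\<close> levels contributes at most
        \<open>L * (z - y)\<close> with weight \<open>c / n\<close>, so the total
        \<open>L * c * (z - y)\<close> does not depend on \<open>n\<close>.\<close>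
      have "G i y \<le> G i z" "G i z \<le> G i y + L * (z - y)" for i
        unfolding G_def using measure_superlevel_lipschitz[OF cdf mono yz] by auto
      then have "(\<Sum>i=1..n. G i y) \<le> (\<Sum>i=1..n. G i z)" "(\<Sum>i=1..n. G i z) \<le> (\<Sum>i=1..n. G i y + L * (z - y))"
        by (auto intro!: sum_mono)
      then have "c / n * (\<Sum>i=1..n. G i y) \<le> c / n * (\<Sum>i=1..n. G i z)"
          "c / n * (\<Sum>i=1..n. G i z) \<le> c / n * ((\<Sum>i=1..n. G i y) + n * (L * (z - y)))"
        using c_pos n_pos by (intro mult_left_mono; simp add: sum.distrib)+
      moreover have "c / n * ((\<Sum>i=1..n. G i y) + n * (L * (z - y))) = c / n * (\<Sum>i=1..n. G i y) + L * c * (z - y)"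
        by (simp add: n_def field_simps)
      moreover have "0 \<le> L * c * (z - y)" using L c yz by simp
      ultimately show ?thesis
        using avg[of y] avg[of z] by (auto simp: n_def divide_inverse abs_le_iff)
    qed
    have "(\<lambda>m. L * c * (z - y) + c * inverse (real (Suc m))) \<longlonglongrightarrow> L * c * (z - y) + c * 0"
      by (intro tendsto_intros LIMSEQ_inverse_real_of_nat)
    then show ?thesis
      using approx by (intro LIMSEQ_le_const[where X = "\<lambda>m. L * c * (z - y) + c * inverse (real (Suc m))"]) auto
  qed
  show ?thesis
  proof (rule lipschitz_onI)
    fix y z :: real
    show "dist (avg M \<phi> y) (avg M \<phi> z) \<le> L * c * dist y z"
      using main[of y z] main[of z y] by (cases "y \<le> z") (auto simp: dist_real_def abs_minus_commute)
  qed (use L c in simp)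
qed

lemma avg_antimono_lipschitz:
  assumes mono: "antimono \<phi>" and range: "\<And>x. 0 \<le> \<phi> x \<and> \<phi> x \<le> c"
    and cdf: "L-lipschitz_on UNIV (cdf M)"
  shows "(L * c)-lipschitz_on UNIV (avg M \<phi>)"
proof -
  have "mono (\<lambda>x. c - \<phi> x)"
    using antimonoD[OF mono] by (intro monoI) simp
  then have lip: "(L * c)-lipschitz_on UNIV (avg M (\<lambda>x. c - \<phi> x))"
    using range by (intro avg_mono_lipschitz[OF _ _ cdf]) auto
  have "mono (\<lambda>x. - \<phi> x)"
    using antimonoD[OF mono] by (intro monoI) simp
  from borel_measurable_mono[OF this] have [measurable]: "\<phi> \<in> borel_measurable borel"
    by simp
  have "integrable M (\<lambda>x. \<phi> (y - x))" for y
    using range by (intro integrable_const_bound[where B = c]) auto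
  then have "avg M (\<lambda>x. c - \<phi> x) y = c - avg M \<phi> y" for y
    by (simp add: avg_def prob_space[simplified])
  then show ?thesis
    using lipschitz_on_real_bound[OF lip] lipschitz_on_nonneg[OF lip]
    by (intro lipschitz_on_realI) (auto simp: abs_minus_commute)
qed

lemma avg_abs_le:
  assumes [measurable]: "\<phi> \<in> borel_measurable borel" and bound: "\<And>x. \<bar>\<phi> x\<bar> \<le> c"
  shows "integrable M (\<lambda>x. \<phi> (y - x))" "\<bar>avg M \<phi> y\<bar> \<le> c"
proof -
  show int: "integrable M (\<lambda>x. \<phi> (y - x))"
    using bound by (intro integrable_const_bound[where B = c]) auto
  have "- c \<le> \<phi> x" "\<phi> x \<le> c" for x
    using bound[of x] by auto
  then show "\<bar>avg M \<phi> y\<bar> \<le> c"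
    unfolding avg_def abs_le_iff
    using integral_le_const[OF int, of c] integral_ge_const[OF int, of "- c"] by auto
qed

end

section \<open>Optimality of two-sided base-stock policies\<close>

lemma convex_on_minimum_segment:
  fixes f :: "real \<Rightarrow> real"
  assumes conv: "convex_on UNIV f" and min: "\<And>z. f a \<le> f z" and s: "s \<in> closed_segment a y"
  shows "f s \<le> f y"
proof -
  obtain u where u: "0 \<le> u" "u \<le> 1" and s: "s = (1 - u) *\<^sub>R a + u *\<^sub>R y"
    using s by (auto simp: in_segment)
  have "f s \<le> (1 - u) * f a + u * f y"
    using convex_onD[OF conv u(1,2), of a y] s by simp
  also have "\<dots> \<le> (1 - u) * f y + u * f y"
    using min[of y] u by (intro add_mono mult_left_mono) auto
  finally show ?thesis by (simp add: algebra_simps)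
qed

lemma convex_on_linear_add:
  "convex_on UNIV f \<Longrightarrow> convex_on UNIV (\<lambda>y. c * y + f y)" for f :: "real \<Rightarrow> real" and c :: real
  by (intro convex_on_add) (auto intro!: convex_onI simp: algebra_simps)

text \<open>The transaction cost dominates both of its linear branches. Below the lower threshold
  the branch with rate \<open>k\<close> reduces the claim to \<open>lo\<close>, above the upper one
  the branch with rate \<open>q\<close> reduces it to \<open>hi\<close>. In between, convexity lets
  both \<open>k * y + f y\<close> to the right of \<open>s\<close> and \<open>- q * y + f y\<close>
  to the left of \<open>s\<close> only exceed their values at \<open>s\<close>, so staying is
  optimal.\<close>

lemma INF_trans_cost_base_stock:
  fixes f :: "real \<Rightarrow> real"
  assumes kq: "0 \<le> k + q" and conv: "convex_on UNIV f" and le: "fst p \<le> snd p"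
    and lo: "\<And>y. k * fst p + f (fst p) \<le> k * y + f y"
    and hi: "\<And>y. - q * snd p + f (snd p) \<le> - q * y + f y"
  shows "(INF y. trans_cost k q y s + f y) = trans_cost k q (base_stock p s) s + f (base_stock p s)"
proof -
  have opt: "trans_cost k q (base_stock p s) s + f (base_stock p s) \<le> trans_cost k q y s + f y" for y
  proof -
    have c: "k * (y - s) \<le> trans_cost k q y s" "q * (s - y) \<le> trans_cost k q y s"
      using kq by (simp_all add: trans_cost_eq_max)
    \<comment> \<open>The last two cases fix the side of \<open>s\<close> on which \<open>y\<close>
      lies; \<open>s\<close> may still be beyond the other threshold, where moving to that threshold
      is better than staying.\<close>
    consider "s \<le> fst p" | "snd p \<le> s" | "fst p \<le> s" "s \<le> y" | "s \<le> snd p" "y \<le> s"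
      by linarith
    then show ?thesis
    proof cases
      case 1
      then have "trans_cost k q (base_stock p s) s + f (base_stock p s) = k * fst p + f (fst p) - k * s"
        using le by (simp add: base_stock_below trans_cost_def algebra_simps)
      then show ?thesis using c(1) lo[of y] by (simp add: algebra_simps)
    next
      case 2
      then have "trans_cost k q (base_stock p s) s + f (base_stock p s) = - q * snd p + f (snd p) + q * s"
        using le by (simp add: base_stock_above trans_cost_down algebra_simps)
      then show ?thesis using c(2) hi[of y] by (simp add: algebra_simps)
    next
      case 3
      have "k * s + f s \<le> k * y + f y"
        using 3 by (intro convex_on_minimum_segment[OF convex_on_linear_add[OF conv] lo])
          (auto simp: closed_segment_eq_real_ivl)
      then have *: "f s \<le> trans_cost k q y s + f y" using c(1) by (simp add: algebra_simps)
      show ?thesis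
      proof (cases "s \<le> snd p")
        case True
        then have "base_stock p s = s" using 3 by (simp add: base_stock_def)
        then show ?thesis using * by (simp add: trans_cost_def)
      next
        case False
        then have "trans_cost k q (base_stock p s) s + f (base_stock p s) = - q * snd p + f (snd p) + q * s"
          using le by (simp add: base_stock_above trans_cost_down algebra_simps)
        also have "\<dots> \<le> f s" using hi[of s] by simp
        finally show ?thesis using * by linarith
      qed
    next
      case 4
      have "- q * s + f s \<le> - q * y + f y"
        using 4 by (intro convex_on_minimum_segment[OF convex_on_linear_add[OF conv] hi])
          (auto simp: closed_segment_eq_real_ivl)
      then have *: "f s \<le> trans_cost k q y s + f y" using c(2) by (simp add: algebra_simps)
      show ?thesis
      proof (cases "fst p \<le> s")
        case True
        then have "base_stock p s = s" using 4 by (simp add: base_stock_def)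
        then show ?thesis using * by (simp add: trans_cost_def)
      next
        case False
        then have "trans_cost k q (base_stock p s) s + f (base_stock p s) = k * fst p + f (fst p) - k * s"
          using le by (simp add: base_stock_below trans_cost_def algebra_simps)
        also have "\<dots> \<le> f s" using lo[of s] by simp
        finally show ?thesis using * by linarith
      qed
    qed
  qed
  show ?thesis
  proof (rule antisym)
    show "(INF y. trans_cost k q y s + f y) \<le> trans_cost k q (base_stock p s) s + f (base_stock p s)"
      using opt by (intro cINF_lower) (auto simp: bdd_below_def)
    show "trans_cost k q (base_stock p s) s + f (base_stock p s) \<le> (INF y. trans_cost k q y s + f y)"
      using opt by (intro cINF_greatest) auto
  qed
qed

text \<open>Partial minimization of a jointly convex cost: the convex combination of two minimizers
  is a candidate for the convex combination of the states.\<close>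

lemma convex_on_minimized_trans_cost:
  assumes kq: "0 \<le> k + q" and conv: "convex_on UNIV f"
    and attained: "\<And>s. g s = trans_cost k q (\<pi> s) s + f (\<pi> s)"
    and lower: "\<And>s y. g s \<le> trans_cost k q y s + f y"
  shows "convex_on UNIV g"
proof (rule convex_onI)
  fix u s s' :: real assume u: "0 < u" "u < 1"
  let ?y = "(1 - u) * \<pi> s + u * \<pi> s'"
  have "g ((1 - u) * s + u * s') \<le> trans_cost k q ?y ((1 - u) * s + u * s') + f ?y"
    by (rule lower)
  also have "\<dots> \<le> ((1 - u) * trans_cost k q (\<pi> s) s + u * trans_cost k q (\<pi> s') s')
      + ((1 - u) * f (\<pi> s) + u * f (\<pi> s'))"
    using u convex_onD[OF conv, of u "\<pi> s" "\<pi> s'"] by (intro add_mono trans_cost_convex kq) auto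
  also have "\<dots> = (1 - u) * g s + u * g s'"
    by (simp add: attained algebra_simps)
  finally show "g ((1 - u) *\<^sub>R s + u *\<^sub>R s') \<le> (1 - u) * g s + u * g s'" by simp
qed simp

lemma convex_has_derivative_above_tangent:
  fixes f :: "real \<Rightarrow> real"
  assumes "convex_on UNIV f" "(f has_field_derivative d) (at x)"
  shows "f x + d * (y - x) \<le> f y"
  using convex_on_imp_above_tangent[OF assms(1), of x y d] assms(2) by simp

text \<open>Completing the square. It turns strong convexity into a bound of a suboptimality gap by
  the squared derivative.\<close>

lemma quadratic_lower_bound:
  fixes \<xi> d K :: real
  assumes "0 < K"
  shows "- \<xi>\<^sup>2 / (2 * K) \<le> \<xi> * d + K / 2 * d\<^sup>2"
proof -
  have "0 \<le> (\<xi> + K * d)\<^sup>2 / (2 * K)" using assms by simp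
  also have "\<dots> = \<xi>\<^sup>2 / (2 * K) + (\<xi> * d + K / 2 * d\<^sup>2)"
    using assms by (simp add: field_simps power2_eq_square)
  finally show ?thesis by simp
qed

section \<open>The dynamic program in terms of the law of the demand\<close>

locale cash_balance = real_distribution \<nu> for \<nu> :: "real measure" +
  fixes L \<mu> k q Blo Bhi :: real and T :: nat and h b :: "nat \<Rightarrow> real"
    and V :: "nat \<Rightarrow> real \<Rightarrow> real" and \<theta>s :: "nat \<Rightarrow> real \<times> real"
  assumes cdf_lipschitz: "L-lipschitz_on UNIV (cdf \<nu>)"
    and cdf_lower: "\<And>x y. Blo \<le> x \<Longrightarrow> x \<le> y \<Longrightarrow> y \<le> Bhi \<Longrightarrow> \<mu> * (y - x) \<le> cdf \<nu> y - cdf \<nu> x"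
    and \<mu>_pos: "0 < \<mu>"
    and kq: "0 \<le> k + q"
    and hb: "\<And>t. t \<in> {1..T} \<Longrightarrow> 0 \<le> h t \<and> 0 \<le> b t \<and> 0 < h t + b t"
    and int_hold: "\<And>t y. t \<in> {1..T} \<Longrightarrow> integrable \<nu> (\<lambda>x. hold_cost (h t) (b t) (y - x))"
    and V_end: "V (Suc T) = (\<lambda>_. 0)"
    and V_step: "\<And>t s. t \<in> {1..T} \<Longrightarrow> V t s = (INF y. trans_cost k q y s +
          (avg \<nu> (hold_cost (h t) (b t)) y + avg \<nu> (V (Suc t)) y))"
    and int_V: "\<And>t y. t \<in> {1..T} \<Longrightarrow> integrable \<nu> (\<lambda>x. V (Suc t) (y - x))"
    and feasible_opt: "\<And>t. t \<in> {1..T} \<Longrightarrow>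
          Blo \<le> fst (\<theta>s t) \<and> fst (\<theta>s t) \<le> snd (\<theta>s t) \<and> snd (\<theta>s t) \<le> Bhi"
    and opt_lo: "\<And>t y. t \<in> {1..T} \<Longrightarrow>
          k * fst (\<theta>s t) + (avg \<nu> (hold_cost (h t) (b t)) (fst (\<theta>s t)) + avg \<nu> (V (Suc t)) (fst (\<theta>s t)))
            \<le> k * y + (avg \<nu> (hold_cost (h t) (b t)) y + avg \<nu> (V (Suc t)) y)"
    and opt_hi: "\<And>t y. t \<in> {1..T} \<Longrightarrow>
          - q * snd (\<theta>s t) + (avg \<nu> (hold_cost (h t) (b t)) (snd (\<theta>s t)) + avg \<nu> (V (Suc t)) (snd (\<theta>s t)))
            \<le> - q * y + (avg \<nu> (hold_cost (h t) (b t)) y + avg \<nu> (V (Suc t)) y)"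
begin

definition ctg :: "nat \<Rightarrow> real \<Rightarrow> real" where
  "ctg t y = avg \<nu> (hold_cost (h t) (b t)) y + avg \<nu> (V (Suc t)) y"

lemmas opt_lo_ctg = opt_lo[folded ctg_def]
lemmas opt_hi_ctg = opt_hi[folded ctg_def]

lemma prob_singleton: "measure \<nu> {x} = 0"
  using lipschitz_on_continuous_on[OF cdf_lipschitz]
  by (simp add: continuous_on_eq_continuous_at flip: isCont_cdf)

text \<open>Kept one-sided because the two signs of \<open>s - s'\<close> bound the slopes of
  \<open>V t\<close> by \<open>- k\<close> from below and by \<open>q\<close> from above, and both
  bounds are needed later.\<close>

lemma V_shift:
  assumes t: "t \<in> {1..T}"
  shows "V t s' \<le> V t s + trans_cost k q s s'"
  unfolding V_step[OF t]
  by (rule INF_trans_cost_le[OF kq]) (use opt_lo[OF t] in \<open>auto simp: bdd_below_def\<close>)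

lemma V_lipschitz:
  assumes t: "t \<in> {1..Suc T}"
  shows "(max \<bar>k\<bar> \<bar>q\<bar>)-lipschitz_on UNIV (V t)"
proof (cases "t = Suc T")
  case True
  then show ?thesis by (auto simp: V_end intro!: lipschitz_onI)
next
  case False
  then have t: "t \<in> {1..T}" using assms by auto
  show ?thesis
  proof (rule lipschitz_onI)
    fix x y
    have "\<bar>V t x - V t y\<bar> \<le> max \<bar>k\<bar> \<bar>q\<bar> * \<bar>x - y\<bar>"
      using V_shift[OF t, of x y] V_shift[OF t, of y x]
        trans_cost_le_dist[of k q x y] trans_cost_le_dist[of k q y x]
      by (simp add: abs_le_iff abs_minus_commute)
    then show "dist (V t x) (V t y) \<le> max \<bar>k\<bar> \<bar>q\<bar> * dist x y"
      by (simp add: dist_real_def)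
  qed auto
qed

lemma ctg_convex_step:
  assumes "t \<in> {1..T}" "convex_on UNIV (V (Suc t))"
  shows "convex_on UNIV (ctg t)"
  unfolding ctg_def using assms hb int_hold int_V
  by (intro convex_on_add avg_convex hold_cost_convex) auto

lemma V_base_stock_step:
  assumes t: "t \<in> {1..T}" and "convex_on UNIV (V (Suc t))"
  shows "V t s = trans_cost k q (base_stock (\<theta>s t) s) s + ctg t (base_stock (\<theta>s t) s)"
  unfolding V_step[OF t] ctg_def[symmetric]
  using feasible_opt[OF t] opt_lo[OF t] opt_hi[OF t]
  by (intro INF_trans_cost_base_stock[OF kq ctg_convex_step[OF assms]]) (auto simp: ctg_def)

text \<open>Convexity of \<open>V (Suc n)\<close> makes the base-stock policy attain the minimum in
  period \<open>n\<close>, and an attained minimum is convex again. The two \<open>_step\<close>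
  lemmas above have convexity as a hypothesis because they are used inside this backward
  induction.\<close>

lemma V_convex:
  assumes t: "t \<in> {1..Suc T}"
  shows "convex_on UNIV (V t)"
proof -
  have "t \<le> Suc T" using t by simp
  then show ?thesis
  proof (induction rule: inc_induct)
    case base
    then show ?case by (simp add: V_end convex_on_const)
  next
    case (step n)
    then have n: "n \<in> {1..T}" using t by auto
    \<comment> \<open>In the reals, \<open>INF\<close> is a lower bound only for a family that is
      bounded below; the minimizer of \<open>k * y + ctg n y\<close> provides the bound.\<close>
    have "bdd_below (range (\<lambda>y. trans_cost k q y s + ctg n y))" for s
    proof (rule bdd_belowI2)
      fix y
      have "k * (y - s) \<le> trans_cost k q y s" using kq by (simp add: trans_cost_eq_max)
      then show "k * fst (\<theta>s n) + ctg n (fst (\<theta>s n)) - k * s \<le> trans_cost k q y s + ctg n y"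
        using opt_lo[OF n, of y] by (simp add: ctg_def algebra_simps)
    qed
    then have "V n s \<le> trans_cost k q y s + ctg n y" for s y
      unfolding V_step[OF n] ctg_def[symmetric] by (intro cINF_lower) auto
    then show ?case
      by (intro convex_on_minimized_trans_cost[OF kq ctg_convex_step[OF n step.IH]
            V_base_stock_step[OF n step.IH]])
  qed
qed

lemma ctg_convex: "t \<in> {1..T} \<Longrightarrow> convex_on UNIV (ctg t)"
  by (intro ctg_convex_step V_convex) auto

lemma V_base_stock:
  "t \<in> {1..T} \<Longrightarrow> V t s = trans_cost k q (base_stock (\<theta>s t) s) s + ctg t (base_stock (\<theta>s t) s)"
  by (intro V_base_stock_step V_convex) auto

section \<open>Policy values\<close>

text \<open>The state is abstracted on the right so that the recursive call is a whole function, the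
  form in which \<open>avg\<close> takes it.\<close>

function policy_value :: "(nat \<Rightarrow> real \<times> real) \<Rightarrow> nat \<Rightarrow> real \<Rightarrow> real" where
  "policy_value \<theta> t = (if T < t then (\<lambda>_. 0) else (\<lambda>s. trans_cost k q (base_stock (\<theta> t) s) s +
     (avg \<nu> (hold_cost (h t) (b t)) (base_stock (\<theta> t) s)
       + avg \<nu> (policy_value \<theta> (Suc t)) (base_stock (\<theta> t) s))))"
  by pat_completeness auto
termination
  by (relation "Wellfounded.measure (\<lambda>(\<theta>, t). Suc T - t)") auto

declare policy_value.simps [simp del]

text \<open>The function \<open>Q t\<close> of the overview: the level in period \<open>t\<close> is
  free, and all later periods follow \<open>\<theta>\<close>.\<close>

definition action_value :: "(nat \<Rightarrow> real \<times> real) \<Rightarrow> nat \<Rightarrow> real \<Rightarrow> real" where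
  "action_value \<theta> t y = avg \<nu> (hold_cost (h t) (b t)) y + avg \<nu> (policy_value \<theta> (Suc t)) y"

lemma policy_value_end: "policy_value \<theta> (Suc T) = (\<lambda>_. 0)"
  by (simp add: policy_value.simps[of \<theta> "Suc T"])

lemma policy_value_step:
  "t \<in> {1..T} \<Longrightarrow> policy_value \<theta> t s
     = trans_cost k q (base_stock (\<theta> t) s) s + action_value \<theta> t (base_stock (\<theta> t) s)"
  by (simp add: policy_value.simps[of \<theta> t] action_value_def)

definition feasible :: "(nat \<Rightarrow> real \<times> real) \<Rightarrow> bool" where
  "feasible \<theta> \<longleftrightarrow> (\<forall>t\<in>{1..T}. Blo \<le> fst (\<theta> t) \<and> fst (\<theta> t) \<le> snd (\<theta> t) \<and> snd (\<theta> t) \<le> Bhi)"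

lemma feasibleD:
  assumes "feasible \<theta>" "t \<in> {1..T}"
  shows "Blo \<le> fst (\<theta> t)" "fst (\<theta> t) \<le> snd (\<theta> t)" "snd (\<theta> t) \<le> Bhi"
  using assms by (auto simp: feasible_def)

lemma feasible_\<theta>s: "feasible \<theta>s"
  using feasible_opt by (auto simp: feasible_def)

text \<open>Makes results on general policies, in particular differentiability, available for
  \<open>V\<close> and \<open>ctg\<close>.\<close>

lemma policy_value_opt:
  assumes t: "t \<in> {1..Suc T}"
  shows "policy_value \<theta>s t = V t"
proof -
  have "t \<le> Suc T" using t by simp
  then show ?thesis
  proof (induction rule: inc_induct)
    case base
    then show ?case by (simp add: V_end policy_value_end)
  next
    case (step n)
    then have n: "n \<in> {1..T}" using t by auto
    show ?case
      by (rule ext) (simp add: V_base_stock[OF n] policy_value_step[OF n] action_value_def ctg_def step.IH)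
  qed
qed

lemma action_value_opt: "t \<in> {1..T} \<Longrightarrow> action_value \<theta>s t = ctg t"
  by (auto simp: action_value_def ctg_def policy_value_opt)

section \<open>Gaps and regrets of a single period\<close>

definition gap_lo :: "(nat \<Rightarrow> real \<times> real) \<Rightarrow> nat \<Rightarrow> real" where
  "gap_lo \<theta> t = (k * fst (\<theta> t) + ctg t (fst (\<theta> t))) - (k * fst (\<theta>s t) + ctg t (fst (\<theta>s t)))"

definition gap_hi :: "(nat \<Rightarrow> real \<times> real) \<Rightarrow> nat \<Rightarrow> real" where
  "gap_hi \<theta> t = (- q * snd (\<theta> t) + ctg t (snd (\<theta> t))) - (- q * snd (\<theta>s t) + ctg t (snd (\<theta>s t)))"

lemma gap_lo_nonneg: "t \<in> {1..T} \<Longrightarrow> 0 \<le> gap_lo \<theta> t"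
  using opt_lo[of t "fst (\<theta> t)"] by (simp add: gap_lo_def ctg_def)

lemma gap_hi_nonneg: "t \<in> {1..T} \<Longrightarrow> 0 \<le> gap_hi \<theta> t"
  using opt_hi[of t "snd (\<theta> t)"] by (simp add: gap_hi_def ctg_def)

definition gaps :: "(nat \<Rightarrow> real \<times> real) \<Rightarrow> nat \<Rightarrow> real" where
  "gaps \<theta> t = (\<Sum>j=t..T. gap_lo \<theta> j + gap_hi \<theta> j)"

lemma gaps_Suc: "t \<in> {1..T} \<Longrightarrow> gaps \<theta> t = gap_lo \<theta> t + gap_hi \<theta> t + gaps \<theta> (Suc t)"
  by (simp add: gaps_def sum.atLeast_Suc_atMost)

definition regret_lo :: "(nat \<Rightarrow> real \<times> real) \<Rightarrow> nat \<Rightarrow> real \<Rightarrow> real" where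
  "regret_lo \<theta> t s = (k * max s (fst (\<theta> t)) + ctg t (max s (fst (\<theta> t))))
     - (k * max s (fst (\<theta>s t)) + ctg t (max s (fst (\<theta>s t))))"

definition regret_hi :: "(nat \<Rightarrow> real \<times> real) \<Rightarrow> nat \<Rightarrow> real \<Rightarrow> real" where
  "regret_hi \<theta> t s = (- q * min s (snd (\<theta> t)) + ctg t (min s (snd (\<theta> t))))
     - (- q * min s (snd (\<theta>s t)) + ctg t (min s (snd (\<theta>s t))))"

text \<open>The regret is constant outside the interval between the two lower thresholds. If
  \<open>a \<le> s \<le> a'\<close>, it is \<open>\<phi> s - \<phi> a'\<close> and decreases because
  \<open>s\<close> approaches the minimizer \<open>a'\<close>; if \<open>a' \<le> s \<le> a\<close>,
  it is \<open>\<phi> a - \<phi> s\<close> and decreases because \<open>s\<close> leaves it.\<close>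

lemma regret_lo_antimono:
  assumes t: "t \<in> {1..T}"
  shows "antimono (regret_lo \<theta> t)"
proof (rule antimonoI)
  fix s s' :: real assume "s \<le> s'"
  define \<phi> where "\<phi> y = k * y + ctg t y" for y
  define a where "a = fst (\<theta> t)"
  define a' where "a' = fst (\<theta>s t)"
  have seg: "x \<in> closed_segment a' y \<Longrightarrow> \<phi> x \<le> \<phi> y" for x y
    unfolding \<phi>_def a'_def
    by (rule convex_on_minimum_segment[OF convex_on_linear_add[OF ctg_convex[OF t]] opt_lo_ctg[OF t]])
  have eq: "regret_lo \<theta> t s = \<phi> (max s a) - \<phi> (max s a')" for s
    by (simp add: regret_lo_def \<phi>_def a_def a'_def)
  \<comment> \<open>In this additive form each case cancels two equal terms and leaves one
    comparison along a segment starting at \<open>a'\<close>.\<close>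
  have "\<phi> (max s' a) + \<phi> (max s a') \<le> \<phi> (max s a) + \<phi> (max s' a')"
  proof -
    consider "a \<le> a'" "s' \<le> a'" | "a \<le> a'" "a' \<le> s'" | "a' \<le> a" "s' \<le> a" | "a' \<le> a" "a \<le> s'"
      by linarith
    then show ?thesis
    proof cases
      case 1
      then have "max s a' = max s' a'" "max s' a \<in> closed_segment a' (max s a)"
        using \<open>s \<le> s'\<close> by (auto simp: closed_segment_eq_real_ivl)
      then show ?thesis using seg by simp
    next
      case 2
      then have "max s' a = max s' a'" "max s a' \<in> closed_segment a' (max s a)"
        by (auto simp: closed_segment_eq_real_ivl)
      then show ?thesis using seg by simp
    next
      case 3
      then have "max s' a = max s a" "max s a' \<in> closed_segment a' (max s' a')"
        using \<open>s \<le> s'\<close> by (auto simp: closed_segment_eq_real_ivl)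
      then show ?thesis using seg by simp
    next
      case 4
      then have "max s' a = max s' a'" "max s a' \<in> closed_segment a' (max s a)"
        by (auto simp: closed_segment_eq_real_ivl)
      then show ?thesis using seg by simp
    qed
  qed
  then show "regret_lo \<theta> t s' \<le> regret_lo \<theta> t s" by (simp add: eq)
qed

text \<open>Mirror image of \<open>regret_lo_antimono\<close>: reflecting the line exchanges
  \<open>max\<close> with \<open>min\<close> and decreasing with increasing.\<close>

lemma regret_hi_mono:
  assumes t: "t \<in> {1..T}"
  shows "mono (regret_hi \<theta> t)"
proof (rule monoI)
  fix s s' :: real assume "s \<le> s'"
  define \<phi> where "\<phi> y = - q * y + ctg t y" for y
  define a where "a = snd (\<theta> t)"
  define a' where "a' = snd (\<theta>s t)"
  have seg: "x \<in> closed_segment a' y \<Longrightarrow> \<phi> x \<le> \<phi> y" for x y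
    unfolding \<phi>_def a'_def
    by (rule convex_on_minimum_segment[OF convex_on_linear_add[OF ctg_convex[OF t]] opt_hi_ctg[OF t]])
  have eq: "regret_hi \<theta> t s = \<phi> (min s a) - \<phi> (min s a')" for s
    by (simp add: regret_hi_def \<phi>_def a_def a'_def)
  have "\<phi> (min s a) + \<phi> (min s' a') \<le> \<phi> (min s' a) + \<phi> (min s a')"
  proof -
    consider "a' \<le> a" "a' \<le> s" | "a' \<le> a" "s \<le> a'" | "a \<le> a'" "a \<le> s" | "a \<le> a'" "s \<le> a"
      by linarith
    then show ?thesis
    proof cases
      case 1
      then have "min s a' = min s' a'" "min s a \<in> closed_segment a' (min s' a)"
        using \<open>s \<le> s'\<close> by (auto simp: closed_segment_eq_real_ivl)
      then show ?thesis using seg by simp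
    next
      case 2
      then have "min s a = min s a'" "min s' a' \<in> closed_segment a' (min s' a)"
        by (auto simp: closed_segment_eq_real_ivl)
      then show ?thesis using seg by simp
    next
      case 3
      then have "min s' a = min s a" "min s' a' \<in> closed_segment a' (min s a')"
        using \<open>s \<le> s'\<close> by (auto simp: closed_segment_eq_real_ivl)
      then show ?thesis using seg by simp
    next
      case 4
      then have "min s a = min s a'" "min s' a' \<in> closed_segment a' (min s' a)"
        by (auto simp: closed_segment_eq_real_ivl)
      then show ?thesis using seg by simp
    qed
  qed
  then show "regret_hi \<theta> t s \<le> regret_hi \<theta> t s'" by (simp add: eq)
qed

text \<open>To the right of both thresholds (\<open>u\<close>) neither policy raises the stock and
  the regret is 0; to the left of both (\<open>l\<close>) each moves to its threshold and the regret
  is the gap. By monotonicity these are the extreme values, so the gap is the total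
  variation.\<close>

lemma regret_lo_range:
  assumes t: "t \<in> {1..T}"
  shows "0 \<le> regret_lo \<theta> t s \<and> regret_lo \<theta> t s \<le> gap_lo \<theta> t"
proof -
  let ?r = "regret_lo \<theta> t"
  define u where "u = max s (max (fst (\<theta> t)) (fst (\<theta>s t)))"
  define l where "l = min s (min (fst (\<theta> t)) (fst (\<theta>s t)))"
  have "?r u = 0" by (simp add: regret_lo_def u_def)
  moreover have "?r l = gap_lo \<theta> t" by (simp add: regret_lo_def gap_lo_def l_def)
  moreover have "?r u \<le> ?r s" "?r s \<le> ?r l"
    by (rule antimonoD[OF regret_lo_antimono[OF t]]; simp add: u_def l_def)+
  ultimately show ?thesis by simp
qed

lemma regret_hi_range:
  assumes t: "t \<in> {1..T}"
  shows "0 \<le> regret_hi \<theta> t s \<and> regret_hi \<theta> t s \<le> gap_hi \<theta> t"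
proof -
  let ?r = "regret_hi \<theta> t"
  define u where "u = max s (max (snd (\<theta> t)) (snd (\<theta>s t)))"
  define l where "l = min s (min (snd (\<theta> t)) (snd (\<theta>s t)))"
  have "?r l = 0" by (simp add: regret_hi_def l_def)
  moreover have "?r u = gap_hi \<theta> t" by (simp add: regret_hi_def gap_hi_def u_def)
  moreover have "?r l \<le> ?r s" "?r s \<le> ?r u"
    by (rule monoD[OF regret_hi_mono[OF t]]; simp add: u_def l_def)+
  ultimately show ?thesis by simp
qed

text \<open>Adding and subtracting \<open>ctg t\<close> at the level chosen by
  \<open>\<theta>\<close> separates the loss of period \<open>t\<close>, measured with an optimal
  future, from the loss of the future itself.\<close>

lemma policy_value_diff:
  assumes \<theta>: "feasible \<theta>" and t: "t \<in> {1..T}"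
  shows "policy_value \<theta> t s - V t s = regret_lo \<theta> t s + regret_hi \<theta> t s
    + (action_value \<theta> t (base_stock (\<theta> t) s) - ctg t (base_stock (\<theta> t) s))"
  using base_stock_cost[OF feasibleD(2)[OF \<theta> t], of k q s "ctg t"]
    base_stock_cost[OF feasibleD(2)[OF feasible_\<theta>s t], of k q s "ctg t"]
  unfolding policy_value_step[OF t] V_base_stock[OF t] regret_lo_def regret_hi_def
  by linarith

lemma policy_value_lipschitz_step:
  assumes \<theta>: "feasible \<theta>" and t: "t \<in> {1..T}" and lip: "C-lipschitz_on UNIV (action_value \<theta> t)"
  shows "(2 * max \<bar>k\<bar> \<bar>q\<bar> + C)-lipschitz_on UNIV (policy_value \<theta> t)"
proof (rule lipschitz_on_realI)
  let ?m = "max \<bar>k\<bar> \<bar>q\<bar>" and ?\<pi> = "base_stock (\<theta> t)"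
  have C: "0 \<le> C" using lip by (rule lipschitz_on_nonneg)
  then show "0 \<le> 2 * ?m + C" by simp
  fix s s'
  have "\<bar>trans_cost k q (?\<pi> s) s - trans_cost k q (?\<pi> s') s'\<bar> \<le> ?m * (\<bar>?\<pi> s - ?\<pi> s'\<bar> + \<bar>s - s'\<bar>)"
    by (rule trans_cost_lipschitz)
  also have "\<dots> \<le> ?m * (2 * \<bar>s - s'\<bar>)"
    using base_stock_nonexpansive[of "\<theta> t" s s'] by (intro mult_left_mono) auto
  finally have 1: "\<bar>trans_cost k q (?\<pi> s) s - trans_cost k q (?\<pi> s') s'\<bar> \<le> 2 * ?m * \<bar>s - s'\<bar>"
    by simp
  have "\<bar>action_value \<theta> t (?\<pi> s) - action_value \<theta> t (?\<pi> s')\<bar> \<le> C * \<bar>?\<pi> s - ?\<pi> s'\<bar>"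
    by (rule lipschitz_on_real_bound[OF lip])
  also have "\<dots> \<le> C * \<bar>s - s'\<bar>"
    using base_stock_nonexpansive[of "\<theta> t" s s'] C by (intro mult_left_mono) auto
  finally show "\<bar>policy_value \<theta> t s - policy_value \<theta> t s'\<bar> \<le> (2 * ?m + C) * \<bar>s - s'\<bar>"
    unfolding policy_value_step[OF t] distrib_right
    using 1 by (intro order_trans[OF abs_diff_triangle_ineq] add_mono)
qed

lemma hold_lipschitz:
  assumes t: "t \<in> {1..T}"
  shows "(max (h t) (b t))-lipschitz_on UNIV (avg \<nu> (hold_cost (h t) (b t)))"
  using hb[OF t] by (intro avg_lipschitz[OF hold_cost_lipschitz int_hold[OF t]]) auto

text \<open>The three claims need each other in the induction: the first gives measurability, the
  second integrability, and the third is the quantitative estimate. In the third the constants add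
  up over the periods: the later regret enters as \<open>avg \<nu> W\<close> after the nonexpansive
  \<open>base_stock\<close>, so it keeps its Lipschitz constant when averaged once more, and the two
  monotone regrets of the current period contribute \<open>L\<close> times their gaps.\<close>

lemma policy_value_bounds:
  assumes \<theta>: "feasible \<theta>" and t: "t \<in> {1..Suc T}"
  shows "(\<exists>C. C-lipschitz_on UNIV (policy_value \<theta> t)) \<and>
    (\<forall>s. \<bar>policy_value \<theta> t s - V t s\<bar> \<le> gaps \<theta> t) \<and>
    (L * gaps \<theta> t)-lipschitz_on UNIV (avg \<nu> (\<lambda>s. policy_value \<theta> t s - V t s))"
proof -
  have "t \<le> Suc T" using t by simp
  then show ?thesis
  proof (induction rule: inc_induct)
    case base
    then show ?case
      by (auto simp: V_end policy_value_end gaps_def avg_def intro!: lipschitz_on_realI exI[of _ 0])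
  next
    case (step n)
    then have n: "n \<in> {1..T}" "Suc n \<in> {1..Suc T}" using t by auto
    obtain C where C: "C-lipschitz_on UNIV (policy_value \<theta> (Suc n))"
      using step.IH by blast
    define W where "W s = policy_value \<theta> (Suc n) s - V (Suc n) s" for s
    have W: "\<bar>W s\<bar> \<le> gaps \<theta> (Suc n)" for s
      using step.IH by (simp add: W_def)
    have W_lip: "(L * gaps \<theta> (Suc n))-lipschitz_on UNIV (avg \<nu> W)"
      using step.IH by (simp add: W_def[abs_def])
    have [measurable]: "W \<in> borel_measurable borel"
      unfolding W_def[abs_def]
      using lipschitz_on_borel_measurable[OF C] lipschitz_on_borel_measurable[OF V_lipschitz[OF n(2)]]
      by measurable
    \<comment> \<open>Finite expectations are assumed for \<open>V\<close>; the policy value differs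
      from it by the bounded function \<open>W\<close>.\<close>
    have int_W: "integrable \<nu> (\<lambda>x. W (y - x))" for y
      by (rule avg_abs_le[OF _ W]) measurable
    have int: "integrable \<nu> (\<lambda>x. policy_value \<theta> (Suc n) (y - x))" for y
      using Bochner_Integration.integrable_add[OF int_W[of y] int_V[OF n(1), of y]] by (simp add: W_def)
    have g: "action_value \<theta> n y - ctg n y = avg \<nu> W y" for y
      using int int_V[OF n(1)] by (simp add: action_value_def ctg_def avg_def W_def)
    have "(max (h n) (b n) + C)-lipschitz_on UNIV (action_value \<theta> n)"
      unfolding action_value_def[abs_def]
      by (intro lipschitz_on_add hold_lipschitz[OF n(1)] avg_lipschitz[OF C int])
    then have lip: "\<exists>C. C-lipschitz_on UNIV (policy_value \<theta> n)"
      using policy_value_lipschitz_step[OF \<theta> n(1)] by blast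
    have decomp: "policy_value \<theta> n s - V n s
        = regret_lo \<theta> n s + regret_hi \<theta> n s + avg \<nu> W (base_stock (\<theta> n) s)" for s
      unfolding policy_value_diff[OF \<theta> n(1)] g by simp
    have gW_bound: "\<bar>avg \<nu> W (base_stock (\<theta> n) s)\<bar> \<le> gaps \<theta> (Suc n)" for s
      by (rule avg_abs_le[OF _ W]) measurable
    have bound: "\<bar>policy_value \<theta> n s - V n s\<bar> \<le> gaps \<theta> n" for s
      unfolding decomp gaps_Suc[OF n(1)]
      using regret_lo_range[OF n(1), of \<theta> s] regret_hi_range[OF n(1), of \<theta> s]
        gW_bound[of s] by auto
    have L: "0 \<le> L" using cdf_lipschitz by (rule lipschitz_on_nonneg)
    have gW_lip: "(L * gaps \<theta> (Suc n))-lipschitz_on UNIV (\<lambda>s. avg \<nu> W (base_stock (\<theta> n) s))"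
    proof (rule lipschitz_on_realI)
      show nn: "0 \<le> L * gaps \<theta> (Suc n)" using W_lip by (rule lipschitz_on_nonneg)
      fix x y
      have "\<bar>avg \<nu> W (base_stock (\<theta> n) x) - avg \<nu> W (base_stock (\<theta> n) y)\<bar>
          \<le> L * gaps \<theta> (Suc n) * \<bar>base_stock (\<theta> n) x - base_stock (\<theta> n) y\<bar>"
        by (rule lipschitz_on_real_bound[OF W_lip])
      also have "\<dots> \<le> L * gaps \<theta> (Suc n) * \<bar>x - y\<bar>"
        by (intro mult_left_mono base_stock_nonexpansive nn)
      finally show "\<bar>avg \<nu> W (base_stock (\<theta> n) x) - avg \<nu> W (base_stock (\<theta> n) y)\<bar>
          \<le> L * gaps \<theta> (Suc n) * \<bar>x - y\<bar>" .
    qed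
    have "mono (\<lambda>s. - regret_lo \<theta> n s)"
      using antimonoD[OF regret_lo_antimono[OF n(1)]] by (intro monoI) simp
    from borel_measurable_mono[OF this]
    have meas: "regret_lo \<theta> n \<in> borel_measurable borel" by simp
    have int_regret: "integrable \<nu> (\<lambda>x. regret_lo \<theta> n (y - x))"
      "integrable \<nu> (\<lambda>x. regret_hi \<theta> n (y - x))"
      "integrable \<nu> (\<lambda>x. avg \<nu> W (base_stock (\<theta> n) (y - x)))" for y
    proof -
      show "integrable \<nu> (\<lambda>x. regret_lo \<theta> n (y - x))"
        using regret_lo_range[OF n(1), of \<theta>] by (intro avg_abs_le(1)[where c = "gap_lo \<theta> n"] meas) simp
      show "integrable \<nu> (\<lambda>x. regret_hi \<theta> n (y - x))"
        using regret_hi_range[OF n(1), of \<theta>]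
        by (intro avg_abs_le(1)[where c = "gap_hi \<theta> n"] borel_measurable_mono[OF regret_hi_mono[OF n(1)]]) simp
      show "integrable \<nu> (\<lambda>x. avg \<nu> W (base_stock (\<theta> n) (y - x)))"
        by (rule avg_abs_le(1)[OF lipschitz_on_borel_measurable[OF gW_lip] gW_bound])
    qed
    have "avg \<nu> (\<lambda>s. policy_value \<theta> n s - V n s)
        = (\<lambda>y. avg \<nu> (regret_lo \<theta> n) y + avg \<nu> (regret_hi \<theta> n) y
            + avg \<nu> (\<lambda>s. avg \<nu> W (base_stock (\<theta> n) s)) y)"
      unfolding decomp using int_regret by (auto simp: avg_def[abs_def])
    moreover have "(L * gap_lo \<theta> n + L * gap_hi \<theta> n + L * gaps \<theta> (Suc n))-lipschitz_on UNIV
        (\<lambda>y. avg \<nu> (regret_lo \<theta> n) y + avg \<nu> (regret_hi \<theta> n) y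
            + avg \<nu> (\<lambda>s. avg \<nu> W (base_stock (\<theta> n) s)) y)"
      by (intro lipschitz_on_add avg_lipschitz[OF gW_lip int_regret(3)]
          avg_antimono_lipschitz[OF regret_lo_antimono regret_lo_range cdf_lipschitz]
          avg_mono_lipschitz[OF regret_hi_mono regret_hi_range cdf_lipschitz] n(1))
    ultimately show ?case
      using lip bound by (simp add: gaps_Suc[OF n(1)] distrib_left)
  qed
qed

lemma policy_value_measurable:
  assumes "feasible \<theta>" "t \<in> {1..Suc T}"
  shows "policy_value \<theta> t \<in> borel_measurable borel"
  using policy_value_bounds[OF assms] lipschitz_on_borel_measurable by blast

lemma policy_value_integrable:
  assumes \<theta>: "feasible \<theta>" and t: "t \<in> {1..T}"
  shows "integrable \<nu> (\<lambda>x. policy_value \<theta> (Suc t) (y - x))"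
proof -
  have t': "Suc t \<in> {1..Suc T}" using t by simp
  let ?W = "\<lambda>s. policy_value \<theta> (Suc t) s - V (Suc t) s"
  have "integrable \<nu> (\<lambda>x. ?W (y - x))"
    using policy_value_bounds[OF \<theta> t'] policy_value_measurable[OF \<theta> t']
      lipschitz_on_borel_measurable[OF V_lipschitz[OF t']]
    by (intro avg_abs_le(1)[where c = "gaps \<theta> (Suc t)" and \<phi> = ?W]) auto
  from Bochner_Integration.integrable_add[OF this int_V[OF t, of y]] show ?thesis by simp
qed

lemma action_value_lipschitz:
  assumes \<theta>: "feasible \<theta>" and t: "t \<in> {1..T}"
  shows "\<exists>C. C-lipschitz_on UNIV (action_value \<theta> t)"
proof -
  obtain C where C: "C-lipschitz_on UNIV (policy_value \<theta> (Suc t))"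
    using policy_value_bounds[OF \<theta>, of "Suc t"] t by auto
  show ?thesis
    unfolding action_value_def[abs_def]
    by (rule exI, rule lipschitz_on_add[OF hold_lipschitz[OF t] avg_lipschitz[OF C policy_value_integrable[OF \<theta> t]]])
qed

lemma action_value_minus_ctg_lipschitz:
  assumes \<theta>: "feasible \<theta>" and t: "t \<in> {1..T}"
  shows "(L * gaps \<theta> (Suc t))-lipschitz_on UNIV (\<lambda>y. action_value \<theta> t y - ctg t y)"
proof -
  have "action_value \<theta> t y - ctg t y = avg \<nu> (\<lambda>s. policy_value \<theta> (Suc t) s - V (Suc t) s) y" for y
    using policy_value_integrable[OF \<theta> t] int_V[OF t] by (simp add: action_value_def ctg_def avg_def)
  then show ?thesis
    using policy_value_bounds[OF \<theta>, of "Suc t"] t by simp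
qed

section \<open>Derivatives of the cost-to-go functions\<close>

lemma hold_has_derivative:
  assumes t: "t \<in> {1..T}"
  shows "(avg \<nu> (hold_cost (h t) (b t)) has_field_derivative ((h t + b t) * cdf \<nu> y - b t)) (at y)"
proof -
  \<comment> \<open>At the kink the value \<open>h t\<close> is taken, so that
    \<open>\<phi>' (y - x)\<close> is affine in the indicator of \<open>{..y}\<close> and averages
    to the distribution function.\<close>
  define \<phi>' :: "real \<Rightarrow> real" where "\<phi>' z = (if z < 0 then - b t else h t)" for z
  have [measurable]: "\<phi>' \<in> borel_measurable borel"
    unfolding \<phi>'_def by measurable
  have "(hold_cost (h t) (b t) has_field_derivative \<phi>' z) (at z)" if z: "z \<notin> {0}" for z
  proof (cases "0 < z")
    case True
    have "((\<lambda>w. h t * w) has_field_derivative h t) (at z)"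
      by (auto intro!: derivative_eq_intros)
    then have "(hold_cost (h t) (b t) has_field_derivative h t) (at z)"
      by (rule has_field_derivative_transform_within_open[of _ _ _ "{0<..}"])
        (use True in \<open>auto simp: hold_cost_def\<close>)
    then show ?thesis using True by (simp add: \<phi>'_def)
  next
    case False
    then have "z < 0" using z by auto
    have "((\<lambda>w. - b t * w) has_field_derivative - b t) (at z)"
      by (auto intro!: derivative_eq_intros)
    then have "(hold_cost (h t) (b t) has_field_derivative - b t) (at z)"
      by (rule has_field_derivative_transform_within_open[of _ _ _ "{..<0}"])
        (use \<open>z < 0\<close> in \<open>auto simp: hold_cost_def\<close>)
    then show ?thesis using \<open>z < 0\<close> by (simp add: \<phi>'_def)
  qed
  then have "(avg \<nu> (hold_cost (h t) (b t)) has_field_derivative avg \<nu> \<phi>' y) (at y)"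
    using hb[OF t]
    by (intro avg_has_derivative[OF hold_cost_lipschitz int_hold[OF t], where N = "{0}"]) (auto simp: prob_singleton)
  moreover have "avg \<nu> \<phi>' y = (h t + b t) * cdf \<nu> y - b t"
  proof -
    have "\<phi>' (y - x) = (h t + b t) * indicator {..y} x - b t" for x
      by (auto simp: \<phi>'_def indicator_def)
    moreover have "integrable \<nu> (\<lambda>x. indicator {..y} x :: real)"
      by (intro integrable_real_indicator) (auto simp: emeasure_eq_measure)
    ultimately show ?thesis
      by (simp add: avg_def cdf_def prob_space[simplified])
  qed
  ultimately show ?thesis by simp
qed

lemma action_value_differentiable_step:
  assumes \<theta>: "feasible \<theta>" and t: "t \<in> {1..T}" and "countable N"
    and diff: "\<And>z. z \<notin> N \<Longrightarrow> policy_value \<theta> (Suc t) differentiable (at z)"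
  shows "action_value \<theta> t differentiable (at y)"
proof -
  obtain C where C: "C-lipschitz_on UNIV (policy_value \<theta> (Suc t))"
    using policy_value_bounds[OF \<theta>, of "Suc t"] t by auto
  have "avg \<nu> (hold_cost (h t) (b t)) differentiable (at y)"
    using hold_has_derivative[OF t] real_differentiable_def by blast
  moreover have "avg \<nu> (policy_value \<theta> (Suc t)) differentiable (at y)"
    using assms by (intro avg_differentiable[OF C policy_value_integrable[OF \<theta> t]]) (auto simp: prob_singleton)
  ultimately show ?thesis
    unfolding action_value_def[abs_def] by (rule differentiable_add)
qed

lemma policy_value_differentiable_step:
  assumes \<theta>: "feasible \<theta>" and t: "t \<in> {1..T}" and z: "z \<notin> {fst (\<theta> t), snd (\<theta> t)}"
    and diff: "\<And>y. action_value \<theta> t differentiable (at y)"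
  shows "policy_value \<theta> t differentiable (at z)"
proof -
  have le: "fst (\<theta> t) \<le> snd (\<theta> t)" using feasibleD[OF \<theta> t] by simp
  consider "z < fst (\<theta> t)" | "snd (\<theta> t) < z" | "fst (\<theta> t) < z" "z < snd (\<theta> t)"
    using z by force
  then show ?thesis
  proof cases
    case 1
    have "((\<lambda>s. k * (fst (\<theta> t) - s) + action_value \<theta> t (fst (\<theta> t))) has_field_derivative - k) (at z)"
      by (auto intro!: derivative_eq_intros)
    then have "(policy_value \<theta> t has_field_derivative - k) (at z)"
      by (rule has_field_derivative_transform_within_open[of _ _ _ "{..<fst (\<theta> t)}"])
        (use 1 le in \<open>auto simp: policy_value_step[OF t] base_stock_below trans_cost_def\<close>)
    then show ?thesis by (auto simp: real_differentiable_def)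
  next
    case 2
    have "((\<lambda>s. q * (s - snd (\<theta> t)) + action_value \<theta> t (snd (\<theta> t))) has_field_derivative q) (at z)"
      by (auto intro!: derivative_eq_intros)
    then have "(policy_value \<theta> t has_field_derivative q) (at z)"
      by (rule has_field_derivative_transform_within_open[of _ _ _ "{snd (\<theta> t)<..}"])
        (use 2 le in \<open>auto simp: policy_value_step[OF t] base_stock_above trans_cost_down\<close>)
    then show ?thesis by (auto simp: real_differentiable_def)
  next
    case 3
    obtain d where "(action_value \<theta> t has_field_derivative d) (at z)"
      using diff by (auto simp: real_differentiable_def)
    then have "(policy_value \<theta> t has_field_derivative d) (at z)"
      by (rule has_field_derivative_transform_within_open[of _ _ _ "{fst (\<theta> t)<..<snd (\<theta> t)}"])
        (use 3 in \<open>auto simp: policy_value_step[OF t] base_stock_between trans_cost_def\<close>)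
    then show ?thesis by (auto simp: real_differentiable_def)
  qed
qed

text \<open>Kinks do not accumulate: averaging over an atomless demand removes those of the next
  policy value, and the current one can have new kinks only at its own two thresholds.\<close>

lemma action_value_differentiable:
  assumes \<theta>: "feasible \<theta>" and t: "t \<in> {1..T}"
  shows "action_value \<theta> t differentiable (at y)"
proof -
  have "\<exists>N. countable N \<and> (\<forall>z. z \<notin> N \<longrightarrow> policy_value \<theta> n differentiable (at z))"
    if n: "n \<in> {1..Suc T}" for n
  proof -
    have "n \<le> Suc T" using n by simp
    then show ?thesis
    proof (induction rule: inc_induct)
      case base
      then show ?case by (intro exI[of _ "{}"]) (simp add: policy_value_end)
    next
      case (step m)
      then have m: "m \<in> {1..T}" using n by auto
      have "action_value \<theta> m differentiable (at y)" for y
        using step.IH action_value_differentiable_step[OF \<theta> m] by blast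
      then show ?case
        using policy_value_differentiable_step[OF \<theta> m]
        by (intro exI[of _ "{fst (\<theta> m), snd (\<theta> m)}"]) auto
    qed
  qed
  from this[of "Suc t"] t action_value_differentiable_step[OF \<theta> t] show ?thesis by auto
qed

lemma action_value_has_derivative:
  "feasible \<theta> \<Longrightarrow> t \<in> {1..T} \<Longrightarrow>
    (action_value \<theta> t has_field_derivative deriv (action_value \<theta> t) y) (at y)"
  by (simp add: DERIV_deriv_iff_real_differentiable action_value_differentiable)

lemma ctg_has_derivative:
  "t \<in> {1..T} \<Longrightarrow> (ctg t has_field_derivative deriv (ctg t) y) (at y)"
  using action_value_has_derivative[OF feasible_\<theta>s] by (simp add: action_value_opt)

text \<open>The link between the partial derivatives of the objective, which involve
  \<open>action_value\<close>, and the convex functions \<open>ctg\<close>.\<close>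

lemma deriv_action_value_close:
  assumes \<theta>: "feasible \<theta>" and t: "t \<in> {1..T}"
  shows "\<bar>deriv (action_value \<theta> t) y - deriv (ctg t) y\<bar> \<le> L * gaps \<theta> (Suc t)"
  by (rule lipschitz_derivative_bound[OF action_value_minus_ctg_lipschitz[OF \<theta> t], of _ y])
    (intro DERIV_diff action_value_has_derivative ctg_has_derivative \<theta> t)

section \<open>Strong convexity and slopes of the cost-to-go\<close>

lemma avg_V_has_derivative:
  assumes t: "t \<in> {1..T}"
  shows "(avg \<nu> (V (Suc t)) has_field_derivative
    deriv (ctg t) y - ((h t + b t) * cdf \<nu> y - b t)) (at y)"
proof -
  have "avg \<nu> (V (Suc t)) = (\<lambda>y. ctg t y - avg \<nu> (hold_cost (h t) (b t)) y)"
    by (auto simp: ctg_def)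
  then show ?thesis
    using DERIV_diff[OF ctg_has_derivative[OF t] hold_has_derivative[OF t]] by simp
qed

text \<open>By \<open>cdf_lower\<close> the derivative \<open>H'\<close> grows at rate at least
  \<open>K\<close> on \<open>{Blo..Bhi}\<close>. After subtracting
  \<open>K / 2 * (z - x)\<^sup>2\<close> the derivative is at least \<open>H' x\<close> to the right
  of \<open>x\<close> and at most \<open>H' x\<close> to the left, so the mean value theorem
  suffices and no second derivative is used.\<close>

lemma hold_strongly_convex:
  assumes t: "t \<in> {1..T}" and x: "x \<in> {Blo..Bhi}" and y: "y \<in> {Blo..Bhi}"
  shows "avg \<nu> (hold_cost (h t) (b t)) x + ((h t + b t) * cdf \<nu> x - b t) * (y - x)
      + (h t + b t) * \<mu> / 2 * (y - x)\<^sup>2 \<le> avg \<nu> (hold_cost (h t) (b t)) y"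
proof -
  define H where "H = avg \<nu> (hold_cost (h t) (b t))"
  define H' where "H' z = (h t + b t) * cdf \<nu> z - b t" for z
  define K where "K = (h t + b t) * \<mu>"
  define G where "G z = H z - K / 2 * (z - x)\<^sup>2" for z
  have G: "(G has_field_derivative H' z - K * (z - x)) (at z)" for z
    unfolding G_def H'_def H_def using hold_has_derivative[OF t, of z]
    by (auto intro!: derivative_eq_intros)
  have grow: "K * (w - v) \<le> H' w - H' v" if "Blo \<le> v" "v \<le> w" "w \<le> Bhi" for v w
  proof -
    have "(h t + b t) * (\<mu> * (w - v)) \<le> (h t + b t) * (cdf \<nu> w - cdf \<nu> v)"
      using cdf_lower[OF that] hb[OF t] by (intro mult_left_mono) auto
    then show ?thesis by (simp add: K_def H'_def algebra_simps)
  qed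
  have "G x + H' x * (y - x) \<le> G y"
  proof (cases x y rule: linorder_cases)
    case less
    then obtain z where z: "x < z" "z < y" "G y - G x = (y - x) * (H' z - K * (z - x))"
      using MVT2[OF less, of G "\<lambda>z. H' z - K * (z - x)"] G by blast
    have "(y - x) * H' x \<le> (y - x) * (H' z - K * (z - x))"
      using grow[of x z] z x y by (intro mult_left_mono) auto
    then show ?thesis using z(3) by (simp add: algebra_simps)
  next
    case greater
    then obtain z where z: "y < z" "z < x" "G x - G y = (x - y) * (H' z - K * (z - x))"
      using MVT2[OF greater, of G "\<lambda>z. H' z - K * (z - x)"] G by blast
    have "(x - y) * (H' z - K * (z - x)) \<le> (x - y) * H' x"
      using grow[of z x] z x y by (intro mult_left_mono) (auto simp: algebra_simps)
    then show ?thesis using z(3) by (simp add: algebra_simps)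
  qed simp
  then show ?thesis by (simp add: G_def H_def H'_def K_def algebra_simps)
qed

text \<open>The holding cost supplies the quadratic term; the expected future value only has to be
  convex.\<close>

lemma ctg_strongly_convex:
  assumes t: "t \<in> {1..T}" and x: "x \<in> {Blo..Bhi}" and y: "y \<in> {Blo..Bhi}"
  shows "ctg t x + deriv (ctg t) x * (y - x) + (h t + b t) * \<mu> / 2 * (y - x)\<^sup>2 \<le> ctg t y"
proof -
  have "convex_on UNIV (avg \<nu> (V (Suc t)))"
    using t by (intro avg_convex V_convex int_V) auto
  from convex_has_derivative_above_tangent[OF this avg_V_has_derivative[OF t], of x y]
  show ?thesis
    using hold_strongly_convex[OF assms] by (simp add: ctg_def algebra_simps)
qed

lemma gap_le_square_derivative:
  assumes \<theta>: "feasible \<theta>" and t: "t \<in> {1..T}"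
  shows "gap_lo \<theta> t \<le> (k + deriv (ctg t) (fst (\<theta> t)))\<^sup>2 / (2 * ((h t + b t) * \<mu>))"
    and "gap_hi \<theta> t \<le> (deriv (ctg t) (snd (\<theta> t)) - q)\<^sup>2 / (2 * ((h t + b t) * \<mu>))"
proof -
  have K: "0 < (h t + b t) * \<mu>" using hb[OF t] \<mu>_pos by simp
  note mem = feasibleD[OF \<theta> t] feasibleD[OF feasible_\<theta>s t]
  show "gap_lo \<theta> t \<le> (k + deriv (ctg t) (fst (\<theta> t)))\<^sup>2 / (2 * ((h t + b t) * \<mu>))"
    using ctg_strongly_convex[OF t, of "fst (\<theta> t)" "fst (\<theta>s t)"] mem
      quadratic_lower_bound[OF K, of "k + deriv (ctg t) (fst (\<theta> t))" "fst (\<theta>s t) - fst (\<theta> t)"]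
    by (simp add: gap_lo_def algebra_simps)
  show "gap_hi \<theta> t \<le> (deriv (ctg t) (snd (\<theta> t)) - q)\<^sup>2 / (2 * ((h t + b t) * \<mu>))"
    using ctg_strongly_convex[OF t, of "snd (\<theta> t)" "snd (\<theta>s t)"] mem
      quadratic_lower_bound[OF K, of "deriv (ctg t) (snd (\<theta> t)) - q" "snd (\<theta>s t) - snd (\<theta> t)"]
    by (simp add: gap_hi_def algebra_simps)
qed

text \<open>The parameters of \<open>\<theta>s\<close> minimize over the whole line, so the
  derivatives vanish even if a threshold sits at \<open>Blo\<close> or \<open>Bhi\<close>.\<close>

lemma deriv_ctg_opt:
  assumes t: "t \<in> {1..T}"
  shows "deriv (ctg t) (fst (\<theta>s t)) = - k" "deriv (ctg t) (snd (\<theta>s t)) = q"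
proof -
  have "((\<lambda>y. k * y + ctg t y) has_field_derivative k + deriv (ctg t) (fst (\<theta>s t))) (at (fst (\<theta>s t)))"
    by (auto intro!: derivative_eq_intros ctg_has_derivative[OF t])
  from DERIV_local_min[OF this zero_less_one] show "deriv (ctg t) (fst (\<theta>s t)) = - k"
    using opt_lo_ctg[OF t] by auto
  have "((\<lambda>y. - q * y + ctg t y) has_field_derivative - q + deriv (ctg t) (snd (\<theta>s t))) (at (snd (\<theta>s t)))"
    by (auto intro!: derivative_eq_intros ctg_has_derivative[OF t])
  from DERIV_local_min[OF this zero_less_one] show "deriv (ctg t) (snd (\<theta>s t)) = q"
    using opt_hi_ctg[OF t] by auto
qed

lemma deriv_ctg_mono:
  assumes t: "t \<in> {1..T}" and "x \<le> y"
  shows "deriv (ctg t) x \<le> deriv (ctg t) y"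
proof (cases "x = y")
  case False
  have "deriv (ctg t) x * (y - x) \<le> deriv (ctg t) y * (y - x)"
    using convex_has_derivative_above_tangent[OF ctg_convex[OF t] ctg_has_derivative[OF t], of x y]
      convex_has_derivative_above_tangent[OF ctg_convex[OF t] ctg_has_derivative[OF t], of y x]
    by (simp add: algebra_simps)
  then show ?thesis using False \<open>x \<le> y\<close> by simp
qed simp

text \<open>The last period is special: \<open>V (Suc T)\<close> is constant, and \<open>0\<close> may lie outside \<open>[- k, q]\<close>.
  Only the length of the range of the derivative is needed, since the derivative of the cost-to-go
  is known at the optimal parameters.\<close>

lemma deriv_avg_V_range:
  assumes t: "t \<in> {1..T}"
    and x: "(avg \<nu> (V (Suc t)) has_field_derivative d) (at x)"
    and y: "(avg \<nu> (V (Suc t)) has_field_derivative e) (at y)"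
  shows "d - e \<le> k + q"
proof (cases "t = T")
  case True
  then have "avg \<nu> (V (Suc t)) = (\<lambda>_. 0)" by (simp add: V_end avg_def[abs_def])
  then have "d = 0" "e = 0" using DERIV_unique[OF x] DERIV_unique[OF y] by auto
  then show ?thesis using kq by simp
next
  case False
  then have t': "Suc t \<in> {1..T}" using t by auto
  \<comment> \<open>The slope bounds of \<open>V_shift\<close> are averaged as monotonicity
    statements, which avoids differentiating \<open>V\<close> itself.\<close>
  have "mono (\<lambda>z. avg \<nu> (V (Suc t)) z + k * z)"
  proof (rule monoI)
    fix v w :: real assume "v \<le> w"
    then have "V (Suc t) (v - x) \<le> V (Suc t) (w - x) + k * (w - v)" for x
      using V_shift[OF t', of "v - x" "w - x"] by (simp add: trans_cost_def)
    then have "avg \<nu> (V (Suc t)) v \<le> (\<integral>x. V (Suc t) (w - x) + k * (w - v) \<partial>\<nu>)"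
      unfolding avg_def using int_V[OF t] by (intro integral_mono) auto
    also have "\<dots> = avg \<nu> (V (Suc t)) w + k * (w - v)"
      unfolding avg_def using int_V[OF t] by (simp add: prob_space[simplified])
    finally show "avg \<nu> (V (Suc t)) v + k * v \<le> avg \<nu> (V (Suc t)) w + k * w"
      by (simp add: algebra_simps)
  qed
  then have "0 \<le> e + k"
    by (rule mono_on_imp_deriv_nonneg[where A = UNIV])
      (auto intro!: derivative_eq_intros y)
  moreover have "mono (\<lambda>z. q * z - avg \<nu> (V (Suc t)) z)"
  proof (rule monoI)
    fix v w :: real assume "v \<le> w"
    then have "V (Suc t) (w - x) \<le> V (Suc t) (v - x) + q * (w - v)" for x
      using V_shift[OF t', of "w - x" "v - x"] by (simp add: trans_cost_down)
    then have "avg \<nu> (V (Suc t)) w \<le> (\<integral>x. V (Suc t) (v - x) + q * (w - v) \<partial>\<nu>)"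
      unfolding avg_def using int_V[OF t] by (intro integral_mono) auto
    also have "\<dots> = avg \<nu> (V (Suc t)) v + q * (w - v)"
      unfolding avg_def using int_V[OF t] by (simp add: prob_space[simplified])
    finally show "q * v - avg \<nu> (V (Suc t)) v \<le> q * w - avg \<nu> (V (Suc t)) w"
      by (simp add: algebra_simps)
  qed
  then have "0 \<le> q - d"
    by (rule mono_on_imp_deriv_nonneg[where A = UNIV])
      (auto intro!: derivative_eq_intros x)
  ultimately show ?thesis by simp
qed

text \<open>The derivative of the holding cost ranges over an interval of length
  \<open>h t + b t\<close>, that of the expected future value over one of length
  \<open>k + q\<close>.\<close>

lemma deriv_ctg_range:
  assumes t: "t \<in> {1..T}"
  shows "deriv (ctg t) x - deriv (ctg t) y \<le> (h t + b t) + (k + q)"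
proof -
  have "(h t + b t) * (cdf \<nu> x - cdf \<nu> y) \<le> (h t + b t) * 1"
    using hb[OF t] cdf_bounded_prob[of x] cdf_nonneg[of y] by (intro mult_left_mono) auto
  then show ?thesis
    using deriv_avg_V_range[OF t avg_V_has_derivative[OF t] avg_V_has_derivative[OF t], of x y]
    by (simp add: algebra_simps)
qed

end

section \<open>The inventory process\<close>

text \<open>The integrand vanishes if \<open>Sn n\<close> exceeds both thresholds and equals
  \<open>\<Phi> (an n) - \<Phi> a\<close> if it lies below both; the event \<open>S = a\<close>,
  where neither need persist, is null. Dividing by \<open>N n\<close> instead of
  \<open>an n - a\<close> allows this coordinate to stay fixed while other parameters move.\<close>

lemma (in prob_space) max_shift_expectation:
  fixes \<Phi> :: "real \<Rightarrow> real"
  assumes lip: "C-lipschitz_on UNIV \<Phi>" and deriv: "(\<Phi> has_field_derivative d) (at a)"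
    and [measurable]: "S \<in> borel_measurable M" "\<And>n. Sn n \<in> borel_measurable M"
    and Sn: "\<And>\<omega>. (\<lambda>n. Sn n \<omega>) \<longlonglongrightarrow> S \<omega>"
    and null: "AE \<omega> in M. S \<omega> \<noteq> a"
    and an: "an \<longlonglongrightarrow> a" and N: "\<And>n. 0 < N n" "\<And>n. \<bar>an n - a\<bar> \<le> N n"
  shows "(\<lambda>n. (expectation (\<lambda>\<omega>. \<Phi> (max (Sn n \<omega>) (an n)) - \<Phi> (max (Sn n \<omega>) a))
            - prob {\<omega> \<in> space M. S \<omega> \<le> a} * d * (an n - a)) / N n) \<longlonglongrightarrow> 0"
    and "integrable M (\<lambda>\<omega>. \<Phi> (max (Sn n \<omega>) (an n)) - \<Phi> (max (Sn n \<omega>) a))"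
proof -
  note [measurable] = lipschitz_on_borel_measurable[OF lip]
  have C: "0 \<le> C" using lip by (rule lipschitz_on_nonneg)
  have diff: "\<bar>\<Phi> (max s (an n)) - \<Phi> (max s a)\<bar> \<le> C * \<bar>an n - a\<bar>" for s n
  proof -
    have "\<bar>max s (an n) - max s a\<bar> \<le> \<bar>an n - a\<bar>" by simp
    with C show ?thesis
      by (intro order_trans[OF lipschitz_on_real_bound[OF lip]] mult_left_mono)
  qed
  then show int: "integrable M (\<lambda>\<omega>. \<Phi> (max (Sn n \<omega>) (an n)) - \<Phi> (max (Sn n \<omega>) a))" for n
    by (intro integrable_const_bound[where B = "C * \<bar>an n - a\<bar>"]) auto
  let ?i = "\<lambda>\<omega>. indicator {\<omega> \<in> space M. S \<omega> \<le> a} \<omega> :: real"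
  let ?R = "\<lambda>n \<omega>. (\<Phi> (max (Sn n \<omega>) (an n)) - \<Phi> (max (Sn n \<omega>) a) - ?i \<omega> * (d * (an n - a))) / N n"
  have "(\<lambda>n. expectation (?R n)) \<longlonglongrightarrow> expectation (\<lambda>_. 0)"
  proof (rule integral_dominated_convergence[where w = "\<lambda>_. C + \<bar>d\<bar>"])
    show "AE \<omega> in M. (\<lambda>n. ?R n \<omega>) \<longlonglongrightarrow> 0"
      using null AE_space
    proof eventually_elim
      fix \<omega> assume \<omega>: "S \<omega> \<noteq> a" "\<omega> \<in> space M"
      have lim: "(\<lambda>n. an n - Sn n \<omega>) \<longlonglongrightarrow> a - S \<omega>" "(\<lambda>n. a - Sn n \<omega>) \<longlonglongrightarrow> a - S \<omega>"
        by (intro tendsto_intros an Sn)+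
      show "(\<lambda>n. ?R n \<omega>) \<longlonglongrightarrow> 0"
      proof (cases "S \<omega> < a")
        case True
        then have "0 < a - S \<omega>" by simp
        from order_tendstoD(1)[OF lim(1) this] order_tendstoD(1)[OF lim(2) this]
        have R: "\<forall>\<^sub>F n in sequentially. ?R n \<omega> = (\<Phi> (an n) - \<Phi> a - d * (an n - a)) / N n"
          by eventually_elim (use True \<omega> in \<open>simp add: max_absorb2\<close>)
        \<comment> \<open>Caratheodory's form of the derivative remains valid where
          \<open>an n = a\<close>.\<close>
        obtain g where g: "\<And>z. \<Phi> z - \<Phi> a = g z * (z - a)" "isCont g a" "g a = d"
          using deriv CARAT_DERIV by blast
        have "(\<lambda>n. (\<Phi> (an n) - \<Phi> a - d * (an n - a)) / N n) \<longlonglongrightarrow> 0"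
        proof (rule tendsto_rabs_zero_cancel, rule tendsto_sandwich[OF _ _ tendsto_const])
          have "(\<lambda>n. g (an n)) \<longlonglongrightarrow> d"
            using isCont_tendsto_compose[OF g(2) an] g(3) by simp
          then have "(\<lambda>n. \<bar>g (an n) - d\<bar>) \<longlonglongrightarrow> \<bar>d - d\<bar>"
            by (intro tendsto_intros)
          then show "(\<lambda>n. \<bar>g (an n) - d\<bar>) \<longlonglongrightarrow> 0" by simp
          have "\<bar>(\<Phi> (an n) - \<Phi> a - d * (an n - a)) / N n\<bar> \<le> \<bar>g (an n) - d\<bar>" for n
          proof -
            have "\<Phi> (an n) - \<Phi> a - d * (an n - a) = (g (an n) - d) * (an n - a)"
              by (simp add: g(1) left_diff_distrib)
            then have "\<bar>\<Phi> (an n) - \<Phi> a - d * (an n - a)\<bar> \<le> \<bar>g (an n) - d\<bar> * N n"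
              using N(2)[of n] by (simp add: abs_mult mult_left_mono)
            then show ?thesis using N(1)[of n] by (simp add: divide_le_eq)
          qed
          then show "\<forall>\<^sub>F n in sequentially. \<bar>(\<Phi> (an n) - \<Phi> a - d * (an n - a)) / N n\<bar> \<le> \<bar>g (an n) - d\<bar>"
            by simp
        qed simp
        then show ?thesis using tendsto_cong[OF R] by blast
      next
        case False
        then have "a - S \<omega> < 0" using \<omega> by simp
        from order_tendstoD(2)[OF lim(1) this] order_tendstoD(2)[OF lim(2) this]
        have "\<forall>\<^sub>F n in sequentially. ?R n \<omega> = 0"
          by eventually_elim (use False \<omega> in \<open>simp add: max_absorb1\<close>)
        then show ?thesis by (rule tendsto_eventually)
      qed
    qed
    fix n
    show "AE \<omega> in M. norm (?R n \<omega>) \<le> C + \<bar>d\<bar>"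
    proof (rule AE_I2)
      fix \<omega>
      have "\<bar>?i \<omega> * (d * (an n - a))\<bar> \<le> \<bar>d\<bar> * \<bar>an n - a\<bar>"
        by (auto simp: indicator_def abs_mult)
      then have "\<bar>\<Phi> (max (Sn n \<omega>) (an n)) - \<Phi> (max (Sn n \<omega>) a) - ?i \<omega> * (d * (an n - a))\<bar>
          \<le> C * \<bar>an n - a\<bar> + \<bar>d\<bar> * \<bar>an n - a\<bar>"
        by (intro order_trans[OF abs_triangle_ineq4] add_mono diff)
      also have "\<dots> \<le> (C + \<bar>d\<bar>) * N n"
        using N(2)[of n] C by (auto simp: distrib_right intro!: add_mono mult_left_mono)
      finally show "norm (?R n \<omega>) \<le> C + \<bar>d\<bar>"
        using N(1)[of n] by (simp add: divide_le_eq abs_divide)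
    qed
  qed auto
  moreover have "expectation (?R n) = (expectation (\<lambda>\<omega>. \<Phi> (max (Sn n \<omega>) (an n)) - \<Phi> (max (Sn n \<omega>) a))
            - prob {\<omega> \<in> space M. S \<omega> \<le> a} * d * (an n - a)) / N n" for n
  proof -
    have "integrable M ?i" by (intro integrable_real_indicator) (auto simp: emeasure_eq_measure)
    then have "expectation (\<lambda>\<omega>. \<Phi> (max (Sn n \<omega>) (an n)) - \<Phi> (max (Sn n \<omega>) a) - ?i \<omega> * (d * (an n - a)))
      = expectation (\<lambda>\<omega>. \<Phi> (max (Sn n \<omega>) (an n)) - \<Phi> (max (Sn n \<omega>) a)) - expectation (\<lambda>\<omega>. ?i \<omega> * (d * (an n - a)))"
      using int by (intro Bochner_Integration.integral_diff) auto
    then show ?thesis by (simp add: mult.assoc)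
  qed
  ultimately show "(\<lambda>n. (expectation (\<lambda>\<omega>. \<Phi> (max (Sn n \<omega>) (an n)) - \<Phi> (max (Sn n \<omega>) a))
            - prob {\<omega> \<in> space M. S \<omega> \<le> a} * d * (an n - a)) / N n) \<longlonglongrightarrow> 0"
    by (simp only: Bochner_Integration.integral_zero)
qed

lemma (in prob_space) min_shift_expectation:
  fixes \<Psi> :: "real \<Rightarrow> real"
  assumes lip: "C-lipschitz_on UNIV \<Psi>" and deriv: "(\<Psi> has_field_derivative d) (at a)"
    and [measurable]: "S \<in> borel_measurable M" "\<And>n. Sn n \<in> borel_measurable M"
    and Sn: "\<And>\<omega>. (\<lambda>n. Sn n \<omega>) \<longlonglongrightarrow> S \<omega>"
    and null: "AE \<omega> in M. S \<omega> \<noteq> a"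
    and an: "an \<longlonglongrightarrow> a" and N: "\<And>n. 0 < N n" "\<And>n. \<bar>an n - a\<bar> \<le> N n"
  shows "(\<lambda>n. (expectation (\<lambda>\<omega>. \<Psi> (min (Sn n \<omega>) (an n)) - \<Psi> (min (Sn n \<omega>) a))
            - prob {\<omega> \<in> space M. a \<le> S \<omega>} * d * (an n - a)) / N n) \<longlonglongrightarrow> 0"
    and "integrable M (\<lambda>\<omega>. \<Psi> (min (Sn n \<omega>) (an n)) - \<Psi> (min (Sn n \<omega>) a))"
proof -
  have min: "min s x = - max (- s) (- x)" for s x :: real
    by (simp add: max_def min_def)
  have lip': "C-lipschitz_on UNIV (\<lambda>z. \<Psi> (- z))"
  proof (rule lipschitz_on_realI[OF lipschitz_on_nonneg[OF lip]])
    show "\<bar>\<Psi> (- x) - \<Psi> (- y)\<bar> \<le> C * \<bar>x - y\<bar>" for x y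
      using lipschitz_on_real_bound[OF lip, of "- x" "- y"] by (simp add: abs_minus_commute)
  qed
  have deriv': "((\<lambda>z. \<Psi> (- z)) has_field_derivative - d) (at (- a))"
    using deriv DERIV_mirror[of \<Psi> d "- a"] by simp
  have an': "(\<lambda>n. - an n) \<longlonglongrightarrow> - a" and Sn': "\<And>\<omega>. (\<lambda>n. - Sn n \<omega>) \<longlonglongrightarrow> - S \<omega>"
    and N': "\<bar>- an n - - a\<bar> \<le> N n" and null': "AE \<omega> in M. - S \<omega> \<noteq> - a" for n
    using N(2)[of n] null by (auto intro!: tendsto_intros an Sn simp: abs_minus_commute)
  have meas: "(\<lambda>\<omega>. - S \<omega>) \<in> borel_measurable M" "(\<lambda>\<omega>. - Sn n \<omega>) \<in> borel_measurable M" for n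
    by measurable
  note shift = max_shift_expectation[OF lip' deriv' meas Sn' null' an' N(1) N']
  show "(\<lambda>n. (expectation (\<lambda>\<omega>. \<Psi> (min (Sn n \<omega>) (an n)) - \<Psi> (min (Sn n \<omega>) a))
            - prob {\<omega> \<in> space M. a \<le> S \<omega>} * d * (an n - a)) / N n) \<longlonglongrightarrow> 0"
    using shift(1) by (simp add: min algebra_simps)
  show "integrable M (\<lambda>\<omega>. \<Psi> (min (Sn n \<omega>) (an n)) - \<Psi> (min (Sn n \<omega>) a))"
    using shift(2)[of n] by (simp add: min)
qed

text \<open>Running the recursion on the coordinates of a product space exhibits the stock of period
  \<open>t\<close> as a function of \<open>s1\<close> and the demands before \<open>t\<close>. This
  gives independence of the current demand.\<close>

lemma inventory_coordinates:
  assumes "1 \<le> t" "t \<le> n"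
  shows "inventory (\<lambda>x. x 0) (\<lambda>i x. x i) \<theta> t (restrict (\<lambda>i. if i = 0 then s1 \<omega> else D i \<omega>) {0..<n})
    = inventory s1 D \<theta> t \<omega>"
  using assms by (induction t) auto

lemma inventory_coordinates_measurable:
  "1 \<le> t \<Longrightarrow> t \<le> n \<Longrightarrow>
    inventory (\<lambda>x. x 0) (\<lambda>i x. x i) \<theta> t \<in> borel_measurable (PiM {0..<n} (\<lambda>_. borel :: real measure))"
proof (induction t)
  case (Suc t)
  show ?case
  proof (cases "t = 0")
    case True
    then show ?thesis using Suc.prems by simp
  next
    case False
    then have [measurable]: "inventory (\<lambda>x. x 0) (\<lambda>i x. x i) \<theta> t \<in> borel_measurable (PiM {0..<n} (\<lambda>_. borel :: real measure))"
      using Suc by simp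
    have [measurable]: "(\<lambda>x. x t) \<in> borel_measurable (PiM {0..<n} (\<lambda>_. borel :: real measure))"
      using Suc.prems by simp
    show ?thesis using False by simp
  qed
qed simp

lemma inventory_tendsto:
  assumes "\<And>i. 1 \<le> i \<Longrightarrow> i < t \<Longrightarrow> (\<lambda>n. X n i) \<longlonglongrightarrow> \<theta> i"
  shows "(\<lambda>n. inventory s1 D (X n) t \<omega>) \<longlonglongrightarrow> inventory s1 D \<theta> t \<omega>"
  using assms
proof (induction t)
  case (Suc t)
  show ?case
  proof (cases "t = 0")
    case False
    with Suc have "(\<lambda>n. X n t) \<longlonglongrightarrow> \<theta> t"
      "(\<lambda>n. inventory s1 D (X n) t \<omega>) \<longlonglongrightarrow> inventory s1 D \<theta> t \<omega>"
      by auto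
    then show ?thesis
      using False by (auto simp: base_stock_def intro!: tendsto_intros)
  qed simp
qed simp

section \<open>Laws of the stocks along a trajectory\<close>

locale cash_balance_process = cash_balance \<nu> L \<mu> k q Blo Bhi T h b V \<theta>s + P: prob_space P
  for \<nu> L \<mu> k q Blo Bhi T h b V \<theta>s and P :: "'w measure" +
  fixes s1 :: "'w \<Rightarrow> real" and D :: "nat \<Rightarrow> 'w \<Rightarrow> real" and \<alpha> :: real
  assumes indep: "P.indep_vars (\<lambda>_. borel) (\<lambda>i. if i = 0 then s1 else D i) {0..T}"
    and D_distr: "\<And>t. t \<in> {1..T} \<Longrightarrow> distr P borel (D t) = \<nu>"
    and s1_null: "\<And>x. measure P {\<omega> \<in> space P. s1 \<omega> = x} = 0"
    and \<alpha>_pos: "0 < \<alpha>"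
    and s1_lower: "\<alpha> \<le> measure P {\<omega> \<in> space P. s1 \<omega> \<le> Blo}"
    and s1_upper: "\<alpha> \<le> measure P {\<omega> \<in> space P. Bhi \<le> s1 \<omega>}"
    and D_upper: "\<And>t. t \<in> {1..T} \<Longrightarrow> \<alpha> \<le> measure P {\<omega> \<in> space P. Bhi - Blo \<le> D t \<omega>}"
    and D_lower: "\<And>t. t \<in> {1..T} \<Longrightarrow> \<alpha> \<le> measure P {\<omega> \<in> space P. D t \<omega> \<le> Blo - Bhi}"
    and finite_cost: "\<And>\<theta>. feasible \<theta> \<Longrightarrow> integrable P (\<lambda>\<omega>. \<Sum>t = 1..T.
        trans_cost k q (base_stock (\<theta> t) (inventory s1 D \<theta> t \<omega>)) (inventory s1 D \<theta> t \<omega>)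
        + avg \<nu> (hold_cost (h t) (b t)) (base_stock (\<theta> t) (inventory s1 D \<theta> t \<omega>)))"
begin

abbreviation stock :: "(nat \<Rightarrow> real \<times> real) \<Rightarrow> nat \<Rightarrow> 'w \<Rightarrow> real" where
  "stock \<equiv> inventory s1 D"

text \<open>The level after ordering, not the quantity ordered.\<close>

abbreviation order :: "(nat \<Rightarrow> real \<times> real) \<Rightarrow> nat \<Rightarrow> 'w \<Rightarrow> real" where
  "order \<theta> t \<omega> \<equiv> base_stock (\<theta> t) (stock \<theta> t \<omega>)"

lemma stock_1: "stock \<theta> (Suc 0) \<omega> = s1 \<omega>"
  by simp

lemma stock_Suc: "t \<in> {1..T} \<Longrightarrow> stock \<theta> (Suc t) \<omega> = order \<theta> t \<omega> - D t \<omega>"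
  by simp

declare inventory.simps [simp del]

lemma s1_measurable [measurable]: "s1 \<in> borel_measurable P"
  using indep unfolding P.indep_vars_def2 by force

lemma D_measurable: "t \<in> {1..T} \<Longrightarrow> D t \<in> borel_measurable P"
  using indep unfolding P.indep_vars_def2 by force

lemma stock_measurable: "t \<in> {1..Suc T} \<Longrightarrow> stock \<theta> t \<in> borel_measurable P"
proof (induction t)
  case (Suc t)
  show ?case
  proof (cases "t = 0")
    case False
    then have t: "t \<in> {1..T}" using Suc.prems by simp
    have [measurable]: "stock \<theta> t \<in> borel_measurable P" "D t \<in> borel_measurable P"
      using Suc.IH D_measurable t by auto
    show ?thesis unfolding stock_Suc[OF t, abs_def] by measurable
  qed (simp add: stock_1[abs_def])
qed simp

lemma order_measurable: "t \<in> {1..T} \<Longrightarrow> order \<theta> t \<in> borel_measurable P"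
  by (intro measurable_compose[OF stock_measurable base_stock_measurable]) auto

lemma order_indep_demand:
  assumes t: "t \<in> {1..T}"
  shows "P.indep_var borel (order \<theta> t) borel (D t)"
proof -
  let ?X = "\<lambda>i. if i = 0 then s1 else D i"
  let ?F = "\<lambda>x. base_stock (\<theta> t) (inventory (\<lambda>x. x 0) (\<lambda>i x. x i) \<theta> t x)"
  have "P.indep_var (PiM {0..<t} (\<lambda>_. borel)) (\<lambda>\<omega>. restrict (\<lambda>i. ?X i \<omega>) {0..<t})
      (PiM {t} (\<lambda>_. borel)) (\<lambda>\<omega>. restrict (\<lambda>i. ?X i \<omega>) {t})"
    using t by (intro P.indep_var_restrict[OF indep]) auto
  then have "P.indep_var borel (?F \<circ> (\<lambda>\<omega>. restrict (\<lambda>i. ?X i \<omega>) {0..<t}))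
      borel ((\<lambda>x. x t) \<circ> (\<lambda>\<omega>. restrict (\<lambda>i. ?X i \<omega>) {t}))"
  proof (rule P.indep_var_compose)
    show "?F \<in> borel_measurable (PiM {0..<t} (\<lambda>_. borel))"
      using t by (intro measurable_compose[OF inventory_coordinates_measurable base_stock_measurable]) auto
  qed simp
  moreover have "?F \<circ> (\<lambda>\<omega>. restrict (\<lambda>i. ?X i \<omega>) {0..<t}) = order \<theta> t"
  proof
    fix \<omega>
    have "(\<lambda>i. ?X i \<omega>) = (\<lambda>i. if i = 0 then s1 \<omega> else D i \<omega>)" by auto
    then show "(?F \<circ> (\<lambda>\<omega>. restrict (\<lambda>i. ?X i \<omega>) {0..<t})) \<omega> = order \<theta> t \<omega>"
      using inventory_coordinates[of t t \<theta> s1 \<omega> D] t by (simp only: o_def) simp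
  qed
  moreover have "(\<lambda>x. x t) \<circ> (\<lambda>\<omega>. restrict (\<lambda>i. ?X i \<omega>) {t}) = D t"
    using t by auto
  ultimately show ?thesis by simp
qed

text \<open>Level and demand are independent, so their joint law is a product and Fubini integrates
  the demand first.\<close>

lemma expectation_next_stock:
  fixes \<phi> :: "real \<Rightarrow> real"
  assumes t: "t \<in> {1..T}" and [measurable]: "\<phi> \<in> borel_measurable borel"
    and int: "integrable P (\<lambda>\<omega>. \<phi> (stock \<theta> (Suc t) \<omega>))"
  shows "P.expectation (\<lambda>\<omega>. \<phi> (stock \<theta> (Suc t) \<omega>)) = P.expectation (\<lambda>\<omega>. avg \<nu> \<phi> (order \<theta> t \<omega>))"
    and "integrable P (\<lambda>\<omega>. avg \<nu> \<phi> (order \<theta> t \<omega>))"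
proof -
  have [measurable]: "order \<theta> t \<in> borel_measurable P" "D t \<in> borel_measurable P"
    using t by (auto intro: order_measurable D_measurable)
  define N where "N = distr P borel (order \<theta> t)"
  interpret N: prob_space N unfolding N_def by (rule P.prob_space_distr) measurable
  interpret N\<nu>: pair_prob_space N \<nu> ..
  have joint: "distr P (borel \<Otimes>\<^sub>M borel) (\<lambda>\<omega>. (order \<theta> t \<omega>, D t \<omega>)) = N \<Otimes>\<^sub>M \<nu>"
    using order_indep_demand[OF t] unfolding P.indep_var_distribution_eq N_def D_distr[OF t] by simp
  have int': "integrable (N \<Otimes>\<^sub>M \<nu>) (\<lambda>z. \<phi> (fst z - snd z))"
    unfolding joint[symmetric] using int by (subst integrable_distr_eq) (auto simp: stock_Suc[OF t])
  have int'': "integrable (N \<Otimes>\<^sub>M \<nu>) (\<lambda>(y, x). \<phi> (y - x))"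
    using int' by (simp add: case_prod_unfold)
  have "P.expectation (\<lambda>\<omega>. \<phi> (stock \<theta> (Suc t) \<omega>)) = (\<integral>z. \<phi> (fst z - snd z) \<partial>(N \<Otimes>\<^sub>M \<nu>))"
    unfolding joint[symmetric] by (subst integral_distr) (auto simp: stock_Suc[OF t])
  also have "\<dots> = (\<integral>y. (\<integral>x. \<phi> (y - x) \<partial>\<nu>) \<partial>N)"
    using N\<nu>.integral_fst'[OF int'] by simp
  also have "\<dots> = P.expectation (\<lambda>\<omega>. avg \<nu> \<phi> (order \<theta> t \<omega>))"
    unfolding N_def avg_def by (subst integral_distr) auto
  finally show "P.expectation (\<lambda>\<omega>. \<phi> (stock \<theta> (Suc t) \<omega>)) = P.expectation (\<lambda>\<omega>. avg \<nu> \<phi> (order \<theta> t \<omega>))" .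
  have "integrable N (\<lambda>y. avg \<nu> \<phi> y)"
    unfolding avg_def using N\<nu>.integrable_fst'[OF int'] by simp
  then show "integrable P (\<lambda>\<omega>. avg \<nu> \<phi> (order \<theta> t \<omega>))"
    unfolding N_def by (rule integrable_distr[rotated]) measurable
qed

lemma order_mem: "feasible \<theta> \<Longrightarrow> t \<in> {1..T} \<Longrightarrow> order \<theta> t \<omega> \<in> {Blo..Bhi}"
  using base_stock_mem[OF feasibleD(2), of \<theta> t "stock \<theta> t \<omega>"] feasibleD[of \<theta> t] by auto

lemma integrable_order:
  fixes \<phi> :: "real \<Rightarrow> real"
  assumes \<theta>: "feasible \<theta>" and t: "t \<in> {1..T}" and lip: "C-lipschitz_on UNIV \<phi>"
  shows "integrable P (\<lambda>\<omega>. \<phi> (order \<theta> t \<omega>))"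
proof (rule P.integrable_const_bound[where B = "\<bar>\<phi> Blo\<bar> + C * (Bhi - Blo)"])
  have "\<bar>\<phi> (order \<theta> t \<omega>)\<bar> \<le> \<bar>\<phi> Blo\<bar> + C * (Bhi - Blo)" for \<omega>
  proof -
    have "\<bar>\<phi> (order \<theta> t \<omega>) - \<phi> Blo\<bar> \<le> C * \<bar>order \<theta> t \<omega> - Blo\<bar>"
      by (rule lipschitz_on_real_bound[OF lip])
    also have "\<dots> \<le> C * (Bhi - Blo)"
      using order_mem[OF \<theta> t, of \<omega>] lipschitz_on_nonneg[OF lip] by (intro mult_left_mono) auto
    finally show ?thesis by linarith
  qed
  then show "AE \<omega> in P. norm (\<phi> (order \<theta> t \<omega>)) \<le> \<bar>\<phi> Blo\<bar> + C * (Bhi - Blo)" by simp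
qed (intro measurable_compose[OF order_measurable[OF t] lipschitz_on_borel_measurable[OF lip]])

text \<open>The level stays in \<open>{Blo..Bhi}\<close>, so the next stock is within
  \<open>Bhi - Blo\<close> of \<open>Blo - D t \<omega>\<close>, and the Lipschitz property
  transfers integrability.\<close>

lemma integrable_next_stock:
  fixes \<phi> :: "real \<Rightarrow> real"
  assumes \<theta>: "feasible \<theta>" and t: "t \<in> {1..T}" and lip: "C-lipschitz_on UNIV \<phi>"
    and int: "\<And>y. integrable \<nu> (\<lambda>x. \<phi> (y - x))"
  shows "integrable P (\<lambda>\<omega>. \<phi> (stock \<theta> (Suc t) \<omega>))"
proof (rule Bochner_Integration.integrable_bound)
  have [measurable]: "\<phi> \<in> borel_measurable borel" "D t \<in> borel_measurable P"
    "stock \<theta> (Suc t) \<in> borel_measurable P"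
    using lipschitz_on_borel_measurable[OF lip] D_measurable[OF t] stock_measurable t by auto
  have "integrable P (\<lambda>\<omega>. \<phi> (Blo - D t \<omega>))"
    using int[of Blo] unfolding D_distr[OF t, symmetric] by (subst (asm) integrable_distr_eq) auto
  then show "integrable P (\<lambda>\<omega>. \<bar>\<phi> (Blo - D t \<omega>)\<bar> + C * (Bhi - Blo))" by simp
  show "(\<lambda>\<omega>. \<phi> (stock \<theta> (Suc t) \<omega>)) \<in> borel_measurable P" by measurable
  have "\<bar>\<phi> (stock \<theta> (Suc t) \<omega>)\<bar> \<le> \<bar>\<phi> (Blo - D t \<omega>)\<bar> + C * (Bhi - Blo)" for \<omega>
  proof -
    have "\<bar>\<phi> (stock \<theta> (Suc t) \<omega>) - \<phi> (Blo - D t \<omega>)\<bar> \<le> C * \<bar>order \<theta> t \<omega> - Blo\<bar>"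
      using lipschitz_on_real_bound[OF lip, of "stock \<theta> (Suc t) \<omega>" "Blo - D t \<omega>"] by (simp add: stock_Suc[OF t])
    also have "\<dots> \<le> C * (Bhi - Blo)"
      using order_mem[OF \<theta> t, of \<omega>] lipschitz_on_nonneg[OF lip] by (intro mult_left_mono) auto
    finally show ?thesis by linarith
  qed
  then show "AE \<omega> in P. norm (\<phi> (stock \<theta> (Suc t) \<omega>)) \<le> norm (\<bar>\<phi> (Blo - D t \<omega>)\<bar> + C * (Bhi - Blo))"
    by (intro AE_I2) (simp add: order_trans[OF _ abs_ge_self])
qed

text \<open>In period 1 the law of \<open>s1\<close> has no atoms; later the independent demand
  alone removes them.\<close>

lemma stock_null:
  assumes t: "t \<in> {1..T}"
  shows "AE \<omega> in P. stock \<theta> t \<omega> \<noteq> x"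
proof -
  have [measurable]: "stock \<theta> t \<in> borel_measurable P" using t by (intro stock_measurable) auto
  have "P.prob {\<omega> \<in> space P. stock \<theta> t \<omega> = x} = 0"
  proof (cases "t = 1")
    case True
    then show ?thesis using s1_null by (simp add: stock_1)
  next
    case False
    then obtain n where n: "t = Suc n" "n \<in> {1..T}" using t by (cases t) auto
    have "integrable P (\<lambda>\<omega>. indicator {x} (stock \<theta> t \<omega>) :: real)"
      by (rule P.integrable_const_bound[where B = 1]) auto
    then have "P.expectation (\<lambda>\<omega>. indicat_real {x} (stock \<theta> t \<omega>)) = P.expectation (\<lambda>\<omega>. avg \<nu> (indicator {x}) (order \<theta> n \<omega>))"
      unfolding n(1) by (intro expectation_next_stock[OF n(2)]) auto
    moreover have "avg \<nu> (indicator {x}) y = 0" for y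
    proof -
      have "(\<lambda>z. indicator {x} (y - z) :: real) = indicator {y - x}"
        by (auto simp: indicator_def fun_eq_iff)
      then show ?thesis by (simp add: avg_def prob_singleton)
    qed
    moreover have "P.expectation (\<lambda>\<omega>. indicat_real {x} (stock \<theta> t \<omega>)) = P.prob {\<omega> \<in> space P. stock \<theta> t \<omega> = x}"
    proof -
      have "P.expectation (\<lambda>\<omega>. indicat_real {x} (stock \<theta> t \<omega>)) = P.expectation (indicat_real {\<omega> \<in> space P. stock \<theta> t \<omega> = x})"
        by (intro Bochner_Integration.integral_cong) (auto simp: indicator_def)
      then show ?thesis by simp
    qed
    ultimately show ?thesis by simp
  qed
  then have "AE \<omega> in P. \<omega> \<notin> {\<omega> \<in> space P. stock \<theta> t \<omega> = x}"
    by (intro AE_not_in) (simp add: null_sets_def P.emeasure_eq_measure)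
  with AE_space show ?thesis by eventually_elim auto
qed

text \<open>From period 2 on the previous level is at most \<open>Bhi\<close>, so a demand of at
  least \<open>Bhi - Blo\<close> brings the stock to \<open>Blo\<close> or lower whatever the past.
  Hence the probability that a threshold binds does not decay with \<open>t\<close>.\<close>

lemma stock_below:
  assumes \<theta>: "feasible \<theta>" and t: "t \<in> {1..T}" and x: "Blo \<le> x"
  shows "\<alpha> \<le> P.prob {\<omega> \<in> space P. stock \<theta> t \<omega> \<le> x}"
proof -
  have [measurable]: "stock \<theta> t \<in> borel_measurable P" using t by (intro stock_measurable) auto
  show ?thesis
  proof (cases "t = 1")
    case True
    have "P.prob {\<omega> \<in> space P. s1 \<omega> \<le> Blo} \<le> P.prob {\<omega> \<in> space P. s1 \<omega> \<le> x}"
      using x by (intro P.finite_measure_mono) auto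
    then show ?thesis using True s1_lower by (simp add: stock_1)
  next
    case False
    then obtain n where n: "t = Suc n" "n \<in> {1..T}" using t by (cases t) auto
    have "P.prob {\<omega> \<in> space P. Bhi - Blo \<le> D n \<omega>} \<le> P.prob {\<omega> \<in> space P. stock \<theta> t \<omega> \<le> x}"
    proof (rule P.finite_measure_mono)
      show "{\<omega> \<in> space P. Bhi - Blo \<le> D n \<omega>} \<subseteq> {\<omega> \<in> space P. stock \<theta> t \<omega> \<le> x}"
        (is "?A \<subseteq> ?B")
      proof
        fix \<omega> assume "\<omega> \<in> ?A"
        then show "\<omega> \<in> ?B"
          using order_mem[OF \<theta> n(2), of \<omega>] x by (simp add: n(1) stock_Suc[OF n(2)])
      qed
    qed measurable
    then show ?thesis using D_upper[OF n(2)] by linarith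
  qed
qed

lemma stock_above:
  assumes \<theta>: "feasible \<theta>" and t: "t \<in> {1..T}" and x: "x \<le> Bhi"
  shows "\<alpha> \<le> P.prob {\<omega> \<in> space P. x \<le> stock \<theta> t \<omega>}"
proof -
  have [measurable]: "stock \<theta> t \<in> borel_measurable P" using t by (intro stock_measurable) auto
  show ?thesis
  proof (cases "t = 1")
    case True
    have "P.prob {\<omega> \<in> space P. Bhi \<le> s1 \<omega>} \<le> P.prob {\<omega> \<in> space P. x \<le> s1 \<omega>}"
      using x by (intro P.finite_measure_mono) auto
    then show ?thesis using True s1_upper by (simp add: stock_1)
  next
    case False
    then obtain n where n: "t = Suc n" "n \<in> {1..T}" using t by (cases t) auto
    have "P.prob {\<omega> \<in> space P. D n \<omega> \<le> Blo - Bhi} \<le> P.prob {\<omega> \<in> space P. x \<le> stock \<theta> t \<omega>}"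
    proof (rule P.finite_measure_mono)
      show "{\<omega> \<in> space P. D n \<omega> \<le> Blo - Bhi} \<subseteq> {\<omega> \<in> space P. x \<le> stock \<theta> t \<omega>}"
        (is "?A \<subseteq> ?B")
      proof
        fix \<omega> assume "\<omega> \<in> ?A"
        then show "\<omega> \<in> ?B"
          using order_mem[OF \<theta> n(2), of \<omega>] x by (simp add: n(1) stock_Suc[OF n(2)])
      qed
    qed measurable
    then show ?thesis using D_lower[OF n(2)] by linarith
  qed
qed

section \<open>Performance differences and the policy gradient\<close>

definition objective :: "(nat \<Rightarrow> real \<times> real) \<Rightarrow> real" where
  "objective \<theta> = P.expectation (\<lambda>\<omega>. \<Sum>t = 1..T. trans_cost k q (order \<theta> t \<omega>) (stock \<theta> t \<omega>)
     + avg \<nu> (hold_cost (h t) (b t)) (order \<theta> t \<omega>))"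

section \<open>Finiteness of the expectations\<close>

lemma integrable_policy_value_later:
  assumes "feasible \<theta>" "feasible \<theta>'" "t \<in> {1..T}"
  shows "integrable P (\<lambda>\<omega>. policy_value \<theta> (Suc t) (stock \<theta>' (Suc t) \<omega>))"
proof -
  obtain C where "C-lipschitz_on UNIV (policy_value \<theta> (Suc t))"
    using policy_value_bounds[of \<theta> "Suc t"] assms by auto
  then show ?thesis
    using assms by (intro integrable_next_stock policy_value_integrable)
qed

lemma integrable_action_value:
  assumes "feasible \<theta>" "feasible \<theta>'" "t \<in> {1..T}"
  shows "integrable P (\<lambda>\<omega>. action_value \<theta> t (order \<theta>' t \<omega>))"
  using action_value_lipschitz[OF assms(1,3)] integrable_order[OF assms(2,3)] by blast

text \<open>Only the total cost is known to be integrable. From period 2 on, the transaction cost is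
  a policy value minus an action value, both integrable since the stock is a bounded level minus a
  demand. In period 1 the stock is \<open>s1\<close>, so the cost is recovered by subtracting all
  other terms from the total.\<close>

lemma integrable_trans_cost:
  assumes \<theta>: "feasible \<theta>" and t: "t \<in> {1..T}"
  shows "integrable P (\<lambda>\<omega>. trans_cost k q (order \<theta> t \<omega>) (stock \<theta> t \<omega>))"
proof -
  have later: "integrable P (\<lambda>\<omega>. trans_cost k q (order \<theta> (Suc n) \<omega>) (stock \<theta> (Suc n) \<omega>))"
    if "n \<in> {1..<T}" for n
  proof -
    have n: "n \<in> {1..T}" "Suc n \<in> {1..T}" using that by auto
    from Bochner_Integration.integrable_diff[OF integrable_policy_value_later[OF \<theta> \<theta> n(1)]
        integrable_action_value[OF \<theta> \<theta> n(2)]]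
    show ?thesis by (simp add: policy_value_step[OF n(2)])
  qed
  show ?thesis
  proof (cases "t = 1")
    case False
    with t obtain n where "t = Suc n" "n \<in> {1..<T}" by (cases t) auto
    then show ?thesis using later by simp
  next
    case True
    let ?c = "\<lambda>t \<omega>. trans_cost k q (order \<theta> t \<omega>) (stock \<theta> t \<omega>)"
    let ?L = "\<lambda>t \<omega>. avg \<nu> (hold_cost (h t) (b t)) (order \<theta> t \<omega>)"
    have hold: "integrable P (?L t)" if "t \<in> {1..T}" for t
      by (rule integrable_order[OF \<theta> that hold_lipschitz[OF that]])
    have "integrable P (\<lambda>\<omega>. \<Sum>t=2..T. ?c t \<omega> + ?L t \<omega>)"
    proof (intro Bochner_Integration.integrable_sum Bochner_Integration.integrable_add)
      fix n assume n: "n \<in> {2..T}"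
      then obtain m where "n = Suc m" "m \<in> {1..<T}" by (cases n) auto
      then show "integrable P (?c n)" using later by simp
      show "integrable P (?L n)" using n by (intro hold) auto
    qed
    from Bochner_Integration.integrable_diff[OF finite_cost[OF \<theta>] this]
    have "integrable P (\<lambda>\<omega>. (\<Sum>t=1..T. ?c t \<omega> + ?L t \<omega>) - (\<Sum>t=2..T. ?c t \<omega> + ?L t \<omega>))" .
    moreover have "(\<Sum>t=1..T. F t) = F 1 + (\<Sum>t=2..T. F t)" for F :: "nat \<Rightarrow> real"
      using t by (simp add: sum.atLeast_Suc_atMost numeral_2_eq_2)
    ultimately have "integrable P (\<lambda>\<omega>. ?c 1 \<omega> + ?L 1 \<omega>)"
      by (simp only: add_diff_cancel_right')
    from Bochner_Integration.integrable_diff[OF this hold[of 1]] show ?thesis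
      using True t by simp
  qed
qed

text \<open>In period 1 the stock is \<open>s1\<close> under every policy, so
  \<open>\<theta>'\<close> may be replaced by \<open>\<theta>\<close>, whose own costs are
  integrable.\<close>

lemma integrable_policy_value:
  assumes \<theta>: "feasible \<theta>" and \<theta>': "feasible \<theta>'" and t: "t \<in> {1..Suc T}"
  shows "integrable P (\<lambda>\<omega>. policy_value \<theta> t (stock \<theta>' t \<omega>))"
proof (cases "t = 1 \<and> t \<in> {1..T}")
  case True
  then have "integrable P (\<lambda>\<omega>. policy_value \<theta> t (stock \<theta> t \<omega>))"
    using Bochner_Integration.integrable_add[OF integrable_trans_cost[OF \<theta>, of t] integrable_action_value[OF \<theta> \<theta>, of t]]
    by (simp add: policy_value_step)
  then show ?thesis using True by (simp add: stock_1)
next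
  case False
  show ?thesis
  proof (cases "t = Suc T")
    case True
    then show ?thesis by (simp add: policy_value_end)
  next
    case not_last: False
    with t False obtain n where "t = Suc n" "n \<in> {1..T}" by (cases t) auto
    then show ?thesis using integrable_policy_value_later[OF \<theta> \<theta>'] by simp
  qed
qed

text \<open>The advantage function: the extra cost of using \<open>\<theta>'\<close> in period
  \<open>t\<close> only and \<open>\<theta>\<close> afterwards.\<close>

definition advantage :: "(nat \<Rightarrow> real \<times> real) \<Rightarrow> (nat \<Rightarrow> real \<times> real) \<Rightarrow> nat \<Rightarrow> real \<Rightarrow> real" where
  "advantage \<theta> \<theta>' t s = trans_cost k q (base_stock (\<theta>' t) s) s
     + action_value \<theta> t (base_stock (\<theta>' t) s) - policy_value \<theta> t s"

lemma period_cost_telescope: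
  assumes \<theta>: "feasible \<theta>" and \<theta>': "feasible \<theta>'" and t: "t \<in> {1..T}"
  shows "P.expectation (\<lambda>\<omega>. trans_cost k q (order \<theta>' t \<omega>) (stock \<theta>' t \<omega>)
        + avg \<nu> (hold_cost (h t) (b t)) (order \<theta>' t \<omega>))
    = P.expectation (\<lambda>\<omega>. policy_value \<theta> t (stock \<theta>' t \<omega>))
      - P.expectation (\<lambda>\<omega>. policy_value \<theta> (Suc t) (stock \<theta>' (Suc t) \<omega>))
      + P.expectation (\<lambda>\<omega>. advantage \<theta> \<theta>' t (stock \<theta>' t \<omega>))"
proof -
  let ?c = "\<lambda>\<omega>. trans_cost k q (order \<theta>' t \<omega>) (stock \<theta>' t \<omega>)"
  let ?L = "\<lambda>\<omega>. avg \<nu> (hold_cost (h t) (b t)) (order \<theta>' t \<omega>)"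
  let ?A = "\<lambda>\<omega>. avg \<nu> (policy_value \<theta> (Suc t)) (order \<theta>' t \<omega>)"
  let ?V = "\<lambda>\<omega>. policy_value \<theta> t (stock \<theta>' t \<omega>)"
  have t': "Suc t \<in> {1..Suc T}" "t \<in> {1..Suc T}" using t by auto
  note next_stock = expectation_next_stock[OF t policy_value_measurable[OF \<theta> t'(1)] integrable_policy_value[OF \<theta> \<theta>' t'(1)]]
  have int: "integrable P ?c" "integrable P ?L" "integrable P ?A" "integrable P ?V"
    using integrable_trans_cost[OF \<theta>' t] integrable_order[OF \<theta>' t hold_lipschitz[OF t]]
      next_stock(2) integrable_policy_value[OF \<theta> \<theta>' t'(2)] by auto
  have "P.expectation (\<lambda>\<omega>. advantage \<theta> \<theta>' t (stock \<theta>' t \<omega>)) = P.expectation (\<lambda>\<omega>. (?c \<omega> + ?L \<omega>) + ?A \<omega> - ?V \<omega>)"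
    by (simp add: advantage_def action_value_def add.assoc)
  also have "\<dots> = P.expectation (\<lambda>\<omega>. ?c \<omega> + ?L \<omega>) + P.expectation ?A - P.expectation ?V"
    using int by simp
  finally show ?thesis using next_stock(1) by simp
qed

lemma objective_eq_sum:
  assumes \<theta>: "feasible \<theta>"
  shows "objective \<theta> = (\<Sum>t = 1..T. P.expectation (\<lambda>\<omega>. trans_cost k q (order \<theta> t \<omega>) (stock \<theta> t \<omega>)
        + avg \<nu> (hold_cost (h t) (b t)) (order \<theta> t \<omega>)))"
  unfolding objective_def
  by (intro Bochner_Integration.integral_sum Bochner_Integration.integrable_add
      integrable_trans_cost[OF \<theta>] integrable_order[OF \<theta> _ hold_lipschitz])

text \<open>Performance difference identity. Along the trajectory of \<open>\<theta>'\<close> each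
  period cost is a decrement of the value of \<open>\<theta>\<close> plus an advantage; the
  decrements telescope to the value at \<open>s1\<close>.\<close>

lemma objective_eq:
  assumes \<theta>: "feasible \<theta>" and \<theta>': "feasible \<theta>'"
  shows "objective \<theta>' = P.expectation (\<lambda>\<omega>. policy_value \<theta> (Suc 0) (s1 \<omega>))
    + (\<Sum>t = 1..T. P.expectation (\<lambda>\<omega>. advantage \<theta> \<theta>' t (stock \<theta>' t \<omega>)))"
proof -
  let ?E = "\<lambda>t. P.expectation (\<lambda>\<omega>. policy_value \<theta> t (stock \<theta>' t \<omega>))"
  have "objective \<theta>' = (\<Sum>t = 1..T. ?E t - ?E (Suc t) + P.expectation (\<lambda>\<omega>. advantage \<theta> \<theta>' t (stock \<theta>' t \<omega>)))"
    unfolding objective_eq_sum[OF \<theta>']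
    by (intro sum.cong refl period_cost_telescope[OF \<theta> \<theta>'])
  also have "\<dots> = (\<Sum>t = 1..T. ?E t - ?E (Suc t))
      + (\<Sum>t = 1..T. P.expectation (\<lambda>\<omega>. advantage \<theta> \<theta>' t (stock \<theta>' t \<omega>)))"
    by (simp add: sum.distrib)
  also have "(\<Sum>t = 1..T. ?E t - ?E (Suc t)) = ?E (Suc 0) - ?E (Suc T)"
  proof -
    have "(\<Sum>t = 1..n. f t - f (Suc t)) = f (Suc 0) - f (Suc n)" for f :: "nat \<Rightarrow> real" and n
      by (induction n) auto
    then show ?thesis .
  qed
  finally show ?thesis by (simp add: policy_value_end stock_1)
qed

lemma advantage_self: "t \<in> {1..T} \<Longrightarrow> advantage \<theta> \<theta> t s = 0"
  by (simp add: advantage_def policy_value_step)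

lemma objective_self:
  "feasible \<theta> \<Longrightarrow> objective \<theta> = P.expectation (\<lambda>\<omega>. policy_value \<theta> (Suc 0) (s1 \<omega>))"
  using objective_eq[of \<theta> \<theta>] by (simp add: advantage_self)

lemma objective_diff:
  assumes "feasible \<theta>" "feasible \<theta>'"
  shows "objective \<theta>' - objective \<theta> = (\<Sum>t = 1..T. P.expectation (\<lambda>\<omega>. advantage \<theta> \<theta>' t (stock \<theta>' t \<omega>)))"
  using objective_eq[OF assms] objective_self[OF assms(1)] by simp

lemma objective_le_gaps:
  assumes \<theta>: "feasible \<theta>"
  shows "objective \<theta> - objective \<theta>s \<le> gaps \<theta> (Suc 0)"
proof -
  have t: "Suc 0 \<in> {1..Suc T}" by simp
  have int: "integrable P (\<lambda>\<omega>. policy_value \<theta> (Suc 0) (s1 \<omega>))" "integrable P (\<lambda>\<omega>. V (Suc 0) (s1 \<omega>))"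
    using integrable_policy_value[OF \<theta> \<theta> t] integrable_policy_value[OF feasible_\<theta>s \<theta> t]
    by (simp_all add: stock_1 policy_value_opt)
  have "objective \<theta> - objective \<theta>s = P.expectation (\<lambda>\<omega>. policy_value \<theta> (Suc 0) (s1 \<omega>) - V (Suc 0) (s1 \<omega>))"
    using int by (simp add: objective_self[OF \<theta>] objective_self[OF feasible_\<theta>s] policy_value_opt)
  also have "\<dots> \<le> gaps \<theta> (Suc 0)"
  proof (rule P.integral_le_const)
    show "integrable P (\<lambda>\<omega>. policy_value \<theta> (Suc 0) (s1 \<omega>) - V (Suc 0) (s1 \<omega>))"
      using int by simp
    show "AE \<omega> in P. policy_value \<theta> (Suc 0) (s1 \<omega>) - V (Suc 0) (s1 \<omega>) \<le> gaps \<theta> (Suc 0)"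
      using policy_value_bounds[OF \<theta> t] by (intro AE_I2) (auto simp: abs_le_iff)
  qed
  finally show ?thesis .
qed

section \<open>Partial derivatives of the objective\<close>

definition grad_lo :: "(nat \<Rightarrow> real \<times> real) \<Rightarrow> nat \<Rightarrow> real" where
  "grad_lo \<theta> t = P.prob {\<omega> \<in> space P. stock \<theta> t \<omega> \<le> fst (\<theta> t)} * (k + deriv (action_value \<theta> t) (fst (\<theta> t)))"

definition grad_hi :: "(nat \<Rightarrow> real \<times> real) \<Rightarrow> nat \<Rightarrow> real" where
  "grad_hi \<theta> t = P.prob {\<omega> \<in> space P. snd (\<theta> t) \<le> stock \<theta> t \<omega>} * (deriv (action_value \<theta> t) (snd (\<theta> t)) - q)"

text \<open>The splitting of \<open>base_stock_cost\<close> with \<open>action_value\<close> in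
  place of \<open>ctg\<close>. It makes the advantage a sum of terms with one threshold each, so the
  two can be differentiated separately.\<close>

lemma advantage_eq:
  assumes \<theta>: "feasible \<theta>" and \<theta>': "feasible \<theta>'" and t: "t \<in> {1..T}"
  shows "advantage \<theta> \<theta>' t s
    = ((k * max s (fst (\<theta>' t)) + action_value \<theta> t (max s (fst (\<theta>' t))))
        - (k * max s (fst (\<theta> t)) + action_value \<theta> t (max s (fst (\<theta> t)))))
      + ((action_value \<theta> t (min s (snd (\<theta>' t))) - q * min s (snd (\<theta>' t)))
        - (action_value \<theta> t (min s (snd (\<theta> t))) - q * min s (snd (\<theta> t))))"
  using base_stock_cost[OF feasibleD(2)[OF \<theta> t], of k q s "action_value \<theta> t"]
    base_stock_cost[OF feasibleD(2)[OF \<theta>' t], of k q s "action_value \<theta> t"]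
  unfolding advantage_def policy_value_step[OF t]
  by linarith

text \<open>Each advantage is evaluated along the trajectory of the perturbed policy, but it vanishes at
  the unperturbed parameters. So to first order only the pointwise convergence of the trajectories
  matters, and these are never differentiated.\<close>

lemma objective_first_order:
  assumes \<theta>: "feasible \<theta>" and X: "\<And>n. feasible (X n)"
    and lim: "\<And>t. t \<in> {1..T} \<Longrightarrow> (\<lambda>n. X n t) \<longlonglongrightarrow> \<theta> t"
    and N: "\<And>n. 0 < N n" "\<And>n t. t \<in> {1..T} \<Longrightarrow> \<bar>fst (X n t) - fst (\<theta> t)\<bar> \<le> N n"
      "\<And>n t. t \<in> {1..T} \<Longrightarrow> \<bar>snd (X n t) - snd (\<theta> t)\<bar> \<le> N n"
  shows "(\<lambda>n. (objective (X n) - objective \<theta> - (\<Sum>t = 1..T. grad_lo \<theta> t * (fst (X n t) - fst (\<theta> t))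
      + grad_hi \<theta> t * (snd (X n t) - snd (\<theta> t)))) / N n) \<longlonglongrightarrow> 0"
proof -
  let ?A = "\<lambda>n t. P.expectation (\<lambda>\<omega>. advantage \<theta> (X n) t (stock (X n) t \<omega>))"
  let ?D = "\<lambda>n t. grad_lo \<theta> t * (fst (X n t) - fst (\<theta> t)) + grad_hi \<theta> t * (snd (X n t) - snd (\<theta> t))"
  have "(\<lambda>n. (?A n t - ?D n t) / N n) \<longlonglongrightarrow> 0" if t: "t \<in> {1..T}" for t
  proof -
    let ?\<Phi> = "\<lambda>y. k * y + action_value \<theta> t y"
    let ?\<Psi> = "\<lambda>y. - q * y + action_value \<theta> t y"
    obtain C where C: "C-lipschitz_on UNIV (action_value \<theta> t)"
      using action_value_lipschitz[OF \<theta> t] by blast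
    have deriv_lo: "(?\<Phi> has_field_derivative k + deriv (action_value \<theta> t) (fst (\<theta> t))) (at (fst (\<theta> t)))"
      and deriv_hi: "(?\<Psi> has_field_derivative - q + deriv (action_value \<theta> t) (snd (\<theta> t))) (at (snd (\<theta> t)))"
      by (auto intro!: derivative_eq_intros action_value_has_derivative[OF \<theta> t])
    have meas: "stock \<theta> t \<in> borel_measurable P" "stock (X n) t \<in> borel_measurable P" for n
      using t by (auto intro: stock_measurable)
    have Sn: "(\<lambda>n. stock (X n) t \<omega>) \<longlonglongrightarrow> stock \<theta> t \<omega>" for \<omega>
      using t by (intro inventory_tendsto lim) auto
    note lo = P.max_shift_expectation[OF lipschitz_on_add_linear[OF C] deriv_lo meas Sn stock_null[OF t]
        tendsto_fst[OF lim[OF t]] N(1) N(2)[OF t]]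
    note hi = P.min_shift_expectation[OF lipschitz_on_add_linear[OF C] deriv_hi meas Sn stock_null[OF t]
        tendsto_snd[OF lim[OF t]] N(1) N(3)[OF t]]
    have "?A n t = P.expectation (\<lambda>\<omega>. ?\<Phi> (max (stock (X n) t \<omega>) (fst (X n t))) - ?\<Phi> (max (stock (X n) t \<omega>) (fst (\<theta> t))))
        + P.expectation (\<lambda>\<omega>. ?\<Psi> (min (stock (X n) t \<omega>) (snd (X n t))) - ?\<Psi> (min (stock (X n) t \<omega>) (snd (\<theta> t))))" for n
      unfolding Bochner_Integration.integral_add[OF lo(2) hi(2), symmetric]
      by (intro Bochner_Integration.integral_cong refl) (simp add: advantage_eq[OF \<theta> X t])
    then have "(?A n t - ?D n t) / N n
      = (P.expectation (\<lambda>\<omega>. ?\<Phi> (max (stock (X n) t \<omega>) (fst (X n t))) - ?\<Phi> (max (stock (X n) t \<omega>) (fst (\<theta> t))))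
          - P.prob {\<omega> \<in> space P. stock \<theta> t \<omega> \<le> fst (\<theta> t)} * (k + deriv (action_value \<theta> t) (fst (\<theta> t))) * (fst (X n t) - fst (\<theta> t))) / N n
        + (P.expectation (\<lambda>\<omega>. ?\<Psi> (min (stock (X n) t \<omega>) (snd (X n t))) - ?\<Psi> (min (stock (X n) t \<omega>) (snd (\<theta> t))))
          - P.prob {\<omega> \<in> space P. snd (\<theta> t) \<le> stock \<theta> t \<omega>} * (- q + deriv (action_value \<theta> t) (snd (\<theta> t))) * (snd (X n t) - snd (\<theta> t))) / N n" for n
      by (simp add: grad_lo_def grad_hi_def flip: add_divide_distrib)
    then show ?thesis using tendsto_add[OF lo(1) hi(1)] by simp
  qed
  then have "(\<lambda>n. \<Sum>t = 1..T. (?A n t - ?D n t) / N n) \<longlonglongrightarrow> (\<Sum>t = 1..T. 0)"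
    by (rule tendsto_sum)
  then show ?thesis
    by (simp add: objective_diff[OF \<theta> X] sum_subtractf flip: sum_divide_distrib)
qed

end

section \<open>The gradient inequality\<close>

lemma le_of_scaled_le:
  fixes a p x c :: real
  assumes "0 < a" "a \<le> p" "p * x \<le> c" "0 \<le> c"
  shows "x \<le> c / a"
proof (cases "x \<le> 0")
  case True
  then show ?thesis using assms by (meson divide_nonneg_pos order_trans)
next
  case False
  then have "a * x \<le> p * x" using assms by (intro mult_right_mono) auto
  then show ?thesis using assms by (simp add: pos_le_divide_eq mult.commute)
qed

text \<open>Expanding the fraction by \<open>K\<^sup>2 * \<alpha> ^ 6\<close> leaves
  \<open>4 * T * K\<^sup>2 * \<alpha> ^ 6\<close> to be bounded: \<open>K \<le> 2 * (L * C)\<close>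
  absorbs the square, \<open>\<alpha> ^ 6 \<le> 1 / 2\<close> the factor 2, and
  \<open>1 \<le> exp 1\<close> the rest.\<close>

lemma small_residual_constant:
  fixes r K \<alpha> L C :: real and T :: nat
  assumes "0 < K" "0 < \<alpha>" "\<alpha> \<le> 1 / 2" "K \<le> 2 * (L * C)" "1 \<le> T"
  shows "T * (4 * r\<^sup>2 / (K * \<alpha>\<^sup>2))
    \<le> r\<^sup>2 * (8 * exp 1 * L\<^sup>2 * C\<^sup>2 * real T ^ 4) / (K ^ 3 * \<alpha> ^ 8)"
proof -
  have "T * (4 * r\<^sup>2 / (K * \<alpha>\<^sup>2)) = r\<^sup>2 * (4 * T * K\<^sup>2 * \<alpha> ^ 6) / (K ^ 3 * \<alpha> ^ 8)"
    using assms by (simp add: field_simps power2_eq_square power3_eq_cube eval_nat_numeral)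
  also have "\<dots> \<le> r\<^sup>2 * (8 * exp 1 * L\<^sup>2 * C\<^sup>2 * real T ^ 4) / (K ^ 3 * \<alpha> ^ 8)"
  proof (intro divide_right_mono mult_left_mono)
    have "K\<^sup>2 \<le> (2 * (L * C))\<^sup>2" using assms by (intro power_mono) auto
    moreover have "\<alpha> ^ 6 \<le> (1 / 2) ^ 6" using assms by (intro power_mono) auto
    then have "\<alpha> ^ 6 \<le> 1 / 2" by (simp add: power_divide)
    moreover have "real T ^ 1 \<le> real T ^ 4" using assms by (intro power_increasing) auto
    ultimately have "real T * (K\<^sup>2 * \<alpha> ^ 6) \<le> real T ^ 4 * ((2 * (L * C))\<^sup>2 * (1 / 2))"
      using assms by (intro mult_mono) auto
    then have 1: "4 * T * K\<^sup>2 * \<alpha> ^ 6 \<le> 1 * (8 * L\<^sup>2 * C\<^sup>2 * real T ^ 4)"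
      by (simp add: power_mult_distrib algebra_simps)
    have "1 * (8 * L\<^sup>2 * C\<^sup>2 * real T ^ 4) \<le> exp 1 * (8 * L\<^sup>2 * C\<^sup>2 * real T ^ 4)"
      by (intro mult_right_mono) auto
    with 1 have "4 * T * K\<^sup>2 * \<alpha> ^ 6 \<le> exp 1 * (8 * L\<^sup>2 * C\<^sup>2 * real T ^ 4)" by linarith
    then show "4 * T * K\<^sup>2 * \<alpha> ^ 6 \<le> 8 * exp 1 * L\<^sup>2 * C\<^sup>2 * real T ^ 4"
      by (simp add: mult_ac)
  qed (use assms in auto)
  finally show ?thesis .
qed

text \<open>Inserting the lower bound for \<open>r\<close> makes the right side at least
  \<open>exp 1 * C\<^sup>2 * T\<^sup>2 / (2 * K * \<alpha> ^ 4)\<close>, so the claim reduces to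
  \<open>8 * \<alpha> ^ 4 \<le> exp 1 * T\<close>.\<close>

lemma large_residual_constant:
  fixes r K \<alpha> L C :: real and T :: nat
  assumes "0 < K" "0 < \<alpha>" "\<alpha> \<le> 1 / 2" "0 < L" "1 \<le> T" and r: "K * \<alpha>\<^sup>2 / (4 * L * T) \<le> r"
  shows "T * (4 * C\<^sup>2 / K) \<le> r\<^sup>2 * (8 * exp 1 * L\<^sup>2 * C\<^sup>2 * real T ^ 4) / (K ^ 3 * \<alpha> ^ 8)"
proof -
  have "\<alpha> ^ 4 \<le> (1 / 2) ^ 4" using assms by (intro power_mono) auto
  then have "8 * \<alpha> ^ 4 \<le> 1 / 2" by (simp add: power_divide)
  also have "\<dots> \<le> exp 1 * T"
  proof -
    have "1 * 1 \<le> exp 1 * real T" using assms by (intro mult_mono) auto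
    then show ?thesis by simp
  qed
  finally have 1: "8 * \<alpha> ^ 4 \<le> exp 1 * T" .
  have "T * (4 * C\<^sup>2 / K) = (8 * \<alpha> ^ 4) * (C\<^sup>2 * T / (2 * K * \<alpha> ^ 4))"
    using assms by (simp add: field_simps)
  also have "\<dots> \<le> (exp 1 * T) * (C\<^sup>2 * T / (2 * K * \<alpha> ^ 4))"
    using 1 assms by (intro mult_right_mono) auto
  also have "\<dots> = (K * \<alpha>\<^sup>2 / (4 * L * T))\<^sup>2 * ((8 * exp 1 * L\<^sup>2 * C\<^sup>2 * real T ^ 4) / (K ^ 3 * \<alpha> ^ 8))"
    using assms by (simp add: field_simps power2_eq_square power3_eq_cube eval_nat_numeral)
  also have "\<dots> \<le> r\<^sup>2 * ((8 * exp 1 * L\<^sup>2 * C\<^sup>2 * real T ^ 4) / (K ^ 3 * \<alpha> ^ 8))"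
    using assms by (intro mult_right_mono power_mono) auto
  finally show ?thesis by simp
qed

context cash_balance_process
begin

text \<open>In the hypothesis \<open>residual\<close>, \<open>r\<close> is the norm of the gradient plus an element of the normal
  cone, tested against the feasible directions that change only period \<open>t\<close>. If the two thresholds
  coincide, they may have to be moved together, which costs the factor \<open>sqrt 2\<close>; since
  \<open>0 \<le> k + q\<close>, the two partial derivatives do not cancel where this matters.\<close>

lemma deriv_ctg_bound:
  assumes \<theta>: "feasible \<theta>" and t: "t \<in> {1..T}" and r: "0 \<le> r"
    and residual: "\<And>u v. Blo \<le> fst (\<theta> t) + u \<Longrightarrow> fst (\<theta> t) + u \<le> snd (\<theta> t) + v \<Longrightarrow> snd (\<theta> t) + v \<le> Bhi \<Longrightarrow>
        - (grad_lo \<theta> t * u + grad_hi \<theta> t * v) \<le> r * sqrt (u\<^sup>2 + v\<^sup>2)"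
  shows "\<bar>k + deriv (ctg t) (fst (\<theta> t))\<bar> \<le> sqrt 2 * r / \<alpha> + L * gaps \<theta> (Suc t)"
    and "\<bar>deriv (ctg t) (snd (\<theta> t)) - q\<bar> \<le> sqrt 2 * r / \<alpha> + L * gaps \<theta> (Suc t)"
proof -
  define a b a' b' where ab: "a = fst (\<theta> t)" "b = snd (\<theta> t)" "a' = fst (\<theta>s t)" "b' = snd (\<theta>s t)"
  define Q where "Q = deriv (action_value \<theta> t)"
  define f where "f = deriv (ctg t)"
  define pl where "pl = P.prob {\<omega> \<in> space P. stock \<theta> t \<omega> \<le> a}"
  define ph where "ph = P.prob {\<omega> \<in> space P. b \<le> stock \<theta> t \<omega>}"
  note mem = feasibleD[OF \<theta> t, folded ab] feasibleD[OF feasible_\<theta>s t, folded ab]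
  have p: "\<alpha> \<le> pl" "\<alpha> \<le> ph"
    unfolding pl_def ph_def using mem by (auto intro!: stock_below stock_above \<theta> t)
  have close: "\<bar>Q y - f y\<bar> \<le> L * gaps \<theta> (Suc t)" for y
    unfolding Q_def f_def by (rule deriv_action_value_close[OF \<theta> t])
  have grad: "grad_lo \<theta> t = pl * (k + Q a)" "grad_hi \<theta> t = ph * (Q b - q)"
    by (simp_all add: grad_lo_def grad_hi_def pl_def ph_def Q_def ab)
  have opt: "f a' = - k" "f b' = q"
    using deriv_ctg_opt[OF t] by (simp_all add: f_def ab)
  have mono: "x \<le> y \<Longrightarrow> f x \<le> f y" for x y
    using deriv_ctg_mono[OF t] by (simp add: f_def)
  have residual: "Blo \<le> a + u \<Longrightarrow> a + u \<le> b + v \<Longrightarrow> b + v \<le> Bhi \<Longrightarrow>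
      - (pl * (k + Q a) * u + ph * (Q b - q) * v) \<le> r * sqrt (u\<^sup>2 + v\<^sup>2)" for u v
    unfolding grad[symmetric] using residual[of u v] by (simp add: ab)
  have sqrt2: "r \<le> sqrt 2 * r" "0 \<le> sqrt 2 * r"
    using r real_sqrt_ge_one[of 2] by (auto simp: mult_le_cancel_right1)
  \<comment> \<open>Three kinds of test moves: the lower threshold alone, the upper one alone, and
    both together.\<close>
  have res_lo: "(pl * - (k + Q a)) * u \<le> r * \<bar>u\<bar>" if "Blo \<le> a + u" "a + u \<le> b" for u
    using residual[of u 0] that mem by (simp add: algebra_simps)
  have res_hi: "(ph * - (Q b - q)) * v \<le> r * \<bar>v\<bar>" if "a \<le> b + v" "b + v \<le> Bhi" for v
    using residual[of 0 v] that mem by (simp add: algebra_simps)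
  have res_diag: "(- (pl * (k + Q a) + ph * (Q b - q))) * u \<le> sqrt 2 * r * \<bar>u\<bar>"
    if "Blo \<le> a + u" "b + u \<le> Bhi" for u
  proof -
    have "u\<^sup>2 + u\<^sup>2 = 2 * u\<^sup>2" by simp
    then have "sqrt (u\<^sup>2 + u\<^sup>2) = sqrt 2 * \<bar>u\<bar>" by (simp only: real_sqrt_mult real_sqrt_abs)
    then have "- (pl * (k + Q a) * u + ph * (Q b - q) * u) \<le> r * (sqrt 2 * \<bar>u\<bar>)"
      using residual[of u u] that mem by simp
    then show ?thesis by (simp add: algebra_simps)
  qed
  have cancel: "x \<le> c" if "x * d \<le> c * \<bar>d\<bar>" "0 < d" for x c d :: real
    using that by simp
  have cancel_neg: "x \<le> c" if "- x * d \<le> c * \<bar>d\<bar>" "d < 0" for x c d :: real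
    using that mult_le_cancel_right_pos[of "- d" x c] by simp
  have div: "x \<le> sqrt 2 * r / \<alpha>" if "p * x \<le> sqrt 2 * r" "\<alpha> \<le> p" for x p
    using le_of_scaled_le[OF \<alpha>_pos that(2,1) sqrt2(2)] .
  have kqQ: "Q y - q \<le> k + Q y" for y using kq by simp

  \<comment> \<open>A positive slope at \<open>a\<close> puts the minimizer \<open>a'\<close>
    strictly below, so moving the threshold to \<open>a'\<close> is feasible and bounds this sign.
    At \<open>a = Blo\<close> no downward move exists, but there the slope cannot be
    positive.\<close>
  have lo_pos: "k + Q a \<le> sqrt 2 * r / \<alpha>" if "0 < k + f a"
  proof (rule div[OF _ p(1)])
    have "a' < a" using that opt mono[of a a'] by (cases "a' < a") auto
    then have "- (pl * (k + Q a)) * (a' - a) \<le> r * \<bar>a' - a\<bar>"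
      using res_lo[of "a' - a"] mem by (simp add: algebra_simps)
    then have "pl * (k + Q a) \<le> r" by (rule cancel_neg) (use \<open>a' < a\<close> in simp)
    then show "pl * (k + Q a) \<le> sqrt 2 * r" using sqrt2 by linarith
  qed
  have lo_neg: "- (k + Q a) \<le> sqrt 2 * r / \<alpha>" if "k + f a < 0"
  proof (rule div[OF _ p(1)])
    have "a < a'" using that opt mono[of a' a] by (cases "a < a'") auto
    show "pl * - (k + Q a) \<le> sqrt 2 * r"
    proof (cases "a < b")
      case True
      have "pl * - (k + Q a) \<le> r"
        by (rule cancel[OF res_lo[of "b - a"]]) (use mem True in simp_all)
      then show ?thesis using sqrt2 by linarith
    next
      case False
      \<comment> \<open>Here the lower threshold can rise only together with the upper one, which
        bounds the sum of both partial derivatives. Where \<open>k + Q a\<close> is nonpositive, so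
        is \<open>Q a - q\<close>, and it cannot compensate the first term.\<close>
      then have "b = a" using mem by simp
      have *: "- (pl * (k + Q a) + ph * (Q a - q)) \<le> sqrt 2 * r"
        by (rule cancel[OF res_diag[of "a' - a", unfolded \<open>b = a\<close>]])
          (use mem \<open>a < a'\<close> in simp_all)
      show ?thesis
      proof (cases "k + Q a \<le> 0")
        case True
        then have "ph * (Q a - q) \<le> 0"
          using kqQ[of a] p \<alpha>_pos by (intro mult_nonneg_nonpos) auto
        then show ?thesis using * by (simp add: algebra_simps)
      next
        case False
        then have "pl * - (k + Q a) \<le> 0"
          using p \<alpha>_pos by (intro mult_nonneg_nonpos) auto
        then show ?thesis using sqrt2 by linarith
      qed
    qed
  qed
  have hi_neg: "- (Q b - q) \<le> sqrt 2 * r / \<alpha>" if "f b - q < 0"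
  proof (rule div[OF _ p(2)])
    have "b < b'" using that opt mono[of b' b] by (cases "b < b'") auto
    have "ph * - (Q b - q) \<le> r"
      by (rule cancel[OF res_hi[of "b' - b"]]) (use mem \<open>b < b'\<close> in simp_all)
    then show "ph * - (Q b - q) \<le> sqrt 2 * r" using sqrt2 by linarith
  qed
  have hi_pos: "Q b - q \<le> sqrt 2 * r / \<alpha>" if "0 < f b - q"
  proof (rule div[OF _ p(2)])
    have "b' < b" using that opt mono[of b b'] by (cases "b' < b") auto
    show "ph * (Q b - q) \<le> sqrt 2 * r"
    proof (cases "a < b")
      case True
      then have "- (ph * (Q b - q)) * (a - b) \<le> r * \<bar>a - b\<bar>"
        using res_hi[of "a - b"] mem by (simp add: algebra_simps)
      then have "ph * (Q b - q) \<le> r" by (rule cancel_neg) (use True in simp)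
      then show ?thesis using sqrt2 by linarith
    next
      case False
      then have "a = b" using mem by simp
      have "- (pl * (k + Q b) + ph * (Q b - q)) * (b' - b) \<le> sqrt 2 * r * \<bar>b' - b\<bar>"
        by (rule res_diag[of "b' - b", unfolded \<open>a = b\<close>]) (use mem \<open>b' < b\<close> in simp_all)
      then have *: "pl * (k + Q b) + ph * (Q b - q) \<le> sqrt 2 * r"
        by (rule cancel_neg) (use \<open>b' < b\<close> in simp)
      show ?thesis
      proof (cases "0 \<le> Q b - q")
        case True
        then have "0 \<le> pl * (k + Q b)"
          using kqQ[of b] p \<alpha>_pos by (intro mult_nonneg_nonneg) auto
        then show ?thesis using * by simp
      next
        case False
        then have "ph * (Q b - q) \<le> 0"
          using p \<alpha>_pos by (intro mult_nonneg_nonpos) auto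
        then show ?thesis using sqrt2 by linarith
      qed
    qed
  qed
  have nn: "0 \<le> sqrt 2 * r / \<alpha>" using sqrt2 \<alpha>_pos by simp
  \<comment> \<open>The sign of \<open>k + f a\<close> selects the move, while the residual bounds
    \<open>k + Q a\<close>; the error of replacing \<open>Q\<close> by \<open>f\<close> is added
    here.\<close>
  have "\<bar>k + f a\<bar> \<le> sqrt 2 * r / \<alpha> + L * gaps \<theta> (Suc t)"
    using lo_pos lo_neg close[of a] nn by (cases "k + f a" "0::real" rule: linorder_cases) (auto simp: abs_le_iff)
  then show "\<bar>k + deriv (ctg t) (fst (\<theta> t))\<bar> \<le> sqrt 2 * r / \<alpha> + L * gaps \<theta> (Suc t)"
    by (simp add: f_def ab)
  have "\<bar>f b - q\<bar> \<le> sqrt 2 * r / \<alpha> + L * gaps \<theta> (Suc t)"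
    using hi_pos hi_neg close[of b] nn by (cases "f b - q" "0::real" rule: linorder_cases) (auto simp: abs_le_iff)
  then show "\<bar>deriv (ctg t) (snd (\<theta> t)) - q\<bar> \<le> sqrt 2 * r / \<alpha> + L * gaps \<theta> (Suc t)"
    by (simp add: f_def ab)
qed

lemma gaps_small_residual:
  assumes \<theta>: "feasible \<theta>" and r: "0 \<le> r" and T: "1 \<le> T" and lt: "Blo < Bhi"
    and K: "0 < K" "\<And>t. t \<in> {1..T} \<Longrightarrow> K \<le> (h t + b t) * \<mu>"
    and small: "4 * L * T * r \<le> K * \<alpha>\<^sup>2" and \<alpha>: "\<alpha> \<le> 1 / 2"
    and residual: "\<And>t u v. t \<in> {1..T} \<Longrightarrow> Blo \<le> fst (\<theta> t) + u \<Longrightarrow> fst (\<theta> t) + u \<le> snd (\<theta> t) + v \<Longrightarrow>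
        snd (\<theta> t) + v \<le> Bhi \<Longrightarrow> - (grad_lo \<theta> t * u + grad_hi \<theta> t * v) \<le> r * sqrt (u\<^sup>2 + v\<^sup>2)"
    and t: "t \<in> {1..Suc T}"
  shows "gaps \<theta> t \<le> real (Suc T - t) * (4 * r\<^sup>2 / (K * \<alpha>\<^sup>2))"
proof -
  have L: "0 \<le> L" using cdf_lipschitz by (rule lipschitz_on_nonneg)
  \<comment> \<open>Twice \<open>(2 * r / \<alpha>)\<^sup>2 / (2 * K)\<close>, the bound for each of
    the two gaps of a period.\<close>
  define B where "B = 4 * r\<^sup>2 / (K * \<alpha>\<^sup>2)"
  have B: "0 \<le> B" using K by (simp add: B_def)
  have "t \<le> Suc T" using t by simp
  then have "gaps \<theta> t \<le> real (Suc T - t) * B"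
  proof (induction rule: inc_induct)
    case base
    then show ?case by (simp add: gaps_def)
  next
    case (step n)
    then have n: "n \<in> {1..T}" using t by auto
    have "real (Suc T - Suc n) * B \<le> T * B" using B by (intro mult_right_mono) auto
    then have "L * gaps \<theta> (Suc n) \<le> L * (T * B)"
      using step.IH L by (intro mult_left_mono) auto
    \<comment> \<open>This is where the smallness condition comes from: it makes
      \<open>L * T * B\<close> at most \<open>r\<close>.\<close>
    also have "\<dots> = (4 * L * T * r) * (r / (K * \<alpha>\<^sup>2))"
      by (simp add: B_def power2_eq_square)
    also have "\<dots> \<le> (K * \<alpha>\<^sup>2) * (r / (K * \<alpha>\<^sup>2))"
      using small r K by (intro mult_right_mono) auto
    also have "\<dots> = r" using K \<alpha>_pos by simp
    also have "r \<le> (1 / 2) * r / \<alpha>"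
      using mult_left_mono[of "2 * \<alpha>" 1 r] \<alpha> \<alpha>_pos r by (simp add: pos_le_divide_eq mult.commute)
    finally have eps: "L * gaps \<theta> (Suc n) \<le> (1 / 2) * r / \<alpha>" .
    \<comment> \<open>The share \<open>1 / 2\<close> of the error, due to
      \<open>\<alpha> \<le> 1 / 2\<close>, and \<open>3 / 2\<close> add up to the factor 2 in
      \<open>2 * r / \<alpha>\<close>.\<close>
    have "sqrt 2 \<le> 3 / 2" by (rule real_le_lsqrt) (auto simp: power2_eq_square)
    then have "sqrt 2 * r / \<alpha> \<le> (3 / 2) * r / \<alpha>"
      using r \<alpha>_pos by (intro divide_right_mono mult_right_mono) auto
    with eps have sum: "sqrt 2 * r / \<alpha> + L * gaps \<theta> (Suc n) \<le> 2 * r / \<alpha>"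
      by (simp add: field_simps)
    have sq: "x\<^sup>2 / (2 * ((h n + b n) * \<mu>)) \<le> B / 2" if "\<bar>x\<bar> \<le> sqrt 2 * r / \<alpha> + L * gaps \<theta> (Suc n)" for x
    proof -
      have "\<bar>x\<bar> \<le> 2 * r / \<alpha>" using that sum by linarith
      then have "x\<^sup>2 \<le> (2 * r / \<alpha>)\<^sup>2" by (metis abs_ge_zero power2_abs power_mono)
      then have "x\<^sup>2 / (2 * ((h n + b n) * \<mu>)) \<le> (2 * r / \<alpha>)\<^sup>2 / (2 * K)"
        using K(1) K(2)[OF n] by (intro frac_le) auto
      also have "\<dots> = B / 2"
        by (simp add: B_def power_divide power_mult_distrib)
      finally show ?thesis .
    qed
    have "gap_lo \<theta> n \<le> B / 2" "gap_hi \<theta> n \<le> B / 2"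
      using gap_le_square_derivative[OF \<theta> n] sq[OF deriv_ctg_bound(1)[OF \<theta> n r residual[OF n]]]
        sq[OF deriv_ctg_bound(2)[OF \<theta> n r residual[OF n]]] by linarith+
    moreover have "real (Suc T - n) * B = B + real (Suc T - Suc n) * B"
      using n by (simp add: of_nat_diff algebra_simps)
    ultimately show ?case
      using step.IH gaps_Suc[OF n, of \<theta>] by linarith
  qed
  then show ?thesis by (simp add: B_def)
qed

text \<open>The derivative of \<open>ctg t\<close> is known at the optimal thresholds and its range
  has length at most \<open>2 * C\<close>, so every \<open>\<xi>\<close> is at most
  \<open>2 * C\<close> in absolute value.\<close>

lemma gaps_bound:
  assumes \<theta>: "feasible \<theta>" and C: "0 \<le> C" "\<And>t. t \<in> {1..T} \<Longrightarrow> (h t + b t) + (k + q) \<le> 2 * C"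
    and K: "0 < K" "\<And>t. t \<in> {1..T} \<Longrightarrow> K \<le> (h t + b t) * \<mu>"
  shows "gaps \<theta> (Suc 0) \<le> T * (4 * C\<^sup>2 / K)"
proof -
  have "gap_lo \<theta> t + gap_hi \<theta> t \<le> 4 * C\<^sup>2 / K" if t: "t \<in> {1..T}" for t
  proof -
    have sq: "x\<^sup>2 / (2 * ((h t + b t) * \<mu>)) \<le> 2 * C\<^sup>2 / K" if "\<bar>x\<bar> \<le> 2 * C" for x
    proof -
      have "x\<^sup>2 \<le> (2 * C)\<^sup>2" using that by (metis abs_ge_zero power2_abs power_mono)
      then have "x\<^sup>2 / (2 * ((h t + b t) * \<mu>)) \<le> (2 * C)\<^sup>2 / (2 * K)"
        using K(1) K(2)[OF t] by (intro frac_le) auto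
      then show ?thesis by (simp add: power_mult_distrib)
    qed
    have "\<bar>k + deriv (ctg t) (fst (\<theta> t))\<bar> \<le> 2 * C" "\<bar>deriv (ctg t) (snd (\<theta> t)) - q\<bar> \<le> 2 * C"
      using deriv_ctg_range[OF t, of "fst (\<theta> t)" "fst (\<theta>s t)"] deriv_ctg_range[OF t, of "fst (\<theta>s t)" "fst (\<theta> t)"]
        deriv_ctg_range[OF t, of "snd (\<theta> t)" "snd (\<theta>s t)"] deriv_ctg_range[OF t, of "snd (\<theta>s t)" "snd (\<theta> t)"]
        deriv_ctg_opt[OF t] C(2)[OF t] by (auto simp: abs_le_iff)
    from sq[OF this(1)] sq[OF this(2)] gap_le_square_derivative[OF \<theta> t] show ?thesis
      by (simp add: field_simps)
  qed
  then have "gaps \<theta> (Suc 0) \<le> (\<Sum>t=1..T. 4 * C\<^sup>2 / K)"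
    unfolding gaps_def One_nat_def by (rule sum_mono)
  then show ?thesis by simp
qed

lemma \<alpha>_le_half:
  assumes "Blo < Bhi"
  shows "\<alpha> \<le> 1 / 2"
proof -
  have "P.prob {\<omega> \<in> space P. s1 \<omega> \<le> Blo} + P.prob {\<omega> \<in> space P. Bhi \<le> s1 \<omega>}
      = P.prob ({\<omega> \<in> space P. s1 \<omega> \<le> Blo} \<union> {\<omega> \<in> space P. Bhi \<le> s1 \<omega>})"
    using assms by (intro P.finite_measure_Union[symmetric]) auto
  also have "\<dots> \<le> 1" by simp
  finally show ?thesis using s1_lower s1_upper by linarith
qed

lemma \<mu>_le_L:
  assumes "Blo < Bhi"
  shows "\<mu> \<le> L"
proof -
  have "\<mu> * (Bhi - Blo) \<le> cdf \<nu> Bhi - cdf \<nu> Blo"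
    using cdf_lower[of Blo Bhi] assms by simp
  also have "\<dots> \<le> L * (Bhi - Blo)"
    using lipschitz_on_real_bound[OF cdf_lipschitz, of Bhi Blo] assms by simp
  finally show ?thesis using assms by simp
qed

theorem objective_gap_le_residual:
  assumes \<theta>: "feasible \<theta>" and r: "0 \<le> r" and T: "1 \<le> T"
    and m: "0 < m" "\<And>t. t \<in> {1..T} \<Longrightarrow> m \<le> h t + b t"
    and C: "\<And>t. t \<in> {1..T} \<Longrightarrow> (h t + b t) + (k + q) \<le> 2 * C"
    and residual: "\<And>t u v. t \<in> {1..T} \<Longrightarrow> Blo \<le> fst (\<theta> t) + u \<Longrightarrow> fst (\<theta> t) + u \<le> snd (\<theta> t) + v \<Longrightarrow>
        snd (\<theta> t) + v \<le> Bhi \<Longrightarrow> - (grad_lo \<theta> t * u + grad_hi \<theta> t * v) \<le> r * sqrt (u\<^sup>2 + v\<^sup>2)"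
  shows "objective \<theta> - objective \<theta>s
    \<le> 1 / (2 * (m ^ 3 * \<mu> ^ 3 * \<alpha> ^ 8 / (16 * exp 1 * L\<^sup>2 * C\<^sup>2 * real T ^ 4))) * r\<^sup>2"
proof -
  define K where "K = m * \<mu>"
  have K: "0 < K" "\<And>t. t \<in> {1..T} \<Longrightarrow> K \<le> (h t + b t) * \<mu>"
    using m \<mu>_pos by (auto simp: K_def)
  have "m \<le> 2 * C" using C[of 1] m(2)[of 1] kq T by force
  then have C_pos: "0 < C" using m by simp
  have const: "1 / (2 * (m ^ 3 * \<mu> ^ 3 * \<alpha> ^ 8 / (16 * exp 1 * L\<^sup>2 * C\<^sup>2 * real T ^ 4))) * r\<^sup>2
      = r\<^sup>2 * (8 * exp 1 * L\<^sup>2 * C\<^sup>2 * real T ^ 4) / (K ^ 3 * \<alpha> ^ 8)"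
    by (simp add: K_def power_mult_distrib mult_ac)
  show ?thesis
  proof (cases "Blo < Bhi")
    case True
    have \<mu>: "\<mu> \<le> L" and \<alpha>: "\<alpha> \<le> 1 / 2" using \<mu>_le_L \<alpha>_le_half True by auto
    then have L: "0 < L" using \<mu>_pos by simp
    have "gaps \<theta> (Suc 0) \<le> r\<^sup>2 * (8 * exp 1 * L\<^sup>2 * C\<^sup>2 * real T ^ 4) / (K ^ 3 * \<alpha> ^ 8)"
    proof (cases "4 * L * T * r \<le> K * \<alpha>\<^sup>2")
      case small: True
      have "K \<le> 2 * C * L"
        unfolding K_def using \<open>m \<le> 2 * C\<close> \<mu> m \<mu>_pos by (intro mult_mono) auto
      then have "K \<le> 2 * (L * C)" by (simp add: mult_ac)
      from small_residual_constant[OF K(1) \<alpha>_pos \<alpha> this T, of r]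
      show ?thesis
        using gaps_small_residual[OF \<theta> r T True K small \<alpha> residual, of "Suc 0"] by simp
    next
      case False
      then have "K * \<alpha>\<^sup>2 / (4 * L * T) \<le> r"
        using L T by (simp add: pos_divide_le_eq mult_ac)
      from large_residual_constant[OF K(1) \<alpha>_pos \<alpha> L T this, of C]
      show ?thesis
        using gaps_bound[OF \<theta> less_imp_le[OF C_pos] C K] by linarith
    qed
    then show ?thesis unfolding const using objective_le_gaps[OF \<theta>] by linarith
  next
    \<comment> \<open>The bounds on \<open>\<alpha>\<close> and \<open>L\<close> rest on
      \<open>Blo < Bhi\<close>. Otherwise feasibility forces \<open>\<theta>\<close> and
      \<open>\<theta>s\<close> to agree in every period.\<close>
    case False
    have "gap_lo \<theta> t = 0 \<and> gap_hi \<theta> t = 0" if t: "t \<in> {1..T}" for t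
    proof -
      have "fst (\<theta> t) = fst (\<theta>s t)" "snd (\<theta> t) = snd (\<theta>s t)"
        using feasibleD[OF \<theta> t] feasibleD[OF feasible_\<theta>s t] False by auto
      then show ?thesis by (simp add: gap_lo_def gap_hi_def)
    qed
    then have "gaps \<theta> (Suc 0) = 0"
      unfolding gaps_def by (intro sum.neutral) auto
    moreover have "0 \<le> r\<^sup>2 * (8 * exp 1 * L\<^sup>2 * C\<^sup>2 * real T ^ 4) / (K ^ 3 * \<alpha> ^ 8)"
      using K by simp
    ultimately show ?thesis unfolding const using objective_le_gaps[OF \<theta>] by linarith
  qed
qed

end

section \<open>Gradients relative to a convex set\<close>

text \<open>If \<open>S\<close> has empty interior, a relative gradient need not be unique. Along a
  segment inside \<open>S\<close>, however, it gives the one-sided derivative of a function of one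
  variable, so an arbitrary gradient can be replaced by the computed one.\<close>

lemma has_gradient_within_directional_unique:
  assumes G: "has_gradient_within f G x S" and G': "has_gradient_within f G' x S"
    and d: "\<And>s. 0 \<le> s \<Longrightarrow> s \<le> 1 \<Longrightarrow> x + s *\<^sub>R d \<in> S"
  shows "inner G d = inner G' d"
proof -
  have "((\<lambda>s. f (x + s *\<^sub>R d)) has_vector_derivative inner G d) (at 0 within {0..1})"
    if "has_gradient_within f G x S" for G
  proof -
    have "(f has_derivative (\<lambda>v. inner G v)) (at (x + 0 *\<^sub>R d) within (\<lambda>s. x + s *\<^sub>R d) ` {0..1})"
      using that d unfolding has_gradient_within_def by (auto intro: has_derivative_subset)
    moreover have "((\<lambda>s. x + s *\<^sub>R d) has_derivative (\<lambda>s. s *\<^sub>R d)) (at 0 within {0..1})"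
      by (auto intro!: derivative_eq_intros)
    ultimately have "((\<lambda>s. f (x + s *\<^sub>R d)) has_derivative (\<lambda>s. inner G (s *\<^sub>R d))) (at 0 within {0..1})"
      by (rule has_derivative_in_compose[rotated])
    then show ?thesis by (simp add: has_vector_derivative_def)
  qed
  from vector_derivative_unique_within[OF _ this[OF G] this[OF G']] show ?thesis
    by (simp add: at_within_Icc_at_right)
qed

text \<open>The normal vector \<open>g\<close> has nonpositive inner product with the feasible
  direction \<open>d\<close>, so dropping it only helps, and Cauchy-Schwarz bounds the rest.\<close>

lemma residual_lower_bound:
  assumes G: "has_gradient_within f G x S" and G': "has_gradient_within f G' x S"
    and g: "g \<in> normal_cone S x" and S: "convex S" "x \<in> S" "x + d \<in> S"
  shows "- inner G' d \<le> norm (G + g) * norm d"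
proof -
  have "x + s *\<^sub>R d \<in> S" if "0 \<le> s" "s \<le> 1" for s
  proof -
    have "x + s *\<^sub>R d = (1 - s) *\<^sub>R x + s *\<^sub>R (x + d)" by (simp add: algebra_simps)
    then show ?thesis using convexD[OF S, of "1 - s" s] that by simp
  qed
  from has_gradient_within_directional_unique[OF G G' this] have "inner G d = inner G' d" .
  moreover have "inner g d \<le> 0"
    using g S(3) by (auto simp: normal_cone_def)
  moreover have "- inner (G + g) d \<le> norm (G + g) * norm d"
    using norm_cauchy_schwarz[of "- (G + g)" d] by (simp only: inner_minus_left norm_minus_cancel)
  ultimately show ?thesis by (simp add: inner_add_left)
qed

lemma convex_policy_params: "convex (policy_params Blo Bhi :: ((real \<times> real) ^ 'n) set)"
proof (rule convexI)
  fix x y :: "(real \<times> real) ^ 'n" and u v :: real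
  assume xy: "x \<in> policy_params Blo Bhi" "y \<in> policy_params Blo Bhi" and uv: "0 \<le> u" "0 \<le> v" "u + v = 1"
  have "Blo \<le> u * fst (x $ i) + v * fst (y $ i)"
    "u * fst (x $ i) + v * fst (y $ i) \<le> u * snd (x $ i) + v * snd (y $ i)"
    "u * snd (x $ i) + v * snd (y $ i) \<le> Bhi" for i
  proof -
    have x: "Blo \<le> fst (x $ i)" "fst (x $ i) \<le> snd (x $ i)" "snd (x $ i) \<le> Bhi"
      and y: "Blo \<le> fst (y $ i)" "fst (y $ i) \<le> snd (y $ i)" "snd (y $ i) \<le> Bhi"
      using xy by (auto simp: policy_params_def)
    have "u * Blo + v * Blo = Blo" "u * Bhi + v * Bhi = Bhi"
      using uv(3) by (simp_all flip: distrib_right)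
    moreover have "u * Blo \<le> u * fst (x $ i)" "v * Blo \<le> v * fst (y $ i)"
      "u * snd (x $ i) \<le> u * Bhi" "v * snd (y $ i) \<le> v * Bhi"
      using x y uv by (auto intro: mult_left_mono)
    moreover show "u * fst (x $ i) + v * fst (y $ i) \<le> u * snd (x $ i) + v * snd (y $ i)"
      using x y uv by (intro add_mono mult_left_mono)
    ultimately show "Blo \<le> u * fst (x $ i) + v * fst (y $ i)"
      "u * snd (x $ i) + v * snd (y $ i) \<le> Bhi" by linarith+
  qed
  then show "u *\<^sub>R x + v *\<^sub>R y \<in> policy_params Blo Bhi"
    by (simp add: policy_params_def)
qed

lemma PLK_conditionI:
  assumes "\<And>x. x \<in> S \<Longrightarrow> \<exists>G. has_gradient_within f G x S"
    and "\<And>x G g. x \<in> S \<Longrightarrow> has_gradient_within f G x S \<Longrightarrow> g \<in> normal_cone S x \<Longrightarrow>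
      f x - f xopt \<le> 1 / (2 * \<mu>) * (norm (G + g))\<^sup>2"
    and \<mu>: "0 \<le> \<mu>"
  shows "PLK_condition f S xopt \<mu>"
  unfolding PLK_condition_def
proof (intro ballI conjI allI impI)
  fix x G assume x: "x \<in> S" and G: "has_gradient_within f G x S"
  have cone: "0 \<in> normal_cone S x" by (simp add: normal_cone_def)
  show "f x - f xopt \<le> 1 / (2 * \<mu>) * (INF g\<in>normal_cone S x. (norm (G + g))\<^sup>2)"
  proof (cases "\<mu> = 0")
    \<comment> \<open>Division by zero yields 0, so the claim is that \<open>f x\<close> does not
      exceed \<open>f xopt\<close>; the hypothesis with normal vector 0 gives it.\<close>
    case True
    then show ?thesis using assms(2)[OF x G cone] by simp
  next
    case False
    then have "0 < \<mu>" using \<mu> by simp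
    have "2 * \<mu> * (f x - f xopt) \<le> (INF g\<in>normal_cone S x. (norm (G + g))\<^sup>2)"
    proof (rule cINF_greatest)
      fix g assume "g \<in> normal_cone S x"
      from assms(2)[OF x G this] show "2 * \<mu> * (f x - f xopt) \<le> (norm (G + g))\<^sup>2"
        using \<open>0 < \<mu>\<close> by (simp add: field_simps)
    qed (use cone in auto)
    then show ?thesis using \<open>0 < \<mu>\<close> by (simp add: field_simps)
  qed
qed (use assms(1) in auto)

section \<open>Reduction to the law of the demand\<close>

lemma inventory_cong:
  "(\<And>i. 1 \<le> i \<Longrightarrow> i < t \<Longrightarrow> \<theta> i = \<theta>' i) \<Longrightarrow> inventory s1 D \<theta> t \<omega> = inventory s1 D \<theta>' t \<omega>"
  by (induction t) auto

lemma total_cost_cong: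
  assumes "\<And>t. t \<in> {1..T} \<Longrightarrow> \<theta> t = \<theta>' t"
  shows "total_cost M T s1 D k q h b \<theta> = total_cost M T s1 D k q h b \<theta>'"
proof
  fix \<omega>
  have "inventory s1 D \<theta> t \<omega> = inventory s1 D \<theta>' t \<omega>" if "t \<in> {1..T}" for t
    using assms that by (intro inventory_cong) auto
  then show "total_cost M T s1 D k q h b \<theta> \<omega> = total_cost M T s1 D k q h b \<theta>' \<omega>"
    using assms unfolding total_cost_def Let_def by (intro sum.cong) auto
qed

lemma opt_value_step:
  "t \<le> T \<Longrightarrow> opt_value M T D k q h b t s = (INF y. trans_cost k q y s + cost_to_go M T D k q h b t y)"
  by (simp add: opt_value.simps[of M T D k q h b t] cost_to_go_def)

lemma opt_value_end: "T < t \<Longrightarrow> opt_value M T D k q h b t = (\<lambda>_. 0)"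
  by (rule ext) (simp add: opt_value.simps)

text \<open>The Lipschitz argument for \<open>V\<close> has to be available before the locale is
  interpreted, since transferring integrals to the law of the demand already needs
  measurability.\<close>

lemma opt_value_measurable:
  assumes kq: "0 \<le> k + q" and bdd: "t \<le> T \<Longrightarrow> bdd_below (range (\<lambda>y. k * y + cost_to_go M T D k q h b t y))"
  shows "opt_value M T D k q h b t \<in> borel_measurable borel"
proof (cases "t \<le> T")
  case True
  have "(max \<bar>k\<bar> \<bar>q\<bar>)-lipschitz_on UNIV (opt_value M T D k q h b t)"
  proof (rule lipschitz_on_realI)
    fix x y
    show "\<bar>opt_value M T D k q h b t x - opt_value M T D k q h b t y\<bar> \<le> max \<bar>k\<bar> \<bar>q\<bar> * \<bar>x - y\<bar>"
      unfolding opt_value_step[OF True]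
      using INF_trans_cost_le[OF kq bdd[OF True], of x y] INF_trans_cost_le[OF kq bdd[OF True], of y x]
        trans_cost_le_dist[of k q x y] trans_cost_le_dist[of k q y x]
      by (simp add: abs_le_iff abs_minus_commute)
  qed auto
  then show ?thesis by (rule lipschitz_on_borel_measurable)
qed (simp add: opt_value_end)

lemma (in prob_space) cash_balance_processI:
  fixes s1 :: "'a \<Rightarrow> real" and D :: "nat \<Rightarrow> 'a \<Rightarrow> real" and \<theta>s :: "nat \<Rightarrow> real \<times> real"
  defines "\<nu> \<equiv> distr M borel (D 1)"
  assumes T: "1 \<le> T"
    and kq: "0 \<le> k + q"
    and hb: "\<And>t. t \<in> {1..T} \<Longrightarrow> 0 \<le> h t \<and> 0 \<le> b t \<and> 0 < h t + b t"
    and indep: "indep_vars (\<lambda>_. borel) (\<lambda>i. if i = 0 then s1 else D i) {0..T}"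
    and cdf_s1: "cdf (distr M borel s1) = \<rho>"
    and cdf_D: "\<And>t. t \<in> {1..T} \<Longrightarrow> cdf (distr M borel (D t)) = F_D"
    and lipschitz_\<rho>: "L_\<rho>-lipschitz_on UNIV \<rho>"
    and lipschitz_D: "L_D-lipschitz_on UNIV F_D"
    and \<alpha>_pos: "0 < \<alpha>"
    and \<rho>_lower: "\<alpha> \<le> \<rho> Blo"
    and \<rho>_upper: "\<rho> Bhi \<le> 1 - \<alpha>"
    and D_upper_tail: "\<And>t. t \<in> {1..T} \<Longrightarrow> \<alpha> \<le> measure M {\<omega> \<in> space M. Bhi - Blo \<le> D t \<omega>}"
    and D_lower_tail: "\<And>t. t \<in> {1..T} \<Longrightarrow> \<alpha> \<le> measure M {\<omega> \<in> space M. D t \<omega> \<le> Blo - Bhi}"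
    and density: "\<And>t. t \<in> {1..T} \<Longrightarrow> distributed M lborel (D t) (\<lambda>x. ennreal (p x))"
    and \<mu>_D_pos: "0 < \<mu>_D"
    and density_lower: "\<And>x. x \<in> {Blo..Bhi} \<Longrightarrow> \<mu>_D \<le> p x"
    and finite_hold_cost: "\<And>t y. t \<in> {1..T} \<Longrightarrow>
          integrable M (\<lambda>\<omega>. hold_cost (h t) (b t) (y - D t \<omega>))"
    and finite_opt_value: "\<And>t y. t \<in> {1..T} \<Longrightarrow>
          integrable M (\<lambda>\<omega>. opt_value M T D k q h b (Suc t) (y - D t \<omega>))"
    and finite_objective: "\<And>\<theta>. (\<And>t. t \<in> {1..T} \<Longrightarrow> Blo \<le> fst (\<theta> t) \<and> fst (\<theta> t) \<le> snd (\<theta> t) \<and> snd (\<theta> t) \<le> Bhi) \<Longrightarrow>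
          integrable M (total_cost M T s1 D k q h b \<theta>)"
    and opt_feasible: "\<And>t. t \<in> {1..T} \<Longrightarrow> Blo \<le> fst (\<theta>s t) \<and> fst (\<theta>s t) \<le> snd (\<theta>s t) \<and> snd (\<theta>s t) \<le> Bhi"
    and opt_lower: "\<And>t y. t \<in> {1..T} \<Longrightarrow>
          k * fst (\<theta>s t) + cost_to_go M T D k q h b t (fst (\<theta>s t)) \<le> k * y + cost_to_go M T D k q h b t y"
    and opt_upper: "\<And>t y. t \<in> {1..T} \<Longrightarrow>
          - q * snd (\<theta>s t) + cost_to_go M T D k q h b t (snd (\<theta>s t)) \<le> - q * y + cost_to_go M T D k q h b t y"
  shows "cash_balance_process \<nu> L_D \<mu>_D k q Blo Bhi T h b (opt_value M T D k q h b) \<theta>s M s1 D \<alpha>"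
    and "\<And>t. t \<in> {1..T} \<Longrightarrow> exp_hold_cost M D h b t = avg \<nu> (hold_cost (h t) (b t))"
proof -
  have one: "1 \<in> {1..T}" using T by simp
  have s1_meas [measurable]: "s1 \<in> borel_measurable M"
    using indep unfolding indep_vars_def2 by force
  have D_meas: "D t \<in> borel_measurable M" if "t \<in> {1..T}" for t
    using indep that unfolding indep_vars_def2 by force
  have D_density: "distr M borel (D t) = density lborel (\<lambda>x. ennreal (p x))" if "t \<in> {1..T}" for t
    using distributed_distr_eq_density[OF density[OF that]] by (simp cong: distr_cong)
  \<comment> \<open>All demands have the same density \<open>p\<close>, hence the same law.\<close>
  have D_distr: "distr M borel (D t) = \<nu>" if "t \<in> {1..T}" for t
    using D_density[OF that] D_density[OF one] by (simp add: \<nu>_def)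
  interpret \<nu>: real_distribution \<nu>
    unfolding \<nu>_def by (rule real_distribution_distr[OF D_meas[OF one]])
  interpret s1: real_distribution "distr M borel s1"
    by (rule real_distribution_distr) measurable
  have cdf: "cdf \<nu> = F_D" using cdf_D[OF one] by (simp add: \<nu>_def)
  have V_meas: "opt_value M T D k q h b (Suc t) \<in> borel_measurable borel" for t
  proof (rule opt_value_measurable[OF kq])
    assume "Suc t \<le> T"
    then show "bdd_below (range (\<lambda>y. k * y + cost_to_go M T D k q h b (Suc t) y))"
      using opt_lower[of "Suc t"] by (auto simp: bdd_below_def)
  qed
  have hold_meas: "hold_cost c d \<in> borel_measurable borel" for c d
    unfolding hold_cost_def by measurable
  have avg: "(\<integral>\<omega>. \<phi> (y - D t \<omega>) \<partial>M) = avg \<nu> \<phi> y" "integrable M (\<lambda>\<omega>. \<phi> (y - D t \<omega>)) \<longleftrightarrow> integrable \<nu> (\<lambda>x. \<phi> (y - x))"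
    if t: "t \<in> {1..T}" and [measurable]: "\<phi> \<in> borel_measurable borel" for \<phi> :: "real \<Rightarrow> real" and y t
  proof -
    note [measurable] = D_meas[OF t]
    show "(\<integral>\<omega>. \<phi> (y - D t \<omega>) \<partial>M) = avg \<nu> \<phi> y"
      unfolding avg_def D_distr[OF t, symmetric] by (subst integral_distr) auto
    show "integrable M (\<lambda>\<omega>. \<phi> (y - D t \<omega>)) \<longleftrightarrow> integrable \<nu> (\<lambda>x. \<phi> (y - x))"
      unfolding D_distr[OF t, symmetric] by (subst integrable_distr_eq) auto
  qed
  show hold: "exp_hold_cost M D h b t = avg \<nu> (hold_cost (h t) (b t))" if "t \<in> {1..T}" for t
    using avg(1)[OF that hold_meas] by (auto simp: exp_hold_cost_def)
  have ctg: "cost_to_go M T D k q h b t y = avg \<nu> (hold_cost (h t) (b t)) y + avg \<nu> (opt_value M T D k q h b (Suc t)) y"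
    if "t \<in> {1..T}" for t y
    using hold[OF that] avg(1)[OF that V_meas] by (simp add: cost_to_go_def)
  have cdf_lower: "\<mu>_D * (y - x) \<le> cdf \<nu> y - cdf \<nu> x" if "Blo \<le> x" "x \<le> y" "y \<le> Bhi" for x y
  proof (cases "x = y")
    case False
    then have "x < y" using that by simp
    have [measurable]: "(\<lambda>x. ennreal (p x)) \<in> borel_measurable lborel"
      using density[OF one] by (rule distributed_borel_measurable)
    \<comment> \<open>Integrating the density bound over \<open>{x<..y}\<close> gives the growth of
      the distribution function.\<close>
    have "ennreal (\<mu>_D * (y - x)) = (\<integral>\<^sup>+z. ennreal \<mu>_D * indicator {x<..y} z \<partial>lborel)"
      using \<mu>_D_pos \<open>x < y\<close> by (simp add: nn_integral_cmult_indicator ennreal_mult)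
    also have "\<dots> \<le> (\<integral>\<^sup>+z. ennreal (p z) * indicator {x<..y} z \<partial>lborel)"
      using density_lower that by (intro nn_integral_mono) (auto simp: indicator_def intro!: ennreal_leI)
    also have "\<dots> = emeasure \<nu> {x<..y}"
      unfolding D_distr[OF one, symmetric] D_density[OF one] by (simp add: emeasure_density)
    also have "\<dots> = ennreal (cdf \<nu> y - cdf \<nu> x)"
      using \<nu>.cdf_diff_eq[OF \<open>x < y\<close>] by (simp add: \<nu>.emeasure_eq_measure)
    finally show ?thesis
      using \<nu>.cdf_nondecreasing[of x y] \<open>x < y\<close> by (simp add: ennreal_le_iff)
  qed simp
  have "continuous_on UNIV \<rho>" using lipschitz_\<rho> by (rule lipschitz_on_continuous_on)
  then have "isCont (cdf (distr M borel s1)) x" for x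
    by (simp add: cdf_s1 continuous_on_eq_continuous_at)
  then have "measure (distr M borel s1) {x} = 0" for x by (simp add: s1.isCont_cdf)
  then have s1_null: "measure M {\<omega> \<in> space M. s1 \<omega> = x} = 0" for x
    by (simp add: measure_distr vimage_def Int_def conj_commute)
  have \<rho>: "\<rho> x = measure M {\<omega> \<in> space M. s1 \<omega> \<le> x}" for x
    unfolding cdf_s1[symmetric] cdf_def by (simp add: measure_distr vimage_def Int_def conj_commute)
  have "prob {\<omega> \<in> space M. \<not> s1 \<omega> \<le> Bhi} = 1 - \<rho> Bhi"
    unfolding \<rho> by (rule prob_neg) measurable
  moreover have "prob {\<omega> \<in> space M. \<not> s1 \<omega> \<le> Bhi} \<le> prob {\<omega> \<in> space M. Bhi \<le> s1 \<omega>}"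
    by (intro finite_measure_mono) auto
  ultimately have s1_upper: "\<alpha> \<le> prob {\<omega> \<in> space M. Bhi \<le> s1 \<omega>}" using \<rho>_upper by linarith
  interpret cash_balance \<nu> L_D \<mu>_D k q Blo Bhi T h b "opt_value M T D k q h b" \<theta>s
  proof unfold_locales
    show "L_D-lipschitz_on UNIV (cdf \<nu>)" using lipschitz_D cdf by simp
    show "opt_value M T D k q h b (Suc T) = (\<lambda>_. 0)" by (simp add: opt_value_end)
    show "opt_value M T D k q h b t s = (INF y. trans_cost k q y s +
        (avg \<nu> (hold_cost (h t) (b t)) y + avg \<nu> (opt_value M T D k q h b (Suc t)) y))"
      if "t \<in> {1..T}" for t s
      using that by (simp add: opt_value_step ctg)
    show "integrable \<nu> (\<lambda>x. hold_cost (h t) (b t) (y - x))" if "t \<in> {1..T}" for t y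
      using finite_hold_cost[OF that] avg(2)[OF that hold_meas] by simp
    show "integrable \<nu> (\<lambda>x. opt_value M T D k q h b (Suc t) (y - x))" if "t \<in> {1..T}" for t y
      using finite_opt_value[OF that] avg(2)[OF that V_meas] by simp
  qed (use cdf_lower \<mu>_D_pos kq hb opt_feasible opt_lower opt_upper ctg in auto)
  show "cash_balance_process \<nu> L_D \<mu>_D k q Blo Bhi T h b (opt_value M T D k q h b) \<theta>s M s1 D \<alpha>"
  proof unfold_locales
    show "integrable M (\<lambda>\<omega>. \<Sum>t = 1..T.
        trans_cost k q (base_stock (\<theta> t) (inventory s1 D \<theta> t \<omega>)) (inventory s1 D \<theta> t \<omega>)
        + avg \<nu> (hold_cost (h t) (b t)) (base_stock (\<theta> t) (inventory s1 D \<theta> t \<omega>)))"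
      if "feasible \<theta>" for \<theta>
    proof -
      have "integrable M (total_cost M T s1 D k q h b \<theta>)"
        using that by (intro finite_objective) (auto simp: feasible_def)
      then show ?thesis by (simp add: total_cost_def[abs_def] Let_def hold)
    qed
  qed (use indep D_distr s1_null \<alpha>_pos \<rho>_lower \<rho> s1_upper D_upper_tail D_lower_tail in auto)
qed

section \<open>Return to the Euclidean parameter space\<close>

theorem theorem5:
  fixes M :: "'w measure"
    and T :: nat and e :: "nat \<Rightarrow> 'n::finite"
    and s1 :: "'w \<Rightarrow> real" and D :: "nat \<Rightarrow> 'w \<Rightarrow> real"
    and \<rho> F_D p :: "real \<Rightarrow> real"
    and k q :: real and h b :: "nat \<Rightarrow> real"
    and Blo Bhi \<alpha> \<mu>_D L_\<rho> L_D :: real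
    and \<theta>opt :: "(real \<times> real) ^ 'n"
  assumes prob: "prob_space M"
    and periods: "bij_betw e {1..T} UNIV"
    and cost_kq: "0 \<le> k + q"
    and cost_hb: "\<And>t. t \<in> {1..T} \<Longrightarrow> 0 \<le> h t \<and> 0 \<le> b t \<and> 0 < h t + b t"
    and indep: "prob_space.indep_vars M (\<lambda>_. borel) (\<lambda>i. if i = 0 then s1 else D i) {0..T}"
    and cdf_s1: "cdf (distr M borel s1) = \<rho>"
    and cdf_D: "\<And>t. t \<in> {1..T} \<Longrightarrow> cdf (distr M borel (D t)) = F_D"
    and lipschitz_\<rho>: "lipschitz_on L_\<rho> UNIV \<rho>"
    and lipschitz_D: "lipschitz_on L_D UNIV F_D"
    and \<alpha>_pos: "0 < \<alpha>"
    and \<rho>_lower: "\<alpha> \<le> \<rho> Blo"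
    and \<rho>_upper: "\<rho> Bhi \<le> 1 - \<alpha>"
    and D_upper_tail: "\<And>t. t \<in> {1..T} \<Longrightarrow> \<alpha> \<le> measure M {\<omega> \<in> space M. Bhi - Blo \<le> D t \<omega>}"
    and D_lower_tail: "\<And>t. t \<in> {1..T} \<Longrightarrow> \<alpha> \<le> measure M {\<omega> \<in> space M. D t \<omega> \<le> Blo - Bhi}"
    and density: "\<And>t. t \<in> {1..T} \<Longrightarrow> distributed M lborel (D t) (\<lambda>x. ennreal (p x))"
    and \<mu>_D_pos: "0 < \<mu>_D"
    and density_lower: "\<And>x. x \<in> {Blo..Bhi} \<Longrightarrow> \<mu>_D \<le> p x"
    and finite_hold_cost: "\<And>t y. t \<in> {1..T} \<Longrightarrow>
          integrable M (\<lambda>\<omega>. hold_cost (h t) (b t) (y - D t \<omega>))"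
    and finite_opt_value: "\<And>t y. t \<in> {1..T} \<Longrightarrow>
          integrable M (\<lambda>\<omega>. opt_value M T D k q h b (Suc t) (y - D t \<omega>))"
    and finite_objective: "\<And>\<theta> :: (real \<times> real) ^ 'n. \<theta> \<in> policy_params Blo Bhi \<Longrightarrow>
          integrable M (total_cost M T s1 D k q h b (\<lambda>t. \<theta> $ e t))"
    and opt_feasible: "\<theta>opt \<in> policy_params Blo Bhi"
    and opt_lower: "\<And>t y. t \<in> {1..T} \<Longrightarrow>
          k * fst (\<theta>opt $ e t) + cost_to_go M T D k q h b t (fst (\<theta>opt $ e t))
            \<le> k * y + cost_to_go M T D k q h b t y"
    and opt_upper: "\<And>t y. t \<in> {1..T} \<Longrightarrow>
          - q * snd (\<theta>opt $ e t) + cost_to_go M T D k q h b t (snd (\<theta>opt $ e t))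
            \<le> - q * y + cost_to_go M T D k q h b t y"
  shows "PLK_condition (policy_objective M T e s1 D k q h b) (policy_params Blo Bhi) \<theta>opt
           (Min ((\<lambda>t. h t + b t) ` {1..T}) ^ 3 * \<mu>_D ^ 3 * \<alpha> ^ 8 /
             (16 * exp 1 * L_D\<^sup>2 * (k + \<bar>q\<bar> + Max ((\<lambda>t. max (h t) (b t)) ` {1..T}))\<^sup>2
               * real T ^ 4))"
proof -
  interpret M: prob_space M by (rule prob)
  define \<nu> where "\<nu> = distr M borel (D 1)"
  define S :: "((real \<times> real) ^ 'n) set" where "S = policy_params Blo Bhi"
  define params :: "(real \<times> real) ^ 'n \<Rightarrow> nat \<Rightarrow> real \<times> real" where "params x t = x $ e t" for x t
  define coord :: "'n \<Rightarrow> nat" where "coord = inv_into {1..T} e"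
  have coord: "coord i \<in> {1..T}" "e (coord i) = i" for i
    unfolding coord_def using bij_betw_imp_surj_on[OF periods]
    by (metis UNIV_I inv_into_into, metis UNIV_I f_inv_into_f)
  have coord_e: "coord (e t) = t" if "t \<in> {1..T}" for t
    using periods that by (auto simp: coord_def bij_betw_def)
  have T: "1 \<le> T" using coord(1) by force
  have mem_S: "x \<in> S \<longleftrightarrow> (\<forall>t\<in>{1..T}. Blo \<le> fst (params x t) \<and> fst (params x t) \<le> snd (params x t) \<and> snd (params x t) \<le> Bhi)" for x
  proof -
    have "(\<forall>i. A i) \<longleftrightarrow> (\<forall>t\<in>{1..T}. A (e t))" for A
      using coord by metis
    then show ?thesis by (simp only: S_def policy_params_def params_def mem_Collect_eq)
  qed
  \<comment> \<open>Outside \<open>{1..T}\<close> a time-indexed policy is arbitrary; it is replaced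
    by the parameter vector that agrees with it on the periods.\<close>
  have finite_cost: "integrable M (total_cost M T s1 D k q h b \<theta>)"
    if \<theta>: "\<And>t. t \<in> {1..T} \<Longrightarrow> Blo \<le> fst (\<theta> t) \<and> fst (\<theta> t) \<le> snd (\<theta> t) \<and> snd (\<theta> t) \<le> Bhi" for \<theta>
  proof -
    define x :: "(real \<times> real) ^ 'n" where "x = (\<chi> i. \<theta> (coord i))"
    have x: "params x t = \<theta> t" if "t \<in> {1..T}" for t
      using coord_e[OF that] by (simp add: x_def params_def)
    then have "x \<in> S" using \<theta> by (simp add: mem_S)
    from finite_objective[OF this[unfolded S_def]]
    have "integrable M (total_cost M T s1 D k q h b (params x))" by (simp add: params_def[abs_def])
    moreover have "total_cost M T s1 D k q h b (params x) = total_cost M T s1 D k q h b \<theta>"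
      by (rule total_cost_cong) (rule x)
    ultimately show ?thesis by simp
  qed
  have opt: "\<theta>opt \<in> S" using opt_feasible by (simp add: S_def)
  note process = M.cash_balance_processI[where \<theta>s = "params \<theta>opt", OF T cost_kq cost_hb indep cdf_s1 cdf_D
      lipschitz_\<rho> lipschitz_D \<alpha>_pos \<rho>_lower \<rho>_upper D_upper_tail D_lower_tail density \<mu>_D_pos density_lower
      finite_hold_cost finite_opt_value finite_cost, folded \<nu>_def]
  have opt_params: "Blo \<le> fst (params \<theta>opt t) \<and> fst (params \<theta>opt t) \<le> snd (params \<theta>opt t) \<and> snd (params \<theta>opt t) \<le> Bhi"
    if "t \<in> {1..T}" for t
    using opt that by (simp add: mem_S)
  interpret cash_balance_process \<nu> L_D \<mu>_D k q Blo Bhi T h b "opt_value M T D k q h b" "params \<theta>opt" M s1 D \<alpha>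
    by (rule process(1)) (use opt_params opt_lower opt_upper in \<open>auto simp: params_def\<close>)
  have hold: "exp_hold_cost M D h b t = avg \<nu> (hold_cost (h t) (b t))" if "t \<in> {1..T}" for t
    by (rule process(2)) (use opt_params opt_lower opt_upper that in \<open>auto simp: params_def\<close>)
  have feasible: "feasible (params x) \<longleftrightarrow> x \<in> S" for x
    by (simp add: mem_S feasible_def)
  define obj where "obj = (policy_objective M T e s1 D k q h b :: (real \<times> real) ^ 'n \<Rightarrow> real)"
  have obj: "obj x = objective (params x)" for x
    unfolding obj_def policy_objective_def objective_def total_cost_def Let_def params_def
    by (simp add: hold)
  define grad :: "(real \<times> real) ^ 'n \<Rightarrow> (real \<times> real) ^ 'n" where
    "grad x = (\<chi> i. (grad_lo (params x) (coord i), grad_hi (params x) (coord i)))" for x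
  have inner_grad: "inner (grad x) d = (\<Sum>t = 1..T. grad_lo (params x) t * fst (d $ e t) + grad_hi (params x) t * snd (d $ e t))" for x d
  proof -
    have "inner (grad x) d = (\<Sum>t\<in>{1..T}. inner (grad x $ e t) (d $ e t))"
      unfolding inner_vec_def by (rule sum.reindex_bij_betw[OF periods, symmetric])
    also have "\<dots> = (\<Sum>t = 1..T. grad_lo (params x) t * fst (d $ e t) + grad_hi (params x) t * snd (d $ e t))"
      by (intro sum.cong) (auto simp: grad_def coord_e inner_prod_def)
    finally show ?thesis .
  qed
  have gradient: "has_gradient_within obj (grad x) x S" if x: "x \<in> S" for x
    unfolding has_gradient_within_def has_derivative_within
  proof
    show "bounded_linear (inner (grad x))" by (rule bounded_linear_inner_right)
    show "((\<lambda>y. (1 / norm (y - x)) *\<^sub>R (obj y - (obj x + inner (grad x) (y - x)))) \<longlongrightarrow> 0) (at x within S)"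
      unfolding tendsto_at_iff_sequentially
    proof (intro allI impI)
      fix X assume X: "\<forall>n. X n \<in> S - {x}" and lim: "X \<longlonglongrightarrow> x"
      have norm: "\<bar>fst (y $ i) - fst (x $ i)\<bar> \<le> norm (y - x)" "\<bar>snd (y $ i) - snd (x $ i)\<bar> \<le> norm (y - x)" for y i
        using norm_fst_le[of "fst ((y - x) $ i)" "snd ((y - x) $ i)"]
          norm_snd_le[of "snd ((y - x) $ i)" "fst ((y - x) $ i)"] Finite_Cartesian_Product.norm_nth_le[of "y - x" i]
        by (cases "y $ i"; cases "x $ i"; auto)+
      \<comment> \<open>\<open>norm (X n - x)\<close> plays the role of \<open>N n\<close>: it is
        positive because \<open>X n\<close> avoids \<open>x\<close>, and it dominates the change of
        every threshold.\<close>
      have "(\<lambda>n. (objective (params (X n)) - objective (params x)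
          - (\<Sum>t = 1..T. grad_lo (params x) t * (fst (params (X n) t) - fst (params x t))
            + grad_hi (params x) t * (snd (params (X n) t) - snd (params x t)))) / norm (X n - x)) \<longlonglongrightarrow> 0"
      proof (rule objective_first_order)
        show "(\<lambda>n. params (X n) t) \<longlonglongrightarrow> params x t" for t
          unfolding params_def by (intro tendsto_vec_nth lim)
      qed (use x X norm in \<open>auto simp: feasible params_def\<close>)
      then show "((\<lambda>y. (1 / norm (y - x)) *\<^sub>R (obj y - (obj x + inner (grad x) (y - x)))) \<circ> X) \<longlonglongrightarrow> 0"
        by (simp add: o_def obj inner_grad params_def diff_diff_eq)
    qed
  qed
  define m where "m = Min ((\<lambda>t. h t + b t) ` {1..T})"
  define C where "C = k + \<bar>q\<bar> + Max ((\<lambda>t. max (h t) (b t)) ` {1..T})"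
  have m: "0 < m" "\<And>t. t \<in> {1..T} \<Longrightarrow> m \<le> h t + b t"
    using T cost_hb by (auto simp: m_def)
  have C: "(h t + b t) + (k + q) \<le> 2 * C" if "t \<in> {1..T}" for t
  proof -
    \<comment> \<open>\<open>h t + b t\<close> is at most twice the maximum, and
      \<open>k + q \<le> 2 * (k + \<bar>q\<bar>)\<close> because \<open>- q \<le> k\<close>.\<close>
    have "max (h t) (b t) \<le> Max ((\<lambda>t. max (h t) (b t)) ` {1..T})" using that by (intro Max_ge) auto
    then show ?thesis using cost_kq by (auto simp: C_def)
  qed
  have "PLK_condition obj S \<theta>opt (m ^ 3 * \<mu>_D ^ 3 * \<alpha> ^ 8 / (16 * exp 1 * L_D\<^sup>2 * C\<^sup>2 * real T ^ 4))"
  proof (rule PLK_conditionI)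
    show "\<exists>G. has_gradient_within obj G x S" if "x \<in> S" for x
      using gradient[OF that] by blast
    show "0 \<le> m ^ 3 * \<mu>_D ^ 3 * \<alpha> ^ 8 / (16 * exp 1 * L_D\<^sup>2 * C\<^sup>2 * real T ^ 4)"
      using m \<mu>_D_pos by simp
    fix x G g assume x: "x \<in> S" and G: "has_gradient_within obj G x S" and g: "g \<in> normal_cone S x"
    have residual: "- (grad_lo (params x) t * u + grad_hi (params x) t * v) \<le> norm (G + g) * sqrt (u\<^sup>2 + v\<^sup>2)"
      if t: "t \<in> {1..T}" and uv: "Blo \<le> fst (params x t) + u" "fst (params x t) + u \<le> snd (params x t) + v"
        "snd (params x t) + v \<le> Bhi" for t u v
    proof -
      \<comment> \<open>A test direction that changes the thresholds of one period only.\<close>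
      define d :: "(real \<times> real) ^ 'n" where "d = axis (e t) (u, v)"
      have "x + d \<in> S"
        using x uv by (auto simp: S_def policy_params_def d_def axis_def params_def)
      from residual_lower_bound[OF G gradient[OF x] g _ x this]
      have "- inner (grad x) d \<le> norm (G + g) * norm d"
        by (simp add: S_def convex_policy_params)
      moreover have "inner (grad x) d = grad_lo (params x) t * u + grad_hi (params x) t * v"
        by (simp add: d_def inner_axis grad_def coord_e[OF t])
      moreover have "norm d = sqrt (u\<^sup>2 + v\<^sup>2)"
        by (simp add: d_def norm_eq_sqrt_inner inner_axis_axis power2_eq_square)
      ultimately show ?thesis by simp
    qed
    show "obj x - obj \<theta>opt \<le> 1 / (2 * (m ^ 3 * \<mu>_D ^ 3 * \<alpha> ^ 8 / (16 * exp 1 * L_D\<^sup>2 * C\<^sup>2 * real T ^ 4))) * (norm (G + g))\<^sup>2"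
      unfolding obj
      by (rule objective_gap_le_residual[OF feasible[THEN iffD2, OF x] norm_ge_zero T m C]) (assumption | erule (3) residual)+
  qed
  then show ?thesis by (simp only: obj_def S_def m_def C_def)
qed

end
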